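(* Assume that $k^\star\le\bar k_n\lesssim\log n/\log\log n$ and $\gamma\omega>M'\bar\epsilon_{n,k^\star}$ for a sufficiently large constant $M'>0$, where $$\bar\epsilon_{n,k^\star}:=(k^\star)^{3/2}\Big(\frac{\log^2n}{n}\Big)^{\frac1{4k^\star-2}}.$$ Then with the prior distribution $\Pi$ satisfying conditions (P1), (P2) and (P3) described in the context, we have $$\sup_{\nu^\star\in\mathcal M_{k^\star,k_0,\gamma,\omega}}\mathsf P^{(n)}_{\nu^\star*\Phi}\Big[\Pi\big(\mathsf W_1(\nu,\nu^\star)\ge M\epsilon_{n,k^\star,k_0,\gamma}\,\big|\,X_{1:n}\big)\Big]=o(1)$$ for some universal constant $M>0$, where $$\epsilon_{n,k^\star,k_0,\gamma}:=(k^\star)^{\frac{6k^\star-4k_0+3}{4(k^\star-k_0)+2}}\,\gamma^{-\frac{2k_0-2}{2(k^\star-k_0)+1}}\Big(\frac{\log^2n}{n}\Big)^{\frac{1}{4(k^\star-k_0)+2}}.$$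
   Context: Notation. $\mathbb N=\{1,2,\dots\}$, $[k]:=\{1,\dots,k\}$, $\Delta_k:=\{w\in[0,1]^k:\sum_{j=1}^k w_j=1\}$. For positive sequences, $a_n\lesssim b_n$ means that there is a constant $C>0$ with $a_n\le Cb_n$ for any $n\in\mathbb N$; $o(1)$ is as $n\to\infty$. Fix $L>0$. $\mathcal M_k$ is the set of distributions $\sum_{j=1}^k w_j\delta_{\theta_j}$ with $(w_1,\dots,w_k)\in\Delta_k$ and $\theta_1,\dots,\theta_k\in[-L,L]$ ($\delta_\theta$ is the Dirac measure at $\theta$), and $\mathcal M:=\bigcup_{k\in\mathbb N}\mathcal M_k$. $\Phi$ is the standard normal distribution and, for $\nu=\sum_j w_j\delta_{\theta_j}$, $\nu*\Phi=\sum_j w_j\mathrm N(\theta_j,1)$. $\mathsf P_G^{(n)}$ denotes probability or expectation when $X_1,\dots,X_n$ are i.i.d. from $G$, $p_G^{(n)}$ is the joint Lebesgue density, and $X_{1:n}=(X_1,\dots,X_n)$. For $\nu=\sum_{j=1}^kw_j\delta_{\theta_j}$ and $\nu'=\sum_{h=1}^{k'}w'_h\delta_{\theta'_h}$, $\mathsf W_1(\nu,\nu')$ is the infimum of $\sum_{j,h}p_{jh}|\theta_j-\theta'_h|$ over all $(p_{jh})\in[0,1]^{k\times k'}$ with $\sum_hp_{jh}=w_j$ and $\sum_jp_{jh}=w'_h$. Separation. An atomic distribution $\nu=\sum_{j=1}^kw_j\delta_{\theta_j}$ is $k_0$ $(\gamma,\omega)$-separated, for $k_0\in[k]$, $\gamma>0$,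 $\omega>0$, if there exists a partition $S_1,\dots,S_{k_0}$ of $[k]$ such that $|\theta_j-\theta_{j'}|\ge\gamma$ for any $j\in S_l$, $j'\in S_{l'}$ and any $l,l'\in[k_0]$ with $l\ne l'$, and $\sum_{j\in S_l}w_j\ge\omega$ for any $l\in[k_0]$. $\mathcal M_{k,k_0,\gamma,\omega}:=\{\nu\in\mathcal M_k:\nu\text{ is }k_0\ (\gamma,\omega)\text{-separated}\}$. Setting. The data are i.i.d. from $\nu^\star*\Phi$ with $\nu^\star\in\mathcal M_{k^\star}$; both the true mixing distribution $\nu^\star$ and the true number of components $k^\star\in\mathbb N$ may vary with $n$, and $\bar k_n$ is a known upper bound on $k^\star$. The prior $\Pi$ first samples $k\in\mathbb N$ from $\Pi(k)$ and then samples the atoms $\theta\in[-L,L]^k$ from $\Pi(\theta|k)$ and the weights $w\in\Delta_k$ from $\Pi(w|k)$, which induces a distribution on $\mathcal M$ through $\nu=\sum_{j=1}^kw_j\delta_{\theta_j}$. The posterior is $\Pi(\mathrm d\nu|X_{1:n}):=p^{(n)}_{\nu*\Phi}(X_{1:n})\Pi(\mathrm d\nu)\big/\int p^{(n)}_{\nu*\Phi}(X_{1:n})\Pi(\mathrm d\nu)$. Conditions on the prior. (P1) The prior on $k$ is sample size dependent. There are a constant $c_1>0$ and a sufficiently large constant $A>0$ such that for any $n\in\mathbb N$ and any $k^\circ\in\mathbb N$, $\Pi(k=k^\circ+1)/\Pi(k=k^\circ)\le c_1e^{-A\bar k_n\log n}$. Additionally, there are constants $c_2>0$ and $c_3>0$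 such that for any $n\in\mathbb N$ and any $k^\dagger\in[\bar k_n]$, $\Pi(k=k^\dagger)\ge c_2e^{-(c_3\bar k_n\log n)k^\dagger}$. (P2) For any $k\in\mathbb N$ and any $(w_1^0,\dots,w_k^0)\in\Delta_k$, there are positive constants $c_4$ and $c_5$ such that for any $\eta\in(0,1/k)$, $\Pi\big(\sum_{j=1}^k|w_j-w_j^0|\le\eta\,\big|\,k\big)\ge c_4\eta^{c_5k}$. (P3) For any $k\in\mathbb N$ and any $\theta^0\in[-L,L]^k$, there are positive constants $c_6$ and $c_7$ such that for any $\eta>0$, $\Pi\big(\max_{1\le j\le k}|\theta_j-\theta_j^0|\le\eta\,\big|\,k\big)\ge c_6\eta^{c_7k}$.
   Formalization: In (P3) the bound is required only for 0<η<1/k, since for all η>0 no prior satisfies it; the constants c4,…,c7 in (P2) and (P3) are taken uniform in k, w⁰ and θ⁰, since with constants depending on these points the uniform claim fails. *)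

theory Defs
  imports "HOL-Probability.Probability"
begin

text \<open>
  A vector of length \<open>k\<close> is an extensional function on \<open>{1..k}\<close>, so that the vectors of length \<open>k\<close>
  are the points of \<open>\<Pi>\<^sub>M j\<in>{1..k}. borel\<close>.
\<close>

definition weight_simplex :: "nat \<Rightarrow> (nat \<Rightarrow> real) set" where
  "weight_simplex k = {w \<in> {1..k} \<rightarrow>\<^sub>E {0..1}. (\<Sum>j\<in>{1..k}. w j) = 1}"

definition atom_cube :: "real \<Rightarrow> nat \<Rightarrow> (nat \<Rightarrow> real) set" where
  "atom_cube L k = {1..k} \<rightarrow>\<^sub>E {-L..L}"

text \<open>
  The distribution \<open>\<Sum>\<^sub>j w\<^sub>j \<delta>\<^bsub>\<theta>\<^sub>j\<^esub>\<close>, as the image under \<open>\<theta>\<close> of the distribution \<open>w\<close> on \<open>{1..k}\<close>.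
\<close>

definition mixing :: "nat \<Rightarrow> (nat \<Rightarrow> real) \<Rightarrow> (nat \<Rightarrow> real) \<Rightarrow> real measure" where
  "mixing k w \<theta> = distr (point_measure {1..k} (\<lambda>j. ennreal (w j))) borel \<theta>"

definition mixings :: "real \<Rightarrow> nat \<Rightarrow> real measure set" where
  "mixings L k = {mixing k w \<theta> | w \<theta>. w \<in> weight_simplex k \<and> \<theta> \<in> atom_cube L k}"

definition separated_atoms ::
    "nat \<Rightarrow> (nat \<Rightarrow> real) \<Rightarrow> (nat \<Rightarrow> real) \<Rightarrow> nat \<Rightarrow> real \<Rightarrow> real \<Rightarrow> bool" where
  "separated_atoms k w \<theta> k0 \<gamma> \<omega> \<longleftrightarrow>
     (\<exists>P. partition_on {1..k} P \<and> card P = k0 \<and>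
        (\<forall>S\<in>P. \<forall>T\<in>P. S \<noteq> T \<longrightarrow> (\<forall>i\<in>S. \<forall>j\<in>T. \<bar>\<theta> i - \<theta> j\<bar> \<ge> \<gamma>)) \<and>
        (\<forall>S\<in>P. (\<Sum>j\<in>S. w j) \<ge> \<omega>))"

definition separated_mixings :: "real \<Rightarrow> nat \<Rightarrow> nat \<Rightarrow> real \<Rightarrow> real \<Rightarrow> real measure set" where
  "separated_mixings L k k0 \<gamma> \<omega> =
     {mixing k w \<theta> | w \<theta>. w \<in> weight_simplex k \<and> \<theta> \<in> atom_cube L k \<and> separated_atoms k w \<theta> k0 \<gamma> \<omega>}"

definition couplings ::
    "nat \<Rightarrow> (nat \<Rightarrow> real) \<Rightarrow> nat \<Rightarrow> (nat \<Rightarrow> real) \<Rightarrow> (nat \<Rightarrow> nat \<Rightarrow> real) set" where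
  "couplings k w k' w' =
     {p. (\<forall>j\<in>{1..k}. \<forall>h\<in>{1..k'}. p j h \<in> {0..1}) \<and>
         (\<forall>j\<in>{1..k}. (\<Sum>h\<in>{1..k'}. p j h) = w j) \<and>
         (\<forall>h\<in>{1..k'}. (\<Sum>j\<in>{1..k}. p j h) = w' h)}"

definition transport_cost ::
    "nat \<Rightarrow> (nat \<Rightarrow> real) \<Rightarrow> nat \<Rightarrow> (nat \<Rightarrow> real) \<Rightarrow> (nat \<Rightarrow> nat \<Rightarrow> real) \<Rightarrow> real" where
  "transport_cost k \<theta> k' \<theta>' p = (\<Sum>j\<in>{1..k}. \<Sum>h\<in>{1..k'}. p j h * \<bar>\<theta> j - \<theta>' h\<bar>)"

text \<open>
  The first Wasserstein distance of two finitely supported distributions. The infimum ranges also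
  over the representations \<open>(k, w, \<theta>)\<close> of the two distributions, because a distribution does not
  determine its representation; the infimum over the couplings alone is the same for all
  representations (lemma \<open>wasserstein1_mixing\<close> below).
\<close>

definition wasserstein1 :: "real measure \<Rightarrow> real measure \<Rightarrow> real" where
  "wasserstein1 \<nu> \<nu>' = Inf {transport_cost k \<theta> k' \<theta>' p | k w \<theta> k' w' \<theta>' p.
     w \<in> weight_simplex k \<and> w' \<in> weight_simplex k' \<and> \<nu> = mixing k w \<theta> \<and> \<nu>' = mixing k' w' \<theta>' \<and>
     p \<in> couplings k w k' w'}"

definition std_normal :: "real measure" where
  "std_normal = density lborel (\<lambda>x. ennreal (std_normal_density x))"

text \<open>
  The Lebesgue density of \<open>\<nu> \<star> std_normal\<close> (lemma \<open>convolution_std_normal\<close> below), and the joint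
  density of \<open>n\<close> independent observations \<open>x 1, \<dots>, x n\<close>.
\<close>

definition mixture_density :: "real measure \<Rightarrow> real \<Rightarrow> ennreal" where
  "mixture_density \<nu> x = (\<integral>\<^sup>+ t. ennreal (normal_density t 1 x) \<partial>\<nu>)"

definition joint_density :: "nat \<Rightarrow> real measure \<Rightarrow> (nat \<Rightarrow> real) \<Rightarrow> ennreal" where
  "joint_density n \<nu> x = (\<Prod>i\<in>{1..n}. mixture_density \<nu> (x i))"

definition iid_data :: "nat \<Rightarrow> real measure \<Rightarrow> (nat \<Rightarrow> real) measure" where
  "iid_data n G = (\<Pi>\<^sub>M i\<in>{1..n}. G)"

text \<open>
  A prior is given by the distribution \<open>\<pi>\<close> of \<open>k\<close> and, for each \<open>k\<close>, the conditional distributions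
  \<open>W k\<close> of the weights and \<open>T k\<close> of the atoms. The integral \<open>\<integral> f(\<nu>) \<Pi>(d\<nu>)\<close> with respect to the
  induced distribution of \<open>\<nu>\<close> is written by change of variables as an integral over \<open>(k, w, \<theta>)\<close>.
\<close>

definition is_prior ::
    "real \<Rightarrow> nat pmf \<Rightarrow> (nat \<Rightarrow> (nat \<Rightarrow> real) measure) \<Rightarrow> (nat \<Rightarrow> (nat \<Rightarrow> real) measure) \<Rightarrow> bool" where
  "is_prior L \<pi> W T \<longleftrightarrow>
     pmf \<pi> 0 = 0 \<and>
     (\<forall>k\<ge>1. prob_space (W k) \<and> sets (W k) = sets (\<Pi>\<^sub>M j\<in>{1..k}. (borel :: real measure)) \<and>
        (AE w in W k. w \<in> weight_simplex k)) \<and>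
     (\<forall>k\<ge>1. prob_space (T k) \<and> sets (T k) = sets (\<Pi>\<^sub>M j\<in>{1..k}. (borel :: real measure)) \<and>
        (AE \<theta> in T k. \<theta> \<in> atom_cube L k))"

definition prior_integral ::
    "nat pmf \<Rightarrow> (nat \<Rightarrow> (nat \<Rightarrow> real) measure) \<Rightarrow> (nat \<Rightarrow> (nat \<Rightarrow> real) measure) \<Rightarrow>
     (real measure \<Rightarrow> ennreal) \<Rightarrow> ennreal" where
  "prior_integral \<pi> W T f =
     (\<integral>\<^sup>+ k. (\<integral>\<^sup>+ (w, \<theta>). f (mixing k w \<theta>) \<partial>(W k \<Otimes>\<^sub>M T k)) \<partial>measure_pmf \<pi>)"

definition posterior ::
    "nat \<Rightarrow> nat pmf \<Rightarrow> (nat \<Rightarrow> (nat \<Rightarrow> real) measure) \<Rightarrow> (nat \<Rightarrow> (nat \<Rightarrow> real) measure) \<Rightarrow>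
     (nat \<Rightarrow> real) \<Rightarrow> real measure set \<Rightarrow> ennreal" where
  "posterior n \<pi> W T x B =
     prior_integral \<pi> W T (\<lambda>\<nu>. joint_density n \<nu> x * indicator B \<nu>) /
     prior_integral \<pi> W T (\<lambda>\<nu>. joint_density n \<nu> x)"

text \<open>
  The ratio condition on the prior of \<open>k\<close> is stated without a division, since
  \<open>pmf (\<pi> n) k\<close> may vanish for large \<open>k\<close>.
\<close>

definition prior_P1 ::
    "real \<Rightarrow> real \<Rightarrow> real \<Rightarrow> real \<Rightarrow> (nat \<Rightarrow> nat) \<Rightarrow> (nat \<Rightarrow> nat pmf) \<Rightarrow> bool" where
  "prior_P1 c1 A c2 c3 kbar \<pi> \<longleftrightarrow>
     (\<forall>n\<ge>1. \<forall>k\<ge>1. pmf (\<pi> n) (k + 1) \<le> c1 * exp (- A * real (kbar n) * ln (real n)) * pmf (\<pi> n) k) \<and>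
     (\<forall>n\<ge>1. \<forall>k\<in>{1..kbar n}. pmf (\<pi> n) k \<ge> c2 * exp (- (c3 * real (kbar n) * ln (real n)) * real k))"

definition prior_P2 :: "real \<Rightarrow> real \<Rightarrow> (nat \<Rightarrow> (nat \<Rightarrow> real) measure) \<Rightarrow> bool" where
  "prior_P2 c4 c5 W \<longleftrightarrow>
     (\<forall>k\<ge>1. \<forall>w0\<in>weight_simplex k. \<forall>\<eta>. 0 < \<eta> \<and> \<eta> < 1 / real k \<longrightarrow>
        measure (W k) {w \<in> space (W k). (\<Sum>j\<in>{1..k}. \<bar>w j - w0 j\<bar>) \<le> \<eta>} \<ge> c4 * \<eta> powr (c5 * real k))"

text \<open>
  The radius is restricted to \<open>0 < \<eta> < 1/k\<close> as for the weights: for \<open>\<eta> \<rightarrow> \<infinity>\<close> the lower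
  bound exceeds 1, so no prior satisfies it for all \<open>\<eta> > 0\<close>.
\<close>

definition prior_P3 :: "real \<Rightarrow> real \<Rightarrow> real \<Rightarrow> (nat \<Rightarrow> (nat \<Rightarrow> real) measure) \<Rightarrow> bool" where
  "prior_P3 L c6 c7 T \<longleftrightarrow>
     (\<forall>k\<ge>1. \<forall>\<theta>0\<in>atom_cube L k. \<forall>\<eta>. 0 < \<eta> \<and> \<eta> < 1 / real k \<longrightarrow>
        measure (T k) {\<theta> \<in> space (T k). (MAX j\<in>{1..k}. \<bar>\<theta> j - \<theta>0 j\<bar>) \<le> \<eta>} \<ge> c6 * \<eta> powr (c7 * real k))"

definition eps_bar :: "nat \<Rightarrow> nat \<Rightarrow> real" where
  "eps_bar n k = real k powr (3 / 2) * ((ln (real n))\<^sup>2 / real n) powr (1 / (4 * real k - 2))"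

definition eps_sep :: "nat \<Rightarrow> nat \<Rightarrow> nat \<Rightarrow> real \<Rightarrow> real" where
  "eps_sep n k k0 \<gamma> =
     real k powr ((6 * real k - 4 * real k0 + 3) / (4 * (real k - real k0) + 2)) *
     \<gamma> powr (- ((2 * real k0 - 2) / (2 * (real k - real k0) + 1))) *
     ((ln (real n))\<^sup>2 / real n) powr (1 / (4 * (real k - real k0) + 2))"

lemma convolution_std_normal:
  assumes "prob_space \<nu>" "sets \<nu> = sets borel"
  shows "\<nu> \<star> std_normal = density lborel (mixture_density \<nu>)"
proof (rule measure_eqI)
  interpret prob_space \<nu> by fact
  interpret pair_sigma_finite \<nu> lborel ..
  have N: "prob_space std_normal"
    unfolding std_normal_def by (rule prob_space_normal_density) simp
  note [measurable_cong] = assms(2)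
  show "sets (\<nu> \<star> std_normal) = sets (density lborel (mixture_density \<nu>))" by simp
  fix A assume "A \<in> sets (\<nu> \<star> std_normal)"
  then have A[measurable]: "A \<in> sets borel" by simp
  have [measurable]: "mixture_density \<nu> \<in> borel_measurable borel"
    unfolding mixture_density_def normal_density_def by measurable
  have sh: "(\<integral>\<^sup>+ y. indicator A (t + y) \<partial>std_normal)
      = (\<integral>\<^sup>+ x. ennreal (normal_density t 1 x) * indicator A x \<partial>lborel)" for t
  proof -
    have "(\<integral>\<^sup>+ y. indicator A (t + y) \<partial>std_normal)
        = (\<integral>\<^sup>+ y. ennreal (std_normal_density y) * indicator A (t + y) \<partial>lborel)"
      unfolding std_normal_def by (subst nn_integral_density) auto
    also have "\<dots> = (\<integral>\<^sup>+ x. ennreal (normal_density t 1 x) * indicator A x \<partial>lborel)"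
      by (subst (2) nn_integral_real_affine[where c = 1 and t = t])
         (auto simp: normal_density_def)
    finally show ?thesis .
  qed
  have "emeasure (\<nu> \<star> std_normal) A = (\<integral>\<^sup>+ x. indicator A x \<partial>(\<nu> \<star> std_normal))"
    by simp
  also have "\<dots> = (\<integral>\<^sup>+ t. \<integral>\<^sup>+ y. indicator A (t + y) \<partial>std_normal \<partial>\<nu>)"
    using assms N by (subst nn_integral_convolution)
      (auto simp: std_normal_def prob_space.finite_measure finite_measure_axioms)
  also have "\<dots> = (\<integral>\<^sup>+ t. \<integral>\<^sup>+ x. ennreal (normal_density t 1 x) * indicator A x \<partial>lborel \<partial>\<nu>)"
    by (simp add: sh)
  also have "\<dots> = (\<integral>\<^sup>+ x. \<integral>\<^sup>+ t. ennreal (normal_density t 1 x) * indicator A x \<partial>\<nu> \<partial>lborel)"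
    by (rule Fubini'[symmetric]) (unfold normal_density_def, measurable)
  also have "\<dots> = (\<integral>\<^sup>+ x. mixture_density \<nu> x * indicator A x \<partial>lborel)"
    unfolding mixture_density_def normal_density_def
    by (intro nn_integral_cong nn_integral_multc) measurable
  also have "\<dots> = emeasure (density lborel (mixture_density \<nu>)) A"
    by (simp add: emeasure_density)
  finally show "emeasure (\<nu> \<star> std_normal) A = emeasure (density lborel (mixture_density \<nu>)) A" .
qed

lemma emeasure_mixing_singleton:
  assumes "w \<in> weight_simplex k"
  shows "emeasure (mixing k w \<theta>) {t} = ennreal (\<Sum>j\<in>{j\<in>{1..k}. \<theta> j = t}. w j)"
proof -
  have "emeasure (mixing k w \<theta>) {t}
      = emeasure (point_measure {1..k} (\<lambda>j. ennreal (w j))) {j\<in>{1..k}. \<theta> j = t}"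
    unfolding mixing_def
    by (subst emeasure_distr) (auto simp: space_point_measure measurable_def sets_point_measure
        intro!: arg_cong2[where f = emeasure])
  also have "\<dots> = (\<Sum>j\<in>{j\<in>{1..k}. \<theta> j = t}. ennreal (w j))"
    by (subst emeasure_point_measure_finite) auto
  also have "\<dots> = ennreal (\<Sum>j\<in>{j\<in>{1..k}. \<theta> j = t}. w j)"
    using assms by (intro sum_ennreal) (auto simp: weight_simplex_def PiE_def Pi_def)
  finally show ?thesis .
qed

lemma atom_mass_eq:
  assumes "w \<in> weight_simplex k" "v \<in> weight_simplex m" "mixing k w \<theta> = mixing m v \<phi>"
  shows "(\<Sum>j\<in>{j\<in>{1..k}. \<theta> j = t}. w j) = (\<Sum>j\<in>{j\<in>{1..m}. \<phi> j = t}. v j)"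
proof -
  have nn: "0 \<le> (\<Sum>j\<in>{j\<in>{1..k}. \<theta> j = t}. w j)" "0 \<le> (\<Sum>j\<in>{j\<in>{1..m}. \<phi> j = t}. v j)"
    using assms by (auto intro!: sum_nonneg simp: weight_simplex_def PiE_def Pi_def)
  show ?thesis
    using emeasure_mixing_singleton[OF assms(1), of \<theta> t]
      emeasure_mixing_singleton[OF assms(2), of \<phi> t] assms(3) nn by (simp add: ennreal_inj)
qed

lemma prob_space_mixing:
  assumes "w \<in> weight_simplex k"
  shows "prob_space (mixing k w \<theta>)"
proof -
  have "emeasure (point_measure {1..k} (\<lambda>j. ennreal (w j))) {1..k} = (\<Sum>j\<in>{1..k}. ennreal (w j))"
    by (subst emeasure_point_measure_finite) auto
  also have "\<dots> = ennreal (\<Sum>j\<in>{1..k}. w j)"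
    using assms by (intro sum_ennreal) (auto simp: weight_simplex_def PiE_def Pi_def)
  also have "\<dots> = 1" using assms by (simp add: weight_simplex_def)
  finally have "prob_space (point_measure {1..k} (\<lambda>j. ennreal (w j)))"
    by (intro prob_spaceI) (simp add: space_point_measure)
  then show ?thesis
    unfolding mixing_def by (intro prob_space.prob_space_distr) (auto simp: measurable_def space_point_measure sets_point_measure)
qed

text \<open>Changing the representation of the first marginal does not change the attainable costs.\<close>

lemma coupling_change_left:
  assumes w: "w \<in> weight_simplex k" and v: "v \<in> weight_simplex m"
    and eq: "mixing k w \<theta> = mixing m v \<phi>" and p: "p \<in> couplings k w k' w'"
  shows "\<exists>q\<in>couplings m v k' w'. transport_cost m \<phi> k' \<theta>' q = transport_cost k \<theta> k' \<theta>' p"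
proof -
  define B where "B t = {j\<in>{1..k}. \<theta> j = t}" for t
  define D where "D t = {i\<in>{1..m}. \<phi> i = t}" for t
  define b where "b t = sum w (B t)" for t
  have fin[simp]: "finite (B t)" "finite (D t)" for t by (auto simp: B_def D_def)
  have bD: "sum v (D t) = b t" for t
    using atom_mass_eq[OF w v eq, of t] by (simp add: B_def D_def b_def)
  have w0: "0 \<le> w j" "w j \<le> 1" if "j \<in> {1..k}" for j using w that by (auto simp: weight_simplex_def PiE_def Pi_def)
  have v0: "0 \<le> v j" "v j \<le> 1" if "j \<in> {1..m}" for j using v that by (auto simp: weight_simplex_def PiE_def Pi_def)
  have p0: "0 \<le> p j h" if "j \<in> {1..k}" "h \<in> {1..k'}" for j h using p that by (auto simp: couplings_def)
  have pw: "(\<Sum>h\<in>{1..k'}. p j h) = w j" if "j \<in> {1..k}" for j using p that by (auto simp: couplings_def)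
  have pw': "(\<Sum>j\<in>{1..k}. p j h) = w' h" if "h \<in> {1..k'}" for h using p that by (auto simp: couplings_def)
  define a where "a t h = (\<Sum>j\<in>B t. p j h)" for t h
  have a0: "0 \<le> a t h" if "h \<in> {1..k'}" for t h
    unfolding a_def using that p0 by (intro sum_nonneg) (auto simp: B_def)
  have ab: "(\<Sum>h\<in>{1..k'}. a t h) = b t" for t
    unfolding a_def b_def by (subst sum.swap) (rule sum.cong[OF refl], rule pw, simp add: B_def)
  have az: "a t h = 0" if "b t = 0" "h \<in> {1..k'}" for t h
    using sum_nonneg_eq_0_iff[of "{1..k'}" "a t"] ab[of t] a0[of _ t] that by (metis finite_atLeastAtMost)
  define q where "q i h = v i / b (\<phi> i) * a (\<phi> i) h" for i h
  have bnn: "0 \<le> b t" for t unfolding b_def using w0 by (intro sum_nonneg) (auto simp: B_def)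
  have q0: "0 \<le> q i h" if "i \<in> {1..m}" "h \<in> {1..k'}" for i h
    unfolding q_def using that v0 a0 bnn by auto
  have vb: "v i \<le> b (\<phi> i)" if "i \<in> {1..m}" for i
    unfolding bD[symmetric] using that v0 by (intro member_le_sum) (auto simp: D_def)
  have qv: "(\<Sum>h\<in>{1..k'}. q i h) = v i" if "i \<in> {1..m}" for i
  proof -
    have "(\<Sum>h\<in>{1..k'}. q i h) = v i / b (\<phi> i) * b (\<phi> i)"
      unfolding q_def by (simp only: sum_distrib_left[symmetric] ab)
    then show ?thesis using vb[OF that] v0[OF that] by auto
  qed
  have q1: "q i h \<le> 1" if "i \<in> {1..m}" "h \<in> {1..k'}" for i h
  proof -
    have "q i h \<le> (\<Sum>h\<in>{1..k'}. q i h)" using that q0 by (intro member_le_sum) auto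
    then show ?thesis using qv v0 that by force
  qed
  have qa: "(\<Sum>i\<in>D t. q i h) = a t h" if h: "h \<in> {1..k'}" for t h
  proof -
    have "(\<Sum>i\<in>D t. q i h) = (\<Sum>i\<in>D t. v i * (a t h / b t))"
      by (intro sum.cong) (auto simp: q_def D_def)
    also have "\<dots> = b t * (a t h / b t)" by (simp only: sum_distrib_right[symmetric] bD)
    also have "\<dots> = a t h" using az[OF _ h, of t] by auto
    finally show ?thesis .
  qed
  define R where "R = \<theta> ` {1..k} \<union> \<phi> ` {1..m}"
  have R: "finite R" "\<theta> ` {1..k} \<subseteq> R" "\<phi> ` {1..m} \<subseteq> R" by (auto simp: R_def)
  have grp1: "(\<Sum>j\<in>{1..k}. f j) = (\<Sum>t\<in>R. \<Sum>j\<in>B t. f j)" for f :: "nat \<Rightarrow> real"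
    using sum.group[OF _ R(1) R(2), of f] by (simp add: B_def)
  have grp2: "(\<Sum>j\<in>{1..m}. f j) = (\<Sum>t\<in>R. \<Sum>j\<in>D t. f j)" for f :: "nat \<Rightarrow> real"
    using sum.group[OF _ R(1) R(3), of f] by (simp add: D_def)
  have qw': "(\<Sum>i\<in>{1..m}. q i h) = w' h" if "h \<in> {1..k'}" for h
    unfolding grp2 pw'[OF that, symmetric] grp1 qa[OF that] a_def ..
  have swap: "transport_cost l \<psi> k' \<theta>' r = (\<Sum>h\<in>{1..k'}. \<Sum>j\<in>{1..l}. r j h * \<bar>\<psi> j - \<theta>' h\<bar>)" for l \<psi> r
    unfolding transport_cost_def by (rule sum.swap)
  have "transport_cost k \<theta> k' \<theta>' p = (\<Sum>h\<in>{1..k'}. \<Sum>t\<in>R. a t h * \<bar>t - \<theta>' h\<bar>)"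
    unfolding swap grp1 a_def sum_distrib_right by (intro sum.cong refl) (simp add: B_def)
  moreover have "transport_cost m \<phi> k' \<theta>' q = (\<Sum>h\<in>{1..k'}. \<Sum>t\<in>R. (\<Sum>i\<in>D t. q i h) * \<bar>t - \<theta>' h\<bar>)"
    unfolding swap grp2 sum_distrib_right by (intro sum.cong refl) (simp add: D_def)
  ultimately have "transport_cost m \<phi> k' \<theta>' q = transport_cost k \<theta> k' \<theta>' p"
    by (simp add: qa)
  moreover have "q \<in> couplings m v k' w'"
    using q0 q1 qv qw' by (auto simp: couplings_def)
  ultimately show ?thesis by blast
qed

lemma coupling_transpose:
  assumes "p \<in> couplings k w k' w'"
  shows "(\<lambda>h j. p j h) \<in> couplings k' w' k w"
    and "transport_cost k' \<theta>' k \<theta> (\<lambda>h j. p j h) = transport_cost k \<theta> k' \<theta>' p"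
proof -
  show "(\<lambda>h j. p j h) \<in> couplings k' w' k w" using assms by (auto simp: couplings_def)
  show "transport_cost k' \<theta>' k \<theta> (\<lambda>h j. p j h) = transport_cost k \<theta> k' \<theta>' p"
    unfolding transport_cost_def by (subst sum.swap) (simp add: abs_minus_commute)
qed

lemma wasserstein1_mixing:
  assumes w: "w \<in> weight_simplex k" and w': "w' \<in> weight_simplex k'"
  shows "wasserstein1 (mixing k w \<theta>) (mixing k' w' \<theta>') =
    (INF p\<in>couplings k w k' w'. transport_cost k \<theta> k' \<theta>' p)"
proof -
  have "\<exists>q\<in>couplings k w k' w'. transport_cost k \<theta> k' \<theta>' q = transport_cost m \<phi> m' \<phi>' p"
    if v: "v \<in> weight_simplex m" and v': "v' \<in> weight_simplex m'"
      and e: "mixing k w \<theta> = mixing m v \<phi>" and e': "mixing k' w' \<theta>' = mixing m' v' \<phi>'"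
      and p: "p \<in> couplings m v m' v'" for m v \<phi> m' v' \<phi>' p
  proof -
    obtain q where q: "q \<in> couplings k w m' v'"
      "transport_cost k \<theta> m' \<phi>' q = transport_cost m \<phi> m' \<phi>' p"
      using coupling_change_left[OF v w e[symmetric] p] by blast
    obtain r where r: "r \<in> couplings k' w' k w"
      "transport_cost k' \<theta>' k \<theta> r = transport_cost m' \<phi>' k \<theta> (\<lambda>h j. q j h)"
      using coupling_change_left[OF v' w' e'[symmetric] coupling_transpose(1)[OF q(1)]] by blast
    show ?thesis
      using coupling_transpose(1)[OF r(1)] coupling_transpose(2)[OF r(1), of \<theta> \<theta>']
        coupling_transpose(2)[OF q(1), of \<phi>' \<theta>] r(2) q(2) by auto
  qed
  then have "{transport_cost m \<phi> m' \<phi>' p | m v \<phi> m' v' \<phi>' p.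
      v \<in> weight_simplex m \<and> v' \<in> weight_simplex m' \<and> mixing k w \<theta> = mixing m v \<phi> \<and>
      mixing k' w' \<theta>' = mixing m' v' \<phi>' \<and> p \<in> couplings m v m' v'}
    = transport_cost k \<theta> k' \<theta>' ` couplings k w k' w'"
    using w w' by (auto simp: image_iff) metis+
  then show ?thesis unfolding wasserstein1_def by simp
qed

end

theory Submission
  imports Defs "HOL-Real_Asymp.Real_Asymp"
begin

text \<open>The two supports together have at most \<open>2 * k\<close> points, and the recursion
  over blocks of \<open>m\<close> consecutive points pays \<open>2 * (1 + L) / s m\<close> for each
  \<open>m\<close> from 2 to \<open>2 * k\<close>, where \<open>s m\<close> bounds from below the
  length of a block of \<open>m\<close> points around the gap. A block of at most
  \<open>2 * (k - k0) + 2\<close> points may be no longer than the gap \<open>g\<close>, which costs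
  \<open>2 * (k - k0) + 1\<close> factors \<open>1 / g\<close>; longer blocks span more and more
  clusters, which gains a squared factorial. A difference of distribution functions is at most 1, so
  \<open>g\<close> times this difference is bounded by a root of order
  \<open>2 * (k - k0) + 1\<close>, uniformly in \<open>g\<close>: this is the exponent of the rate.

  Since \<open>k\<close> may grow, all constants must be tracked in \<open>k\<close>. The second
  moment of the Hermite polynomial of degree \<open>2 * k - 1\<close> is at most
  \<open>(2 * k) ^ (2 * k)\<close> up to exponential factors, and its square root gives the power of
  \<open>k\<close> in the rate. The prior masses to be compensated are of order
  \<open>exp (- s)\<close> with \<open>s\<close> a multiple of \<open>kb * k * ln n\<close>, which
  fixes the accuracy of the tests; the bound on \<open>kb\<close> turns \<open>kb * ln n\<close>
  into the squared logarithm.\<close>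

text \<open>
  If the moments of order less than \<open>2 k\<close> of two mixing distributions with at most \<open>k\<close> atoms are
  close, then at every gap \<open>g\<close> of their joint support the two distribution functions are close, with a
  loss of one factor \<open>1 / g\<close> per atom and of only \<open>1 / \<gamma>\<close> for atoms in different clusters. Integrating
  over the gaps bounds \<open>W\<^sub>1\<close>. Without using the clusters this gives the rate \<open>eps_bar\<close>; by \<open>\<gamma> \<omega> > M' eps_bar\<close>
  the second distribution then has an atom near each cluster of the first one, and a second
  application gives the rate \<open>eps_sep\<close>.

  Moments are unbiasedly estimated by Hermite polynomials, and their empirical means, made robust
  by Catoni's influence function, give tests with exponentially small errors, so that no covering of
  the parameter space is needed. The evidence is bounded from below by the average likelihood over a
  ball of radius \<open>1 / n\<^sup>2\<close>, which is within \<open>O(1 / n)\<close> of the true likelihood in \<open>L\<^sup>1\<close>. Models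
  with \<open>k > k\<^sup>*\<close> are excluded by the prior alone.
\<close>

section \<open>Transport on the line\<close>

lemma measurable_point_mixing [measurable]:
  "\<theta> \<in> measurable (point_measure {1..k} f) borel" for \<theta> :: "nat \<Rightarrow> real"
  by (auto simp: measurable_def space_point_measure sets_point_measure)

lemma nn_integral_mixing:
  assumes [measurable]: "f \<in> borel_measurable borel"
  shows "(\<integral>\<^sup>+ t. f t \<partial>mixing k w \<theta>) = (\<Sum>j\<in>{1..k}. ennreal (w j) * f (\<theta> j))"
  unfolding mixing_def by (subst nn_integral_distr) (auto simp: nn_integral_point_measure_finite)

lemma emeasure_mixing:
  assumes "A \<in> sets borel"
  shows "emeasure (mixing k w \<theta>) A = (\<Sum>j\<in>{1..k}. ennreal (w j) * indicator A (\<theta> j))"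
proof -
  have "emeasure (mixing k w \<theta>) A = (\<integral>\<^sup>+ t. indicator A t \<partial>mixing k w \<theta>)"
    using assms by (simp add: mixing_def)
  then show ?thesis using assms by (simp add: nn_integral_mixing)
qed

text \<open>Two distributions become comparable once both are written on one list of atoms
  \<open>t\<close>: repeated atoms are merged, and points of \<open>t\<close> outside the support
  get weight 0. The weights are restricted to \<open>{1..N}\<close> because
  \<open>weight_simplex N\<close> consists of extensional functions.\<close>

lemma mixing_regroup:
  assumes w: "\<And>j. j \<in> {1..k} \<Longrightarrow> 0 \<le> w j"
    and inj: "inj_on t {1..N}" and sub: "\<theta> ` {1..k} \<subseteq> t ` {1..N}"
  shows "mixing k w \<theta> = mixing N (\<lambda>i\<in>{1..N}. \<Sum>j\<in>{j\<in>{1..k}. \<theta> j = t i}. w j) t" (is "_ = mixing N ?a t")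
proof (rule measure_eqI)
  show "sets (mixing k w \<theta>) = sets (mixing N ?a t)" by (simp add: mixing_def)
  fix A assume "A \<in> sets (mixing k w \<theta>)"
  then have A: "A \<in> sets borel" by (simp add: mixing_def)
  have "(\<Sum>j\<in>{1..k}. ennreal (w j) * indicator A (\<theta> j))
      = (\<Sum>s\<in>t ` {1..N}. \<Sum>j\<in>{j\<in>{1..k}. \<theta> j = s}. ennreal (w j) * indicator A (\<theta> j))"
    by (rule sum.group[symmetric]) (use sub in auto)
  also have "\<dots> = (\<Sum>i\<in>{1..N}. \<Sum>j\<in>{j\<in>{1..k}. \<theta> j = t i}. ennreal (w j) * indicator A (\<theta> j))"
    by (subst sum.reindex[OF inj]) (simp only: o_def)
  also have "\<dots> = (\<Sum>i\<in>{1..N}. ennreal (?a i) * indicator A (t i))"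
  proof (rule sum.cong[OF refl])
    fix i assume i: "i \<in> {1..N}"
    have "(\<Sum>j\<in>{j\<in>{1..k}. \<theta> j = t i}. ennreal (w j) * indicator A (\<theta> j))
        = (\<Sum>j\<in>{j\<in>{1..k}. \<theta> j = t i}. ennreal (w j)) * indicator A (t i)"
      by (simp add: sum_distrib_right)
    also have "(\<Sum>j\<in>{j\<in>{1..k}. \<theta> j = t i}. ennreal (w j)) = ennreal (?a i)"
      using w i by (subst sum_ennreal) auto
    finally show "(\<Sum>j\<in>{j\<in>{1..k}. \<theta> j = t i}. ennreal (w j) * indicator A (\<theta> j))
      = ennreal (?a i) * indicator A (t i)" .
  qed
  finally show "emeasure (mixing k w \<theta>) A = emeasure (mixing N ?a t) A"
    by (simp add: emeasure_mixing[OF A])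
qed

lemma regroup_weights:
  assumes w: "w \<in> weight_simplex k"
    and inj: "inj_on t {1..N}" and sub: "\<theta> ` {1..k} \<subseteq> t ` {1..N}"
  shows "(\<lambda>i\<in>{1..N}. \<Sum>j\<in>{j\<in>{1..k}. \<theta> j = t i}. w j) \<in> weight_simplex N" (is "?a \<in> _")
proof -
  have w0: "0 \<le> w j" if "j \<in> {1..k}" for j
    using w that by (auto simp: weight_simplex_def PiE_def Pi_def)
  have "1 = (\<Sum>j\<in>{1..k}. w j)" using w by (simp add: weight_simplex_def)
  also have "\<dots> = (\<Sum>s\<in>t ` {1..N}. \<Sum>j\<in>{j\<in>{1..k}. \<theta> j = s}. w j)"
    by (rule sum.group[symmetric]) (use sub in auto)
  also have "\<dots> = (\<Sum>i\<in>{1..N}. ?a i)" by (subst sum.reindex[OF inj]) simp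
  finally have s: "(\<Sum>i\<in>{1..N}. ?a i) = 1" by simp
  have nn: "0 \<le> ?a i" if "i \<in> {1..N}" for i
    using that w0 by (auto intro!: sum_nonneg)
  have "?a i \<le> 1" if "i \<in> {1..N}" for i
  proof -
    have "?a i \<le> (\<Sum>i\<in>{1..N}. ?a i)" by (rule member_le_sum) (use that nn in auto)
    then show ?thesis using s by simp
  qed
  then show ?thesis using s nn unfolding weight_simplex_def by (auto simp: PiE_def Pi_def)
qed

text \<open>Gap \<open>l\<close> counts exactly when it lies between the two points; the two
  indicators cover the two orders of \<open>i\<close> and \<open>j\<close>. The index set does not
  depend on \<open>i\<close> and \<open>j\<close>, so a transport cost can be summed over the
  coupling before the gaps.\<close>

lemma abs_diff_eq_sum_gaps:
  fixes t :: "nat \<Rightarrow> real"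
  assumes mono: "\<And>i j. 1 \<le> i \<Longrightarrow> i \<le> j \<Longrightarrow> j \<le> N \<Longrightarrow> t i \<le> t j" and "i \<in> {1..N}" "j \<in> {1..N}"
  shows "\<bar>t i - t j\<bar> = (\<Sum>l\<in>{1..<N}. (t (Suc l) - t l) * (of_bool (i \<le> l \<and> l < j) + of_bool (j \<le> l \<and> l < i)))"
proof -
  have *: "t j - t i = (\<Sum>l\<in>{1..<N}. (t (Suc l) - t l) * of_bool (i \<le> l \<and> l < j))"
    if "i \<le> j" "1 \<le> i" "j \<le> N" for i j
  proof -
    have "t j - t i = (\<Sum>l\<in>{i..<j}. t (Suc l) - t l)" using that by (simp add: sum_Suc_diff')
    also have "\<dots> = (\<Sum>l\<in>{1..<N} \<inter> {l. i \<le> l \<and> l < j}. t (Suc l) - t l)"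
      using that by (intro sum.cong set_eqI) auto
    also have "\<dots> = (\<Sum>l\<in>{1..<N}. if l \<in> {l. i \<le> l \<and> l < j} then t (Suc l) - t l else 0)"
      by (rule sum.inter_restrict) simp
    also have "\<dots> = (\<Sum>l\<in>{1..<N}. (t (Suc l) - t l) * of_bool (i \<le> l \<and> l < j))"
      by (intro sum.cong) auto
    finally show ?thesis .
  qed
  show ?thesis
  proof (cases "i \<le> j")
    case True
    then have "\<bar>t i - t j\<bar> = t j - t i" using assms by force
    also have "\<dots> = (\<Sum>l\<in>{1..<N}. (t (Suc l) - t l) * of_bool (i \<le> l \<and> l < j))"
      using True assms by (intro *) auto
    also have "\<dots> = (\<Sum>l\<in>{1..<N}. (t (Suc l) - t l) * (of_bool (i \<le> l \<and> l < j) + of_bool (j \<le> l \<and> l < i)))"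
      by (intro sum.cong refl) (use True in auto)
    finally show ?thesis .
  next
    case False
    then have "\<bar>t i - t j\<bar> = t i - t j" using assms(1)[of j i] assms(2,3) by force
    also have "\<dots> = (\<Sum>l\<in>{1..<N}. (t (Suc l) - t l) * of_bool (j \<le> l \<and> l < i))"
      using False assms by (intro *) auto
    also have "\<dots> = (\<Sum>l\<in>{1..<N}. (t (Suc l) - t l) * (of_bool (i \<le> l \<and> l < j) + of_bool (j \<le> l \<and> l < i)))"
      by (intro sum.cong refl) (use False in auto)
    finally show ?thesis .
  qed
qed

text \<open>The coupling is the comonotone one: its joint distribution function is \<open>min (A i) (B j)\<close>.\<close>

lemma comonotone_coupling:
  fixes a b t :: "nat \<Rightarrow> real"
  assumes a: "a \<in> weight_simplex N" and b: "b \<in> weight_simplex N"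
    and mono: "\<And>i j. 1 \<le> i \<Longrightarrow> i \<le> j \<Longrightarrow> j \<le> N \<Longrightarrow> t i \<le> t j"
  shows "\<exists>p\<in>couplings N a N b. transport_cost N t N t p =
    (\<Sum>l\<in>{1..<N}. (t (Suc l) - t l) * \<bar>\<Sum>i\<in>{1..l}. a i - b i\<bar>)"
proof -
  define A where "A i = (\<Sum>l\<in>{1..i}. a l)" for i
  define B where "B i = (\<Sum>l\<in>{1..i}. b l)" for i
  define C where "C i j = min (A i) (B j)" for i j
  \<comment> \<open>The mixed second difference of the joint distribution function \<open>C\<close>,
    that is, its mass in the cell \<open>(i, j)\<close>.\<close>
  define p where "p i j = (C i j - C (i-1) j) - (C i (j-1) - C (i-1) (j-1))" for i j
  have a0: "0 \<le> a i" if "i \<in> {1..N}" for i using a that by (auto simp: weight_simplex_def PiE_def Pi_def)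
  have b0: "0 \<le> b i" if "i \<in> {1..N}" for i using b that by (auto simp: weight_simplex_def PiE_def Pi_def)
  have A0: "A 0 = 0" "B 0 = 0" by (simp_all add: A_def B_def)
  have AN: "A N = 1" "B N = 1" using a b by (simp_all add: A_def B_def weight_simplex_def)
  have AS: "A i = A (i-1) + a i" if "i \<in> {1..N}" for i
    using that by (cases i) (auto simp: A_def)
  have BS: "B i = B (i-1) + b i" if "i \<in> {1..N}" for i
    using that by (cases i) (auto simp: B_def)
  have Am: "A i \<le> A j" if "i \<le> j" "j \<le> N" for i j
    unfolding A_def using that by (intro sum_mono2) (auto intro!: a0)
  have Bm: "B i \<le> B j" if "i \<le> j" "j \<le> N" for i j
    unfolding B_def using that by (intro sum_mono2) (auto intro!: b0)
  have CN: "C i N = A i" "C N i = B i" if "i \<le> N" for i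
    using Am[of i N] Bm[of i N] that AN by (auto simp: C_def)
  have C0: "C i 0 = 0" "C 0 i = 0" if "i \<le> N" for i
    using Am[of 0 i] Bm[of 0 i] that A0 by (auto simp: C_def)
  \<comment> \<open>Nonnegativity is the supermodularity of \<open>min\<close>.\<close>
  have p0: "0 \<le> p i j" if "i \<in> {1..N}" "j \<in> {1..N}" for i j
    using AS[OF that(1)] BS[OF that(2)] a0[OF that(1)] b0[OF that(2)] unfolding p_def C_def by linarith
  have row: "(\<Sum>j\<in>{Suc m..n}. p i j) = (C i n - C (i-1) n) - (C i m - C (i-1) m)" if "m \<le> n" for i m n
    unfolding p_def using sum_telescope''[OF that, of "\<lambda>j. C i j - C (i-1) j"] by simp
  have box: "(\<Sum>i\<in>{Suc m'..n'}. \<Sum>j\<in>{Suc m..n}. p i j) = (C n' n - C m' n) - (C n' m - C m' m)"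
    if "m \<le> n" "m' \<le> n'" for m n m' n'
    using sum_telescope''[OF that(2), of "\<lambda>i. C i n - C i m"] by (simp add: row[OF that(1)] algebra_simps)
  have r1: "(\<Sum>j\<in>{1..N}. p i j) = a i" if "i \<in> {1..N}" for i
  proof -
    have "i \<le> N" "i - 1 \<le> N" using that by auto
    then show ?thesis using row[of 0 N i] AS[OF that] by (simp add: CN C0)
  qed
  have r2: "(\<Sum>i\<in>{1..N}. p i j) = b j" if "j \<in> {1..N}" for j
  proof -
    have "j \<le> N" "j - 1 \<le> N" using that by auto
    moreover have "(\<Sum>i\<in>{1..N}. p i j) = (C N j - C N (j-1)) - (C 0 j - C 0 (j-1))"
      unfolding p_def using sum_telescope''[of 0 N "\<lambda>i. C i j - C i (j-1)"] by (simp add: algebra_simps)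
    ultimately show ?thesis using BS[OF that] by (simp add: CN C0)
  qed
  have p1: "p i j \<le> 1" if "i \<in> {1..N}" "j \<in> {1..N}" for i j
  proof -
    have "p i j \<le> (\<Sum>j\<in>{1..N}. p i j)" by (rule member_le_sum) (use that p0 in auto)
    also have "\<dots> \<le> 1" using r1[OF that(1)] a that(1) by (auto simp: weight_simplex_def PiE_def Pi_def)
    finally show ?thesis .
  qed
  \<comment> \<open>The mass crossing gap \<open>l\<close>: the box sums telescope to
    \<open>A l - min (A l) (B l)\<close> to the right and \<open>B l - min (A l) (B l)\<close> to
    the left.\<close>
  have cross: "(\<Sum>i\<in>{1..N}. \<Sum>j\<in>{1..N}. p i j * (of_bool (i \<le> l \<and> l < j) + of_bool (j \<le> l \<and> l < i)))
      = \<bar>A l - B l\<bar>" if l: "l \<in> {1..<N}" for l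
  proof -
    have lN: "l \<le> N" using l by simp
    have e1: "(\<Sum>i\<in>{1..N}. \<Sum>j\<in>{1..N}. p i j * of_bool (i \<le> l \<and> l < j)) = (\<Sum>i\<in>{Suc 0..l}. \<Sum>j\<in>{Suc l..N}. p i j)"
    proof -
      have "(\<Sum>i\<in>{Suc 0..l}. \<Sum>j\<in>{Suc l..N}. p i j)
          = (\<Sum>i\<in>{1..N} \<inter> {..l}. \<Sum>j\<in>{1..N} \<inter> {Suc l..}. p i j)"
        using lN by (intro sum.cong) auto
      also have "\<dots> = (\<Sum>i\<in>{1..N}. if i \<in> {..l} then \<Sum>j\<in>{1..N}. if j \<in> {Suc l..} then p i j else 0 else 0)"
        by (simp only: sum.inter_restrict finite_atLeastAtMost)
      also have "\<dots> = (\<Sum>i\<in>{1..N}. \<Sum>j\<in>{1..N}. p i j * of_bool (i \<le> l \<and> l < j))"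
      proof (rule sum.cong[OF refl])
        fix i
        show "(if i \<in> {..l} then \<Sum>j\<in>{1..N}. if j \<in> {Suc l..} then p i j else 0 else 0)
            = (\<Sum>j\<in>{1..N}. p i j * of_bool (i \<le> l \<and> l < j))"
        proof (cases "i \<in> {..l}")
          case True
          then show ?thesis by (simp only: if_True) (intro sum.cong refl, simp)
        next
          case False
          then show ?thesis by auto
        qed
      qed
      finally show ?thesis ..
    qed
    have e2: "(\<Sum>i\<in>{1..N}. \<Sum>j\<in>{1..N}. p i j * of_bool (j \<le> l \<and> l < i)) = (\<Sum>i\<in>{Suc l..N}. \<Sum>j\<in>{Suc 0..l}. p i j)"
    proof -
      have "(\<Sum>i\<in>{Suc l..N}. \<Sum>j\<in>{Suc 0..l}. p i j)
          = (\<Sum>i\<in>{1..N} \<inter> {Suc l..}. \<Sum>j\<in>{1..N} \<inter> {..l}. p i j)"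
        using lN by (intro sum.cong) auto
      also have "\<dots> = (\<Sum>i\<in>{1..N}. if i \<in> {Suc l..} then \<Sum>j\<in>{1..N}. if j \<in> {..l} then p i j else 0 else 0)"
        by (simp only: sum.inter_restrict finite_atLeastAtMost)
      also have "\<dots> = (\<Sum>i\<in>{1..N}. \<Sum>j\<in>{1..N}. p i j * of_bool (j \<le> l \<and> l < i))"
      proof (rule sum.cong[OF refl])
        fix i
        show "(if i \<in> {Suc l..} then \<Sum>j\<in>{1..N}. if j \<in> {..l} then p i j else 0 else 0)
            = (\<Sum>j\<in>{1..N}. p i j * of_bool (j \<le> l \<and> l < i))"
        proof (cases "i \<in> {Suc l..}")
          case True
          then show ?thesis by (simp only: if_True) (intro sum.cong refl, simp)
        next
          case False
          then show ?thesis by auto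
        qed
      qed
      finally show ?thesis ..
    qed
    have "(\<Sum>i\<in>{1..N}. \<Sum>j\<in>{1..N}. p i j * (of_bool (i \<le> l \<and> l < j) + of_bool (j \<le> l \<and> l < i)))
      = (\<Sum>i\<in>{Suc 0..l}. \<Sum>j\<in>{Suc l..N}. p i j) + (\<Sum>i\<in>{Suc l..N}. \<Sum>j\<in>{Suc 0..l}. p i j)"
      unfolding e1[symmetric] e2[symmetric] by (simp only: distrib_left sum.distrib)
    also have "\<dots> = (A l - min (A l) (B l)) + (B l - min (A l) (B l))"
      using lN by (simp add: box CN C0) (simp add: C_def A0)
    also have "\<dots> = \<bar>A l - B l\<bar>" by linarith
    finally show ?thesis .
  qed
  have "transport_cost N t N t p = (\<Sum>i\<in>{1..N}. \<Sum>j\<in>{1..N}. \<Sum>l\<in>{1..<N}.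
      (t (Suc l) - t l) * (p i j * (of_bool (i \<le> l \<and> l < j) + of_bool (j \<le> l \<and> l < i))))"
    unfolding transport_cost_def
    by (intro sum.cong refl) (subst abs_diff_eq_sum_gaps[OF mono], auto simp: sum_distrib_left mult_ac)
  also have "\<dots> = (\<Sum>l\<in>{1..<N}. \<Sum>i\<in>{1..N}. \<Sum>j\<in>{1..N}.
      (t (Suc l) - t l) * (p i j * (of_bool (i \<le> l \<and> l < j) + of_bool (j \<le> l \<and> l < i))))"
    by (simp only: sum.swap[of _ "{1..<N}" "{1..N}"])
  also have "\<dots> = (\<Sum>l\<in>{1..<N}. (t (Suc l) - t l) * \<bar>A l - B l\<bar>)"
    by (intro sum.cong refl) (simp only: sum_distrib_left[symmetric] cross)
  also have "\<dots> = (\<Sum>l\<in>{1..<N}. (t (Suc l) - t l) * \<bar>\<Sum>i\<in>{1..l}. a i - b i\<bar>)"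
    by (simp add: A_def B_def sum_subtractf)
  finally show ?thesis using p0 p1 r1 r2 by (intro bexI[of _ p]) (auto simp: couplings_def)
qed

lemma transport_cost_nonneg:
  assumes "p \<in> couplings k w k' w'"
  shows "0 \<le> transport_cost k \<theta> k' \<theta>' p"
  using assms unfolding transport_cost_def couplings_def by (auto intro!: sum_nonneg mult_nonneg_nonneg)

lemma wasserstein1_le_sum_gaps:
  fixes t :: "nat \<Rightarrow> real"
  assumes a: "a \<in> weight_simplex N" and b: "b \<in> weight_simplex N"
    and mono: "\<And>i j. 1 \<le> i \<Longrightarrow> i \<le> j \<Longrightarrow> j \<le> N \<Longrightarrow> t i \<le> t j"
  shows "wasserstein1 (mixing N a t) (mixing N b t) \<le>
    (\<Sum>l\<in>{1..<N}. (t (Suc l) - t l) * \<bar>\<Sum>i\<in>{1..l}. a i - b i\<bar>)"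
proof -
  obtain p where p: "p \<in> couplings N a N b" "transport_cost N t N t p =
    (\<Sum>l\<in>{1..<N}. (t (Suc l) - t l) * \<bar>\<Sum>i\<in>{1..l}. a i - b i\<bar>)"
    using comonotone_coupling[where t = t, OF a b mono] by blast
  show ?thesis unfolding wasserstein1_mixing[OF a b] p(2)[symmetric]
    by (rule cINF_lower[OF _ p(1)]) (auto intro!: bdd_belowI[where m = 0] transport_cost_nonneg)
qed

section \<open>Lower bounds for the transport cost\<close>

lemma couplings_nonempty:
  assumes w: "w \<in> weight_simplex k" and w': "w' \<in> weight_simplex k'"
  shows "couplings k w k' w' \<noteq> {}"
proof -
  have "(\<lambda>j h. w j * w' h) \<in> couplings k w k' w'"
    using w w' unfolding couplings_def weight_simplex_def
    by (auto simp: sum_distrib_left[symmetric] sum_distrib_right[symmetric] PiE_def Pi_def intro: mult_le_one)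
  then show ?thesis by blast
qed

text \<open>Every coupling carries the mass of \<open>S\<close> over a distance of at least
  \<open>d\<close>. Contraposed, a small distance forces an atom of the other distribution near each
  set of sufficient mass.\<close>

lemma wasserstein1_ge_far_mass:
  assumes w: "w \<in> weight_simplex k" and w': "w' \<in> weight_simplex k'"
    and S: "S \<subseteq> {1..k'}" and d: "0 \<le> d"
    and far: "\<And>j h. j \<in> {1..k} \<Longrightarrow> h \<in> S \<Longrightarrow> d \<le> \<bar>\<theta> j - \<theta>' h\<bar>"
  shows "d * (\<Sum>h\<in>S. w' h) \<le> wasserstein1 (mixing k w \<theta>) (mixing k' w' \<theta>')"
  unfolding wasserstein1_mixing[OF w w']
proof (rule cINF_greatest[OF couplings_nonempty[OF w w']])
  fix p assume p: "p \<in> couplings k w k' w'"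
  have "d * (\<Sum>h\<in>S. w' h) = d * (\<Sum>h\<in>S. \<Sum>j\<in>{1..k}. p j h)"
    using p S by (intro arg_cong[where f = "(*) d"] sum.cong) (auto simp: couplings_def)
  also have "\<dots> = (\<Sum>h\<in>S. \<Sum>j\<in>{1..k}. p j h * d)" by (simp add: sum_distrib_left mult.commute)
  also have "\<dots> \<le> (\<Sum>h\<in>S. \<Sum>j\<in>{1..k}. p j h * \<bar>\<theta> j - \<theta>' h\<bar>)"
    using p S far by (intro sum_mono mult_left_mono) (auto simp: couplings_def subset_iff)
  also have "\<dots> \<le> (\<Sum>h\<in>{1..k'}. \<Sum>j\<in>{1..k}. p j h * \<bar>\<theta> j - \<theta>' h\<bar>)"
    using p S by (intro sum_mono2) (auto simp: couplings_def intro!: sum_nonneg)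
  also have "\<dots> = transport_cost k \<theta> k' \<theta>' p" unfolding transport_cost_def by (rule sum.swap)
  finally show "d * (\<Sum>h\<in>S. w' h) \<le> transport_cost k \<theta> k' \<theta>' p" .
qed

section \<open>Moments and cut masses\<close>

text \<open>
  Neville's recursion in dual form. For \<open>a = t p\<close> and \<open>b = t q\<close>, the mass of \<open>\<mu>\<close> to the left of the
  cut \<open>i\<close>, multiplied by \<open>b - a\<close>, is the difference of the corresponding masses of \<open>(x - a) \<mu>\<close> and
  \<open>(x - b) \<mu>\<close>, which have one atom less.
\<close>

lemma partial_mass_bound:
  fixes t s \<mu> :: "nat \<Rightarrow> real"
  assumes L: "\<And>j. p0 \<le> j \<Longrightarrow> j \<le> q0 \<Longrightarrow> \<bar>t j\<bar> \<le> L"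
    and spread: "\<And>p q. p0 \<le> p \<Longrightarrow> p \<le> i \<Longrightarrow> i < q \<Longrightarrow> q \<le> q0 \<Longrightarrow> s (Suc q - p) \<le> t q - t p"
    and s: "\<And>m. 2 \<le> m \<Longrightarrow> m \<le> Suc q0 - p0 \<Longrightarrow> 0 < s m \<and> s m \<le> 2 * (1 + L)"
    and pq: "p0 \<le> p" "p \<le> Suc i" "i \<le> q" "q \<le> q0" and \<delta>: "0 \<le> \<delta>"
    and mom: "\<And>r. r < Suc q - p \<Longrightarrow> \<bar>\<Sum>j\<in>{p..q}. \<mu> j * t j ^ r\<bar> \<le> \<delta>"
  shows "\<bar>\<Sum>j\<in>{p..i}. \<mu> j\<bar> \<le> \<delta> * (\<Prod>m\<in>{2..Suc q - p}. 2 * (1 + L) / s m)"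
  using pq \<delta> mom
proof (induction "Suc q - p" arbitrary: p q \<mu> \<delta>)
  case 0
  then have "p = Suc i" "q = i" by auto
  then show ?case using 0 by simp
next
  case (Suc d)
  define c where "c = 2 * (1 + L)"
  define K where "K m = (\<Prod>m\<in>{2..m}. c / s m)" for m
  have s': "0 < s m" "s m \<le> c" if "2 \<le> m" "m \<le> Suc q0 - p0" for m
    using s[OF that] by (auto simp: c_def)
  \<comment> \<open>Each factor is at least 1, which is why \<open>s m\<close> is bounded by
    \<open>2 * (1 + L)\<close>; the base cases can then be weakened to the full product.\<close>
  have K0: "1 \<le> K m" if "m \<le> Suc q0 - p0" for m
    unfolding K_def using s' that by (intro prod_ge_1) auto
  have m: "Suc q - p \<le> Suc q0 - p0" using Suc.prems by auto
  \<comment> \<open>An empty left part has mass 0, and a cut behind the last point leaves the moment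
    of order 0. Only a cut strictly inside the block uses the recursion.\<close>
  consider "p = Suc i" | "p \<le> i" "q = i" | "p \<le> i" "i < q" using Suc.prems by linarith
  then show ?case
  proof cases
    case 1
    have "0 \<le> \<delta> * K (Suc q - p)" using K0[OF m] Suc.prems by simp
    with 1 show ?thesis by (simp add: K_def c_def)
  next
    case 2
    then have "\<bar>\<Sum>j\<in>{p..i}. \<mu> j\<bar> \<le> \<delta> * 1" using Suc.prems(6)[of 0] by simp
    also have "\<dots> \<le> \<delta> * K (Suc q - p)" using K0[OF m] Suc.prems by (intro mult_left_mono) auto
    finally show ?thesis by (simp add: K_def c_def)
  next
    case 3
    define a where "a = t p"
    define b where "b = t q"
    have bL: "\<bar>b\<bar> \<le> L" "\<bar>a\<bar> \<le> L" using L 3 Suc.prems by (auto simp: a_def b_def)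
    have c0: "0 \<le> c" using bL by (simp add: c_def)
    \<comment> \<open>Multiplication by \<open>x - e\<close> consumes one moment and costs a factor
      \<open>1 + L\<close>; the two choices of \<open>e\<close> together give the numerator
      \<open>2 * (1 + L)\<close>.\<close>
    have half: "\<bar>\<Sum>j\<in>{p..q}. (t j - e) * \<mu> j * t j ^ r\<bar> \<le> \<delta> * (1 + L)"
      if "Suc r < Suc q - p" "\<bar>e\<bar> \<le> L" for e r
    proof -
      have "(\<Sum>j\<in>{p..q}. (t j - e) * \<mu> j * t j ^ r)
          = (\<Sum>j\<in>{p..q}. \<mu> j * t j ^ Suc r) - e * (\<Sum>j\<in>{p..q}. \<mu> j * t j ^ r)"
        unfolding sum_distrib_left sum_subtractf[symmetric] by (intro sum.cong refl) (simp add: algebra_simps)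
      also have "\<bar>\<dots>\<bar> \<le> \<bar>\<Sum>j\<in>{p..q}. \<mu> j * t j ^ Suc r\<bar> + \<bar>e\<bar> * \<bar>\<Sum>j\<in>{p..q}. \<mu> j * t j ^ r\<bar>"
        by (rule order.trans[OF abs_triangle_ineq4]) (simp add: abs_mult)
      also have "\<dots> \<le> \<delta> + L * \<delta>"
        using Suc.prems(6)[of "Suc r"] Suc.prems(6)[of r] that
        by (intro add_mono mult_mono) auto
      finally show ?thesis by (simp add: algebra_simps)
    qed
    have d: "d = Suc (q - 1) - p" "d = Suc q - Suc p" using Suc.hyps(2) 3 by auto
    have nn: "0 \<le> \<delta> * (1 + L)" using Suc.prems bL by auto
    have Q: "{p..q} = insert q {p..q - 1}" "q \<notin> {p..q - 1}" using 3 by auto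
    have P: "{p..q} = insert p {Suc p..q}" "p \<notin> {Suc p..q}" using 3 by auto
    have P': "{p..i} = insert p {Suc p..i}" "p \<notin> {Suc p..i}" using 3 by auto
    \<comment> \<open>The factor \<open>t j - b\<close> vanishes at \<open>j = q\<close> and
      \<open>t j - a\<close> at \<open>j = p\<close>, so the block loses an end point while its
      moments stay controlled.\<close>
    have s1: "(\<Sum>j\<in>{p..q - 1}. (t j - b) * \<mu> j * t j ^ r) = (\<Sum>j\<in>{p..q}. (t j - b) * \<mu> j * t j ^ r)" for r
      unfolding Q(1) by (subst sum.insert[OF _ Q(2)]) (simp_all add: b_def)
    have s2: "(\<Sum>j\<in>{Suc p..q}. (t j - a) * \<mu> j * t j ^ r) = (\<Sum>j\<in>{p..q}. (t j - a) * \<mu> j * t j ^ r)" for r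
      unfolding P(1) by (subst sum.insert[OF _ P(2)]) (simp_all add: a_def)
    have 1: "\<bar>\<Sum>j\<in>{p..i}. (t j - b) * \<mu> j\<bar> \<le> \<delta> * (1 + L) * K d"
      unfolding K_def c_def d(1)
    proof (rule Suc.hyps(1)[OF d(1)])
      show "p0 \<le> p" "p \<le> Suc i" using Suc.prems by auto
      show "i \<le> q - 1" using 3 by simp
      show "q - 1 \<le> q0" using Suc.prems by simp
      show "0 \<le> \<delta> * (1 + L)" by (rule nn)
      show "\<bar>\<Sum>j\<in>{p..q - 1}. (t j - b) * \<mu> j * t j ^ r\<bar> \<le> \<delta> * (1 + L)" if "r < Suc (q - 1) - p" for r
        unfolding s1 by (rule half[OF _ bL(1)]) (use that 3 in linarith)
    qed
    have "\<bar>\<Sum>j\<in>{Suc p..i}. (t j - a) * \<mu> j\<bar> \<le> \<delta> * (1 + L) * K d"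
      unfolding K_def c_def d(2)
    proof (rule Suc.hyps(1)[OF d(2)])
      show "p0 \<le> Suc p" "Suc p \<le> Suc i" "i \<le> q" "q \<le> q0" using Suc.prems 3 by auto
      show "0 \<le> \<delta> * (1 + L)" by (rule nn)
      show "\<bar>\<Sum>j\<in>{Suc p..q}. (t j - a) * \<mu> j * t j ^ r\<bar> \<le> \<delta> * (1 + L)" if "r < Suc q - Suc p" for r
        unfolding s2 by (rule half[OF _ bL(2)]) (use that 3 in linarith)
    qed
    also have "(\<Sum>j\<in>{Suc p..i}. (t j - a) * \<mu> j) = (\<Sum>j\<in>{p..i}. (t j - a) * \<mu> j)"
      unfolding P'(1) by (subst sum.insert[OF _ P'(2)]) (simp_all add: a_def)
    finally have 2: "\<bar>\<Sum>j\<in>{p..i}. (t j - a) * \<mu> j\<bar> \<le> \<delta> * (1 + L) * K d" .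
    have "(b - a) * (\<Sum>j\<in>{p..i}. \<mu> j) = (\<Sum>j\<in>{p..i}. (t j - a) * \<mu> j) - (\<Sum>j\<in>{p..i}. (t j - b) * \<mu> j)"
      unfolding sum_distrib_left sum_subtractf[symmetric] by (intro sum.cong refl) (simp add: algebra_simps)
    also have "\<bar>\<dots>\<bar> \<le> \<delta> * (1 + L) * K d + \<delta> * (1 + L) * K d"
      by (rule order.trans[OF abs_triangle_ineq4]) (rule add_mono[OF 2 1])
    also have "\<dots> = \<delta> * K d * c" by (simp add: c_def algebra_simps)
    finally have ba': "\<bar>(b - a) * (\<Sum>j\<in>{p..i}. \<mu> j)\<bar> \<le> \<delta> * K d * c" .
    have "Suc q - p = Suc d" using Suc.hyps(2) by simp
    then have sm: "0 < s (Suc d)" "s (Suc d) \<le> b - a"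
      using spread[of p q] s'(1)[of "Suc q - p"] 3 Suc.prems(1,4) m by (auto simp: a_def b_def)
    then have ba: "(b - a) * \<bar>\<Sum>j\<in>{p..i}. \<mu> j\<bar> \<le> \<delta> * K d * c"
      using ba' by (simp add: abs_mult)
    have "s (Suc d) * \<bar>\<Sum>j\<in>{p..i}. \<mu> j\<bar> \<le> (b - a) * \<bar>\<Sum>j\<in>{p..i}. \<mu> j\<bar>"
      using sm by (intro mult_right_mono) auto
    with ba have "\<bar>\<Sum>j\<in>{p..i}. \<mu> j\<bar> \<le> \<delta> * K d * c / s (Suc d)"
      using sm by (simp add: field_simps)
    also have "\<dots> = \<delta> * K (Suc d)"
    proof -
      have "2 \<le> Suc d" using 3 Suc.hyps(2) by linarith
      then show ?thesis unfolding K_def by (simp add: prod.nat_ivl_Suc' mult_ac)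
    qed
    finally show ?thesis using Suc.hyps(2) by (simp add: K_def c_def)
  qed
qed

text \<open>Induction by removing the maximum, below which the other points stay by at least
  \<open>d\<close>.\<close>

lemma separated_points_spread:
  fixes S :: "real set"
  assumes "finite S" "S \<noteq> {}" "S \<subseteq> {u..v}" and sep: "\<And>x y. x \<in> S \<Longrightarrow> y \<in> S \<Longrightarrow> x \<noteq> y \<Longrightarrow> d \<le> \<bar>x - y\<bar>"
  shows "(real (card S) - 1) * d \<le> v - u"
  using assms
proof (induction "card S" arbitrary: S v)
  case 0
  have "S = {}" using 0(1) 0(2) by simp
  then show ?case using 0(3) by contradiction
next
  case (Suc n)
  define x where "x = Max S"
  have x: "x \<in> S" unfolding x_def by (rule Max_in) fact+
  have xv: "u \<le> x" "x \<le> v" using x Suc.prems(3) by auto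
  show ?case
  proof (cases "S = {x}")
    case True
    then have "card S = 1" by simp
    then show ?thesis using xv by simp
  next
    case False
    define S' where "S' = S - {x}"
    have S': "S' \<noteq> {}" "finite S'" using False x Suc.prems(1) unfolding S'_def by blast+
    have cS: "card S = Suc (card S')" unfolding S'_def by (rule card.remove) fact+
    have le: "y \<le> x - d" if "y \<in> S'" for y
    proof -
      have "y \<in> S" "y \<noteq> x" using that unfolding S'_def by blast+
      moreover have "y \<le> x" unfolding x_def by (rule Max_ge) fact+
      moreover have "d \<le> \<bar>x - y\<bar>"
        using Suc.prems(4)[OF x, of y] that unfolding S'_def by blast
      ultimately show ?thesis by linarith
    qed
    have "(real (card S') - 1) * d \<le> (x - d) - u"
    proof (rule Suc.hyps(1))
      show "n = card S'" using cS Suc.hyps(2) by simp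
      show "finite S'" "S' \<noteq> {}" using S' by auto
      show "S' \<subseteq> {u..x - d}"
      proof
        fix y assume y: "y \<in> S'"
        then have "y \<in> {u..v}" using Suc.prems(3) unfolding S'_def by blast
        then show "y \<in> {u..x - d}" using le[OF y] by simp
      qed
      show "d \<le> \<bar>y - z\<bar>" if "y \<in> S'" "z \<in> S'" "y \<noteq> z" for y z
        using Suc.prems(4)[of y z] that unfolding S'_def by blast
    qed
    then show ?thesis using cS xv by (simp add: algebra_simps)
  qed
qed

text \<open>The indices \<open>2 * j + 1\<close> and \<open>2 * j + 2\<close> both contribute
  \<open>j\<close>. The number \<open>(m + 1) div 2\<close> is the least number of clusters met by
  \<open>m\<close> points when each cluster has at most two representatives; hence the square of the
  factorial.\<close>

lemma prod_half_indices:
  assumes "1 \<le> k"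
  shows "(\<Prod>m\<in>{3..2 * k}. real ((m + 1) div 2 - 1)) = (fact (k - 1))\<^sup>2"
  using assms
proof (induction k rule: dec_induct)
  case base
  then show ?case by simp
next
  case (step k)
  have "{3..2 * Suc k} = insert (2 * k + 2) (insert (2 * k + 1) {3..2 * k})" using step by auto
  then have "(\<Prod>m\<in>{3..2 * Suc k}. real ((m + 1) div 2 - 1))
    = real k * (real k * (\<Prod>m\<in>{3..2 * k}. real ((m + 1) div 2 - 1)))"
    by simp
  also have "\<dots> = (real k * fact (k - 1))\<^sup>2" using step by (simp add: power2_eq_square)
  also have "real k * fact (k - 1) = fact k" using step by (simp add: fact_reduce)
  finally show ?case by simp
qed

text \<open>Interpolation between \<open>D \<le> X / g ^ p\<close> and \<open>D \<le> 1\<close>: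
  since \<open>D ^ p \<le> D\<close>, also \<open>(g * D) ^ p \<le> g ^ p * D \<le> X\<close>. Small
  gaps are therefore harmless.\<close>

lemma mult_le_powr_inverse:
  fixes g D X :: real
  assumes "0 < g" "0 \<le> D" "D \<le> 1" "D \<le> X / g ^ p" "1 \<le> p"
  shows "g * D \<le> X powr (1 / real p)"
proof -
  have "(g * D) ^ p = g ^ p * (D * D ^ (p - 1))"
    using assms(5) by (simp add: power_mult_distrib power_Suc[symmetric] del: power_Suc)
  also have "\<dots> \<le> g ^ p * (D * 1)"
    using assms by (intro mult_left_mono power_le_one) auto
  also have "\<dots> \<le> X" using assms by (simp add: field_simps)
  finally have X: "(g * D) ^ p \<le> X" .
  then have "((g * D) ^ p) powr (1 / real p) \<le> X powr (1 / real p)"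
    using assms by (intro powr_mono2) auto
  moreover have "((g * D) ^ p) powr (1 / real p) = g * D"
    using assms by (cases "D = 0") (auto simp: powr_realpow[symmetric] powr_powr simp del: powr_realpow)
  ultimately show ?thesis by simp
qed

section \<open>The Wasserstein distance and the moments\<close>

lemma finite_set_strict_enum:
  fixes Z :: "real set"
  assumes "finite Z"
  obtains t :: "nat \<Rightarrow> real" where "t ` {1..card Z} = Z"
    "\<And>i j. 1 \<le> i \<Longrightarrow> i < j \<Longrightarrow> j \<le> card Z \<Longrightarrow> t i < t j"
proof
  define xs where "xs = sorted_list_of_set Z"
  define t where "t i = xs ! (i - 1)" for i
  have xs: "set xs = Z" "length xs = card Z" "sorted_wrt (<) xs"
    using assms by (auto simp: xs_def)
  have "{1..card Z} = Suc ` {0..<card Z}"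
    by (simp add: atLeastLessThanSuc_atLeastAtMost image_Suc_atLeastLessThan)
  then have "t ` {1..card Z} = (!) xs ` {0..<length xs}"
    unfolding xs(2) by (simp only: image_image t_def diff_Suc_1)
  also have "\<dots> = Z" using xs(1) by (simp add: nth_image)
  finally show "t ` {1..card Z} = Z" .
  show "t i < t j" if "1 \<le> i" "i < j" "j \<le> card Z" for i j
    unfolding t_def using that xs(2) by (intro sorted_wrt_nth_less[OF xs(3)]) auto
qed

lemma sum_regroup_weights:
  fixes f :: "real \<Rightarrow> real" and t \<theta> w :: "nat \<Rightarrow> real"
  assumes inj: "inj_on t {1..N}" and sub: "\<theta> ` {1..k} \<subseteq> t ` {1..N}"
  shows "(\<Sum>i\<in>{1..N}. (\<lambda>i\<in>{1..N}. \<Sum>j\<in>{j\<in>{1..k}. \<theta> j = t i}. w j) i * f (t i)) = (\<Sum>j\<in>{1..k}. w j * f (\<theta> j))"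
proof -
  have "(\<Sum>j\<in>{1..k}. w j * f (\<theta> j)) = (\<Sum>s\<in>t ` {1..N}. \<Sum>j\<in>{j\<in>{1..k}. \<theta> j = s}. w j * f (\<theta> j))"
    by (rule sum.group[symmetric]) (use sub in auto)
  also have "\<dots> = (\<Sum>i\<in>{1..N}. \<Sum>j\<in>{j\<in>{1..k}. \<theta> j = t i}. w j * f (\<theta> j))"
    by (subst sum.reindex[OF inj]) (simp only: o_def)
  also have "\<dots> = (\<Sum>i\<in>{1..N}. (\<lambda>i\<in>{1..N}. \<Sum>j\<in>{j\<in>{1..k}. \<theta> j = t i}. w j) i * f (t i))"
    by (intro sum.cong refl) (auto simp: sum_distrib_right intro!: sum.cong)
  finally show ?thesis ..
qed

lemma partial_sum_simplex:
  assumes "a \<in> weight_simplex N" "l \<le> N"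
  shows "0 \<le> (\<Sum>i\<in>{1..l}. a i)" "(\<Sum>i\<in>{1..l}. a i) \<le> 1"
proof -
  have a0: "0 \<le> a i" if "i \<in> {1..N}" for i
    using assms that by (auto simp: weight_simplex_def PiE_def Pi_def)
  then show "0 \<le> (\<Sum>i\<in>{1..l}. a i)" using assms by (intro sum_nonneg) auto
  have "(\<Sum>i\<in>{1..l}. a i) \<le> (\<Sum>i\<in>{1..N}. a i)" using assms a0 by (intro sum_mono2) auto
  then show "(\<Sum>i\<in>{1..l}. a i) \<le> 1" using assms by (simp add: weight_simplex_def)
qed

text \<open>
  The points \<open>x l\<close> and \<open>y l\<close> represent the clusters. A block of \<open>m\<close> consecutive points of the
  joint support contains at most \<open>2 (k - k0)\<close> points that represent no cluster, hence meets at least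
  \<open>(m - 2 (k - k0)) / 2\<close> clusters.
\<close>

lemma block_spread:
  fixes X Y Blk :: "real set" and x y :: "'i \<Rightarrow> real"
  assumes fin: "finite X" "finite Y" "card X \<le> k" "card Y \<le> k" and Blk: "Blk \<subseteq> X \<union> Y" "Blk \<subseteq> {u..v}"
    and I: "finite I" "x ` I \<subseteq> X" "y ` I \<subseteq> Y" "inj_on x I" "inj_on y I" and d: "0 < d"
    and sep: "\<And>l l'. l \<in> I \<Longrightarrow> l' \<in> I \<Longrightarrow> l \<noteq> l' \<Longrightarrow>
      d \<le> \<bar>x l - x l'\<bar> \<and> d \<le> \<bar>y l - y l'\<bar> \<and> d \<le> \<bar>x l - y l'\<bar>"
    and big: "2 * (k - card I) + 2 < card Blk"
  shows "d * real ((card Blk - 2 * (k - card I) + 1) div 2 - 1) \<le> v - u"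
proof -
  \<comment> \<open>\<open>E\<close> collects the clusters with a representative in the block, and
    \<open>z\<close> picks one. It may come from either distribution, hence the assumed separation
    of \<open>x l\<close> from \<open>y l'\<close>.\<close>
  define E where "E = {i\<in>I. x i \<in> Blk \<or> y i \<in> Blk}"
  define z where "z i = (if x i \<in> Blk then x i else y i)" for i
  have finE: "finite E" "E \<subseteq> I" using I by (auto simp: E_def)
  have finB: "finite Blk" using Blk(1) fin by (meson finite_UnI finite_subset)
  have cX: "card (X - x ` I) \<le> k - card I"
    using fin I by (subst card_Diff_subset) (auto simp: card_image)
  have cY: "card (Y - y ` I) \<le> k - card I"
    using fin I by (subst card_Diff_subset) (auto simp: card_image)
  have "Blk \<subseteq> ((X - x ` I) \<union> (Y - y ` I)) \<union> (x ` E \<union> y ` E)"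
  proof
    fix b assume b: "b \<in> Blk"
    show "b \<in> ((X - x ` I) \<union> (Y - y ` I)) \<union> (x ` E \<union> y ` E)"
    proof (cases "b \<in> x ` I \<or> b \<in> y ` I")
      case True
      then have "b \<in> x ` E \<union> y ` E" using b unfolding E_def by blast
      then show ?thesis by blast
    next
      case False
      then show ?thesis using b Blk(1) by blast
    qed
  qed
  \<comment> \<open>Each distribution has at most \<open>k - card I\<close> points that represent no
    cluster, and each cluster in \<open>E\<close> accounts for at most two points of the
    block.\<close>
  then have "card Blk \<le> card (((X - x ` I) \<union> (Y - y ` I)) \<union> (x ` E \<union> y ` E))"
    using fin finE by (intro card_mono) auto
  also have "\<dots> \<le> (card (X - x ` I) + card (Y - y ` I)) + (card (x ` E) + card (y ` E))"
    by (intro order.trans[OF card_Un_le] add_mono card_Un_le)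
  also have "\<dots> \<le> (card (X - x ` I) + card (Y - y ` I)) + (card E + card E)"
    using finE by (intro add_mono card_image_le) auto
  finally have m: "card Blk \<le> 2 * (k - card I) + 2 * card E" using cX cY by linarith
  have zsep: "d \<le> \<bar>z l - z l'\<bar>" if "l \<in> E" "l' \<in> E" "l \<noteq> l'" for l l'
    using sep[of l l'] sep[of l' l] that finE(2) unfolding z_def
    by (auto simp: abs_minus_commute)
  have injz: "inj_on z E"
  proof (rule inj_onI)
    fix l l' assume "l \<in> E" "l' \<in> E" "z l = z l'"
    then show "l = l'" using zsep[of l l'] d by force
  qed
  have E1: "2 \<le> card E" using m big by linarith
  have zB: "z ` E \<subseteq> {u..v}"
  proof -
    have "z ` E \<subseteq> Blk" by (auto simp: z_def E_def)
    then show ?thesis using Blk(2) by blast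
  qed
  have "(real (card (z ` E)) - 1) * d \<le> v - u"
  proof (rule separated_points_spread)
    show "finite (z ` E)" using finE by simp
    show "z ` E \<noteq> {}" using E1 by auto
    show "z ` E \<subseteq> {u..v}" by (rule zB)
    show "d \<le> \<bar>a - b\<bar>" if "a \<in> z ` E" "b \<in> z ` E" "a \<noteq> b" for a b
      using that zsep by blast
  qed
  then have "(real (card E) - 1) * d \<le> v - u" by (simp add: card_image[OF injz])
  moreover have "d * real ((card Blk - 2 * (k - card I) + 1) div 2 - 1) \<le> d * (real (card E) - 1)"
  proof -
    have "(card Blk - 2 * (k - card I) + 1) div 2 - 1 \<le> card E - 1" using m by linarith
    then have "real ((card Blk - 2 * (k - card I) + 1) div 2 - 1) \<le> real (card E) - 1"
      using E1 by linarith
    then show ?thesis using d by simp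
  qed
  ultimately show ?thesis by (simp add: mult.commute)
qed

text \<open>For the \<open>A + 1\<close> indices up to \<open>A + 2\<close> only the gap inside the
  block is known. The remaining \<open>2 * k0 - 2\<close> indices, shifted by \<open>A\<close>,
  reduce to \<open>prod_half_indices\<close> with a factor \<open>2 / \<gamma>\<close> each.\<close>

lemma prod_spread_bounds:
  fixes c g \<gamma> :: real
  assumes "1 \<le> k0" "k0 \<le> k" "g > 0" "\<gamma> > 0"
  defines "A \<equiv> 2 * (k - k0)"
  shows "(\<Prod>m\<in>{2..2 * k}. c / (if m \<le> A + 2 then g else \<gamma> / 2 * real ((m - A + 1) div 2 - 1)))
    = c ^ (2 * k - 1) * (2 / \<gamma>) ^ (2 * k0 - 2) / (fact (k0 - 1))\<^sup>2 / g ^ (A + 1)"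
    (is "prod ?f _ = _")
proof -
  have A: "2 * k = 2 * k0 + A" using assms by simp
  have "{2..2 * k} = {2..A + 2} \<union> {3 + A..2 * k0 + A}" using assms by auto
  then have "prod ?f {2..2 * k} = prod ?f {2..A + 2} * prod ?f {3 + A..2 * k0 + A}"
    by (simp only:) (rule prod.union_disjoint, auto)
  also have "prod ?f {2..A + 2} = (\<Prod>m\<in>{2..A + 2}. c / g)" by (intro prod.cong) auto
  also have "\<dots> = (c / g) ^ (A + 1)" by simp
  also have "prod ?f {3 + A..2 * k0 + A} = (\<Prod>m\<in>{3..2 * k0}. ?f (m + A))"
    by (rule prod.shift_bounds_cl_nat_ivl)
  also have "\<dots> = (\<Prod>m\<in>{3..2 * k0}. (c * (2 / \<gamma>)) / real ((m + 1) div 2 - 1))"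
    by (intro prod.cong) (auto simp: field_simps)
  also have "\<dots> = (c * (2 / \<gamma>)) ^ (2 * k0 - 2) / (fact (k0 - 1))\<^sup>2"
    unfolding prod_dividef prod_half_indices[OF assms(1)] by simp
  also have "(c / g) ^ (A + 1) * ((c * (2 / \<gamma>)) ^ (2 * k0 - 2) / (fact (k0 - 1))\<^sup>2)
    = (c ^ (A + 1) * c ^ (2 * k0 - 2)) * (2 / \<gamma>) ^ (2 * k0 - 2) / (fact (k0 - 1))\<^sup>2 / g ^ (A + 1)"
    by (simp only: power_mult_distrib power_divide) (simp add: field_simps)
  also have "c ^ (A + 1) * c ^ (2 * k0 - 2) = c ^ (2 * k - 1)"
    unfolding power_add[symmetric] using assms by (intro arg_cong[where f = "(^) c"]) auto
  finally show ?thesis .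
qed

theorem wasserstein1_le_moments:
  fixes x y :: "'i \<Rightarrow> real"
  assumes w: "w \<in> weight_simplex k'" and \<theta>: "\<theta> \<in> atom_cube L k'"
    and ws: "ws \<in> weight_simplex k" and \<theta>s: "\<theta>s \<in> atom_cube L k"
    and k: "k' \<le> k" and \<delta>: "0 \<le> \<delta>"
    and mom: "\<And>r. 1 \<le> r \<Longrightarrow> r < 2 * k \<Longrightarrow>
      \<bar>(\<Sum>j\<in>{1..k'}. w j * \<theta> j ^ r) - (\<Sum>j\<in>{1..k}. ws j * \<theta>s j ^ r)\<bar> \<le> \<delta>"
    and I: "finite I" "I \<noteq> {}" "x ` I \<subseteq> \<theta>s ` {1..k}" "y ` I \<subseteq> \<theta> ` {1..k'}" and \<gamma>: "0 < \<gamma>"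
    and sep: "\<And>l l'. l \<in> I \<Longrightarrow> l' \<in> I \<Longrightarrow> l \<noteq> l' \<Longrightarrow>
      \<gamma> / 2 \<le> \<bar>x l - x l'\<bar> \<and> \<gamma> / 2 \<le> \<bar>y l - y l'\<bar> \<and> \<gamma> / 2 \<le> \<bar>x l - y l'\<bar>"
  shows "wasserstein1 (mixing k' w \<theta>) (mixing k ws \<theta>s) \<le> 2 * real k *
    (\<delta> * ((2 * (1 + L)) ^ (2 * k - 1) * (2 / \<gamma>) ^ (2 * card I - 2) / (fact (card I - 1))\<^sup>2))
      powr (1 / real (2 * (k - card I) + 1))"
proof -
  define k0 where "k0 = card I"
  define A where "A = 2 * (k - k0)"
  define c where "c = 2 * (1 + L)"
  define X where "X = \<delta> * (c ^ (2 * k - 1) * (2 / \<gamma>) ^ (2 * k0 - 2) / (fact (k0 - 1))\<^sup>2)"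
  define Z where "Z = \<theta> ` {1..k'} \<union> \<theta>s ` {1..k}"
  define N where "N = card Z"
  have injx: "inj_on x I" and injy: "inj_on y I"
    using sep \<gamma> by (auto simp: inj_on_def) fastforce+
  have cI: "1 \<le> k0" using I by (simp add: k0_def Suc_le_eq card_gt_0_iff)
  have "card (x ` I) \<le> card (\<theta>s ` {1..k})" using I by (intro card_mono) auto
  also have "\<dots> \<le> k" using card_image_le[of "{1..k}" \<theta>s] by simp
  finally have k0k: "k0 \<le> k" by (simp add: k0_def card_image[OF injx])
  have finZ: "finite Z" by (simp add: Z_def)
  obtain t where t: "t ` {1..N} = Z" "\<And>i j. 1 \<le> i \<Longrightarrow> i < j \<Longrightarrow> j \<le> N \<Longrightarrow> t i < t j"
    using finite_set_strict_enum[OF finZ] unfolding N_def by metis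
  have tm: "t i \<le> t j" if "1 \<le> i" "i \<le> j" "j \<le> N" for i j
    using t(2)[of i j] that by (cases "i = j") auto
  have injt: "inj_on t {1..N}"
    by (rule linorder_inj_onI) (use t(2) in force)+
  have cX: "card (\<theta>s ` {1..k}) \<le> k" "card (\<theta> ` {1..k'}) \<le> k"
    using card_image_le[of "{1..k}" \<theta>s] card_image_le[of "{1..k'}" \<theta>] k by simp_all
  then have N2k: "N \<le> 2 * k" unfolding N_def Z_def using card_Un_le[of "\<theta> ` {1..k'}" "\<theta>s ` {1..k}"] by linarith
  have ZL: "\<bar>z\<bar> \<le> L" if "z \<in> Z" for z
    using that \<theta> \<theta>s by (auto simp: Z_def atom_cube_def PiE_def Pi_def abs_le_iff minus_le_iff)
  have tL: "\<bar>t j\<bar> \<le> L" if "1 \<le> j" "j \<le> N" for j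
    using that t(1) by (intro ZL) auto
  have sub: "\<theta> ` {1..k'} \<subseteq> t ` {1..N}" "\<theta>s ` {1..k} \<subseteq> t ` {1..N}"
    unfolding t(1) Z_def by blast+
  define a where "a = (\<lambda>i\<in>{1..N}. \<Sum>j\<in>{j\<in>{1..k'}. \<theta> j = t i}. w j)"
  define b where "b = (\<lambda>i\<in>{1..N}. \<Sum>j\<in>{j\<in>{1..k}. \<theta>s j = t i}. ws j)"
  have ab: "a \<in> weight_simplex N" "b \<in> weight_simplex N"
    unfolding a_def b_def by (rule regroup_weights[OF w injt sub(1)], rule regroup_weights[OF ws injt sub(2)])
  have "mixing k' w \<theta> = mixing N a t" unfolding a_def
    by (rule mixing_regroup[OF _ injt sub(1)]) (use w in \<open>auto simp: weight_simplex_def PiE_def Pi_def\<close>)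
  moreover have "mixing k ws \<theta>s = mixing N b t" unfolding b_def
    by (rule mixing_regroup[OF _ injt sub(2)]) (use ws in \<open>auto simp: weight_simplex_def PiE_def Pi_def\<close>)
  ultimately have "wasserstein1 (mixing k' w \<theta>) (mixing k ws \<theta>s)
      \<le> (\<Sum>l\<in>{1..<N}. (t (Suc l) - t l) * \<bar>\<Sum>i\<in>{1..l}. a i - b i\<bar>)"
    using wasserstein1_le_sum_gaps[OF ab tm] by simp
  also have "\<dots> \<le> (\<Sum>l\<in>{1..<N}. X powr (1 / real (A + 1)))"
  proof (rule sum_mono)
    fix l assume l: "l \<in> {1..<N}"
    define g where "g = t (Suc l) - t l"
    \<comment> \<open>Short blocks are at least as long as the gap; longer ones use the clusters
      they meet, by \<open>block_spread\<close>. At \<open>m = A + 2\<close> the second expression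
      would be 0, hence the threshold.\<close>
    define s where "s m = (if m \<le> A + 2 then g else \<gamma> / 2 * real ((m - A + 1) div 2 - 1))" for m
    have g: "0 < g" "g \<le> c"
      using t(2)[of l "Suc l"] l tL[of l] tL[of "Suc l"] by (auto simp: g_def c_def)
    \<comment> \<open>All representatives lie in \<open>[-L, L]\<close>, so even the largest value
      of \<open>s\<close> stays below \<open>c\<close>, as \<open>partial_mass_bound\<close>
      requires.\<close>
    have wide: "\<gamma> / 2 * real (k0 - 1) \<le> c"
    proof -
      have "(real (card (x ` I)) - 1) * (\<gamma> / 2) \<le> L - (- L)"
      proof (rule separated_points_spread)
        show "finite (x ` I)" "x ` I \<noteq> {}" using I by auto
        show "x ` I \<subseteq> {-L..L}"
        proof
          fix z assume "z \<in> x ` I"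
          then have "\<bar>z\<bar> \<le> L" using I(3) by (intro ZL) (auto simp: Z_def)
          then show "z \<in> {-L..L}" by auto
        qed
        show "\<gamma> / 2 \<le> \<bar>u - v\<bar>" if "u \<in> x ` I" "v \<in> x ` I" "u \<noteq> v" for u v
          using that sep by blast
      qed
      then show ?thesis using cI by (simp add: card_image[OF injx] c_def k0_def mult.commute)
    qed
    have s: "0 < s m \<and> s m \<le> c" if "2 \<le> m" "m \<le> 2 * k" for m
    proof (cases "m \<le> A + 2")
      case True
      then show ?thesis using g by (simp add: s_def)
    next
      case False
      define J where "J = (m - A + 1) div 2 - 1"
      have sm: "s m = \<gamma> / 2 * real J" using False by (simp add: s_def J_def)
      have "1 \<le> J" unfolding J_def using False by linarith
      moreover have "J \<le> k0 - 1" unfolding J_def using that k0k unfolding A_def by linarith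
      ultimately have J: "0 < real J" "real J \<le> real (k0 - 1)" by linarith+
      then have "\<gamma> / 2 * real J \<le> \<gamma> / 2 * real (k0 - 1)"
        using \<gamma> by (intro mult_left_mono) auto
      then have "\<gamma> / 2 * real J \<le> c" using wide by (rule order.trans)
      moreover have "0 < \<gamma> / 2 * real J" using J(1) \<gamma> by simp
      ultimately show ?thesis unfolding sm by blast
    qed
    have spread: "s (Suc q - p) \<le> t q - t p" if "1 \<le> p" "p \<le> l" "l < q" "q \<le> N" for p q
    proof (cases "Suc q - p \<le> A + 2")
      case True
      have "t p \<le> t l" "t (Suc l) \<le> t q" using that by (auto intro!: tm)
      then show ?thesis using True by (simp add: s_def g_def)
    next
      case False
      define Blk where "Blk = t ` {p..q}"
      have cB: "card Blk = Suc q - p" unfolding Blk_def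
        using that by (subst card_image) (auto intro: inj_on_subset[OF injt])
      have "Blk \<subseteq> \<theta>s ` {1..k} \<union> \<theta> ` {1..k'}"
      proof -
        have "Blk \<subseteq> t ` {1..N}" unfolding Blk_def using that by (intro image_mono) auto
        then show ?thesis unfolding t(1) Z_def by blast
      qed
      moreover have "Blk \<subseteq> {t p..t q}"
        using that by (auto simp: Blk_def intro!: tm)
      ultimately have "\<gamma> / 2 * real ((card Blk - 2 * (k - card I) + 1) div 2 - 1) \<le> t q - t p"
        using \<gamma> False cB
        by (intro block_spread[OF _ _ cX(1) cX(2) _ _ I(1,3,4) injx injy _ sep])
          (auto simp: A_def k0_def)
      then show ?thesis using False by (simp add: s_def cB A_def k0_def)
    qed
    have ps: "0 \<le> (\<Sum>i\<in>{1..l}. a i)" "(\<Sum>i\<in>{1..l}. a i) \<le> 1" "0 \<le> (\<Sum>i\<in>{1..l}. b i)" "(\<Sum>i\<in>{1..l}. b i) \<le> 1"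
      using partial_sum_simplex[OF ab(1), of l] partial_sum_simplex[OF ab(2), of l] l by auto
    have le1: "\<bar>\<Sum>i\<in>{1..l}. a i - b i\<bar> \<le> 1" unfolding sum_subtractf using ps by linarith
    have "\<bar>\<Sum>i\<in>{1..l}. a i - b i\<bar> \<le> \<delta> * (\<Prod>m\<in>{2..Suc N - 1}. 2 * (1 + L) / s m)"
    proof (rule partial_mass_bound[where p0 = 1 and q0 = N and q = N and t = t])
      show "\<bar>t j\<bar> \<le> L" if "1 \<le> j" "j \<le> N" for j using tL that .
      show "s (Suc q - p) \<le> t q - t p" if "1 \<le> p" "p \<le> l" "l < q" "q \<le> N" for p q using spread that .
      show "0 < s m \<and> s m \<le> 2 * (1 + L)" if "2 \<le> m" "m \<le> Suc N - 1" for m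
        using s[of m] that N2k by (simp add: c_def)
      show "(1::nat) \<le> 1" "1 \<le> Suc l" "l \<le> N" "N \<le> N" using l by auto
      show "0 \<le> \<delta>" by fact
      show "\<bar>\<Sum>j\<in>{1..N}. (a j - b j) * t j ^ r\<bar> \<le> \<delta>" if "r < Suc N - 1" for r
      proof -
        have "(\<Sum>j\<in>{1..N}. (a j - b j) * t j ^ r) = (\<Sum>j\<in>{1..k'}. w j * \<theta> j ^ r) - (\<Sum>j\<in>{1..k}. ws j * \<theta>s j ^ r)"
          using sum_regroup_weights[OF injt sub(1), of w "\<lambda>z. z ^ r"] sum_regroup_weights[OF injt sub(2), of ws "\<lambda>z. z ^ r"]
          unfolding a_def[symmetric] b_def[symmetric] by (simp only: left_diff_distrib sum_subtractf)
        \<comment> \<open>Order 0 is free, because both total masses are 1.\<close>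
        moreover have "(\<Sum>j\<in>{1..k'}. w j * \<theta> j ^ r) - (\<Sum>j\<in>{1..k}. ws j * \<theta>s j ^ r) = 0" if "r = 0"
          using w ws that by (simp add: weight_simplex_def)
        ultimately show ?thesis using mom[of r] that N2k \<delta> by (cases "r = 0") auto
      qed
    qed
    \<comment> \<open>The joint support may have fewer than \<open>2 * k\<close> points; the added
      factors are at least 1.\<close>
    also have "\<dots> \<le> \<delta> * (\<Prod>m\<in>{2..2 * k}. c / s m)"
    proof (rule mult_left_mono[OF _ \<delta>])
      have "(\<Prod>m\<in>{2..Suc N - 1}. 2 * (1 + L) / s m) = (\<Prod>m\<in>{2..N}. c / s m)" by (simp add: c_def)
      also have "\<dots> \<le> (\<Prod>m\<in>{2..2 * k}. c / s m)"
      proof (rule prod_mono2)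
        have cs: "1 \<le> c / s m" if "2 \<le> m" "m \<le> 2 * k" for m using s[OF that] by simp
        show "finite {2..2 * k}" "{2..N} \<subseteq> {2..2 * k}" using N2k by auto
        show "1 \<le> c / s m" if "m \<in> {2..2 * k} - {2..N}" for m using cs[of m] that by auto
        show "0 \<le> c / s m" if "m \<in> {2..N}" for m
          by (rule order.trans[OF zero_le_one cs]) (use that N2k in auto)
      qed
      finally show "(\<Prod>m\<in>{2..Suc N - 1}. 2 * (1 + L) / s m) \<le> (\<Prod>m\<in>{2..2 * k}. c / s m)" .
    qed
    also have "\<dots> = X / g ^ (A + 1)"
      unfolding s_def A_def prod_spread_bounds[OF cI k0k g(1) \<gamma>] by (simp add: X_def A_def)
    finally have "\<bar>\<Sum>i\<in>{1..l}. a i - b i\<bar> \<le> X / g ^ (A + 1)" .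
    then have "g * \<bar>\<Sum>i\<in>{1..l}. a i - b i\<bar> \<le> X powr (1 / real (A + 1))"
      by (rule mult_le_powr_inverse[OF g(1) abs_ge_zero le1]) simp
    then show "(t (Suc l) - t l) * \<bar>\<Sum>i\<in>{1..l}. a i - b i\<bar> \<le> X powr (1 / real (A + 1))"
      by (simp only: g_def)
  qed
  also have "\<dots> = real (N - 1) * X powr (1 / real (A + 1))" by simp
  also have "\<dots> \<le> 2 * real k * X powr (1 / real (A + 1))"
    using N2k by (intro mult_right_mono) auto
  finally show ?thesis by (simp add: X_def A_def k0_def c_def)
qed

section \<open>Hermite polynomials\<close>

definition gauss_expect :: "real \<Rightarrow> real poly \<Rightarrow> real" where
  "gauss_expect \<theta> p = (\<integral>x. normal_density \<theta> 1 x * poly p x \<partial>lborel)"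

text \<open>Expansion around the mean reduces Gaussian integrals of polynomials to central
  moments.\<close>

lemma poly_eq_shifted_sum:
  "poly p x = (\<Sum>i\<le>degree (p \<circ>\<^sub>p [:\<theta>, 1:]). coeff (p \<circ>\<^sub>p [:\<theta>, 1:]) i * (x - \<theta>) ^ i)" for p :: "real poly"
proof -
  have "poly p x = poly (p \<circ>\<^sub>p [:\<theta>, 1:]) (x - \<theta>)" by (simp add: poly_pcompose)
  then show ?thesis by (simp add: poly_altdef)
qed

lemma integrable_normal_poly: "integrable lborel (\<lambda>x. normal_density \<theta> 1 x * poly p x)"
proof -
  have "integrable lborel (\<lambda>x. coeff (p \<circ>\<^sub>p [:\<theta>, 1:]) i * (normal_density \<theta> 1 x * (x - \<theta>) ^ i))" for i
    by (intro integrable_mult_right integrable_normal_moment) simp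
  then have "integrable lborel (\<lambda>x. \<Sum>i\<le>degree (p \<circ>\<^sub>p [:\<theta>, 1:]). coeff (p \<circ>\<^sub>p [:\<theta>, 1:]) i * (normal_density \<theta> 1 x * (x - \<theta>) ^ i))"
    by (intro Bochner_Integration.integrable_sum)
  then show ?thesis
    by (subst poly_eq_shifted_sum[of _ _ \<theta>]) (simp add: sum_distrib_left mult_ac)
qed

lemma gauss_expect_add: "gauss_expect \<theta> (p + q) = gauss_expect \<theta> p + gauss_expect \<theta> q"
  unfolding gauss_expect_def using integrable_normal_poly[of \<theta> p] integrable_normal_poly[of \<theta> q]
  by (simp add: distrib_left)

lemma gauss_expect_diff: "gauss_expect \<theta> (p - q) = gauss_expect \<theta> p - gauss_expect \<theta> q"
  unfolding gauss_expect_def using integrable_normal_poly[of \<theta> p] integrable_normal_poly[of \<theta> q]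
  by (simp add: right_diff_distrib)

lemma gauss_expect_smult: "gauss_expect \<theta> (smult c p) = c * gauss_expect \<theta> p"
  unfolding gauss_expect_def by (simp add: mult.left_commute)

lemma gauss_expect_1: "gauss_expect \<theta> 1 = 1"
  unfolding gauss_expect_def by simp

lemma gauss_expect_nonneg: "(\<And>x. 0 \<le> poly p x) \<Longrightarrow> 0 \<le> gauss_expect \<theta> p"
  unfolding gauss_expect_def by (intro Bochner_Integration.integral_nonneg) auto

text \<open>Stein's identity for \<open>(x - \<theta>) ^ i\<close>. For even \<open>i\<close> both
  sides vanish; at \<open>i = 0\<close> the truncated exponent \<open>i - 1\<close> is multiplied by
  0.\<close>

lemma normal_moment_rec:
  "(\<integral>x. normal_density \<theta> 1 x * (x - \<theta>) ^ Suc i \<partial>lborel)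
    = real i * (\<integral>x. normal_density \<theta> 1 x * (x - \<theta>) ^ (i - 1) \<partial>lborel)"
proof (cases "even i")
  case True
  then obtain k where k: "i = 2 * k" by (elim evenE)
  have odd0: "(\<integral>x. normal_density \<theta> 1 x * (x - \<theta>) ^ (2 * j + 1) \<partial>lborel) = 0" for j
    by (rule integral_normal_moment_odd) simp
  show ?thesis
  proof (cases k)
    case 0
    then show ?thesis using odd0[of 0] k by simp
  next
    case (Suc j)
    then have "Suc i = 2 * k + 1" "i - 1 = 2 * j + 1" using k by auto
    then show ?thesis using odd0 by (simp only: mult_zero_right)
  qed
next
  case False
  then obtain k where k: "i = 2 * k + 1" by (elim oddE)
  have ev: "(\<integral>x. normal_density \<theta> 1 x * (x - \<theta>) ^ (2 * j) \<partial>lborel) = fact (2 * j) / (2 ^ j * fact j)" for j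
    using integral_normal_moment_even[of 1 \<theta> j] by simp
  have "Suc i = 2 * Suc k" "i - 1 = 2 * k" using k by auto
  moreover have "fact (2 * Suc k) / (2 ^ Suc k * fact (Suc k)) = real i * (fact (2 * k) / (2 ^ k * fact k) :: real)"
    unfolding k by (simp add: divide_simps)
  ultimately show ?thesis by (simp only: ev)
qed

lemma poly_pderiv_sum:
  "poly (pderiv q) y = (\<Sum>i\<le>degree q. coeff q i * (real i * y ^ (i - 1)))" for q :: "real poly"
proof -
  have "((\<lambda>y. \<Sum>i\<le>degree q. coeff q i * y ^ i) has_real_derivative
      (\<Sum>i\<le>degree q. coeff q i * (real i * y ^ (i - 1)))) (at y)"
    by (auto intro!: derivative_eq_intros sum.cong)
  then have "(poly q has_real_derivative (\<Sum>i\<le>degree q. coeff q i * (real i * y ^ (i - 1)))) (at y)"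
    by (simp add: poly_altdef[abs_def])
  then show ?thesis using poly_DERIV[of q y] by (metis DERIV_unique)
qed

text \<open>Stein's identity, obtained termwise from the recursion of the central moments instead of
  integration by parts.\<close>

lemma gauss_expect_stein: "gauss_expect \<theta> (pCons 0 p) = \<theta> * gauss_expect \<theta> p + gauss_expect \<theta> (pderiv p)"
proof -
  define q where "q = p \<circ>\<^sub>p [:\<theta>, 1:]"
  define \<mu> where "\<mu> i = (\<integral>x. normal_density \<theta> 1 x * (x - \<theta>) ^ i \<partial>lborel)" for i
  have int: "integrable lborel (\<lambda>x. c * (normal_density \<theta> 1 x * (x - \<theta>) ^ i))" for c i
    by (intro integrable_mult_right integrable_normal_moment) simp
  have ev: "(\<integral>x. normal_density \<theta> 1 x * (\<Sum>i\<le>degree q. c i * (x - \<theta>) ^ e i) \<partial>lborel)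
      = (\<Sum>i\<le>degree q. c i * \<mu> (e i))" for c e
  proof -
    have "(\<lambda>x. normal_density \<theta> 1 x * (\<Sum>i\<le>degree q. c i * (x - \<theta>) ^ e i))
      = (\<lambda>x. \<Sum>i\<le>degree q. c i * (normal_density \<theta> 1 x * (x - \<theta>) ^ e i))"
      by (simp add: sum_distrib_left mult_ac fun_eq_iff)
    then show ?thesis unfolding \<mu>_def using int by simp
  qed
  have p: "poly p x = (\<Sum>i\<le>degree q. coeff q i * (x - \<theta>) ^ i)" for x
    unfolding q_def by (rule poly_eq_shifted_sum)
  have "poly (pCons 0 p - smult \<theta> p) x = (\<Sum>i\<le>degree q. coeff q i * (x - \<theta>) ^ Suc i)" for x
  proof -
    have "poly (pCons 0 p - smult \<theta> p) x = (x - \<theta>) * poly p x" by (simp add: algebra_simps)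
    then show ?thesis by (simp add: p sum_distrib_left mult_ac)
  qed
  then have "gauss_expect \<theta> (pCons 0 p - smult \<theta> p) = (\<Sum>i\<le>degree q. coeff q i * \<mu> (Suc i))"
    unfolding gauss_expect_def using ev[of "coeff q" Suc] by simp
  also have "\<dots> = (\<Sum>i\<le>degree q. (coeff q i * real i) * \<mu> (i - 1))"
    unfolding \<mu>_def normal_moment_rec by (simp add: mult_ac)
  also have "\<dots> = gauss_expect \<theta> (pderiv p)"
  proof -
    have "poly (pderiv p) x = poly (pderiv q) (x - \<theta>)" for x
      by (simp add: q_def pderiv_pcompose poly_pcompose pderiv_pCons)
    then have "poly (pderiv p) x = (\<Sum>i\<le>degree q. (coeff q i * real i) * (x - \<theta>) ^ (i - 1))" for x
      by (simp add: poly_pderiv_sum mult_ac)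
    then show ?thesis
      unfolding gauss_expect_def using ev[of "\<lambda>i. coeff q i * real i" "\<lambda>i. i - 1"] by simp
  qed
  finally show ?thesis by (simp add: gauss_expect_diff gauss_expect_smult)
qed

text \<open>The probabilists' Hermite polynomials, given by the raising operator
  \<open>x - d/dx\<close>. By Stein's identity this operator multiplies expectations under a
  unit-variance normal law by its mean, which makes the polynomials unbiased for the powers of
  \<open>\<theta>\<close>.\<close>

fun hermite :: "nat \<Rightarrow> real poly" where
  "hermite 0 = 1"
| "hermite (Suc r) = pCons 0 (hermite r) - pderiv (hermite r)"

text \<open>The Appell property; it keeps the recursion for products below within the Hermite
  polynomials.\<close>

lemma pderiv_hermite: "pderiv (hermite (Suc r)) = smult (real (Suc r)) (hermite r)"
proof (induction r)
  case 0
  then show ?case by (simp add: pderiv_pCons)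
next
  case (Suc r)
  have "pderiv (hermite (Suc (Suc r))) =
      hermite (Suc r) + pCons 0 (pderiv (hermite (Suc r))) - pderiv (pderiv (hermite (Suc r)))"
    by (simp only: hermite.simps(2)[of "Suc r"] pderiv_diff pderiv_pCons)
  also have "\<dots> = hermite (Suc r) + smult (real (Suc r)) (hermite (Suc r))"
    unfolding Suc.IH by (simp add: pderiv_smult smult_diff_right)
  also have "\<dots> = smult (real (Suc (Suc r))) (hermite (Suc r))"
    by (simp only: of_nat_Suc[of "Suc r"] smult_add_left) (simp add: add.commute)
  finally show ?case .
qed

lemma gauss_expect_hermite: "gauss_expect \<theta> (hermite r) = \<theta> ^ r"
  by (induction r) (simp_all add: gauss_expect_1 gauss_expect_diff gauss_expect_stein)

text \<open>Stein's identity for the product yields the derivatives of both factors, and that of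
  \<open>hermite r\<close> cancels against the raising operator. At \<open>m = 0\<close> the factor
  \<open>real m\<close> removes the truncated index.\<close>

lemma gauss_expect_hermite_mult_Suc:
  "gauss_expect \<theta> (hermite (Suc r) * hermite m) =
    \<theta> * gauss_expect \<theta> (hermite r * hermite m) + real m * gauss_expect \<theta> (hermite r * hermite (m - 1))"
proof -
  have "hermite (Suc r) * hermite m = pCons 0 (hermite r * hermite m) - pderiv (hermite r) * hermite m"
    by (simp add: left_diff_distrib)
  then have "gauss_expect \<theta> (hermite (Suc r) * hermite m) =
      \<theta> * gauss_expect \<theta> (hermite r * hermite m) + gauss_expect \<theta> (hermite r * pderiv (hermite m))"
    by (simp add: gauss_expect_diff gauss_expect_stein pderiv_mult gauss_expect_add mult.commute)
  also have "gauss_expect \<theta> (hermite r * pderiv (hermite m)) = real m * gauss_expect \<theta> (hermite r * hermite (m - 1))"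
  proof (cases m)
    case 0
    then show ?thesis by (simp add: gauss_expect_def)
  next
    case (Suc m')
    then show ?thesis by (simp only: pderiv_hermite mult_smult_right gauss_expect_smult diff_Suc_1)
  qed
  finally show ?thesis .
qed

text \<open>Induction on \<open>r + m\<close>, always lowering the larger index: for
  \<open>m \<le> Suc r\<close> the square of \<open>m\<close> is at most \<open>Suc r * m\<close>,
  which keeps the derivative term below \<open>sqrt (fact (Suc r) * fact m)\<close>. In
  \<open>1 + L\<close>, the \<open>L\<close> comes from the mean and the 1 from the
  derivative.\<close>

lemma gauss_expect_hermite_mult_le:
  assumes "\<bar>\<theta>\<bar> \<le> L"
  shows "\<bar>gauss_expect \<theta> (hermite r * hermite m)\<bar> \<le> sqrt (fact r * fact m) * (1 + L) ^ (r + m)"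
proof (induction "r + m" arbitrary: r m rule: less_induct)
  case less
  have L: "0 \<le> L" using assms by simp
  have main: "\<bar>gauss_expect \<theta> (hermite (Suc r) * hermite m)\<bar> \<le> sqrt (fact (Suc r) * fact m) * (1 + L) ^ (Suc r + m)"
    if "m \<le> Suc r" and IH: "\<And>r' m'. r' + m' < Suc r + m \<Longrightarrow>
      \<bar>gauss_expect \<theta> (hermite r' * hermite m')\<bar> \<le> sqrt (fact r' * fact m') * (1 + L) ^ (r' + m')" for r m
  proof -
    define S where "S = sqrt (fact (Suc r) * fact m)"
    have s1: "sqrt (fact r * fact m) \<le> S" unfolding S_def
      by (intro real_sqrt_le_mono mult_right_mono fact_mono) auto
    have s2: "real m * sqrt (fact r * fact (m - 1)) \<le> S"
    proof (cases m)
      case (Suc m')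
      have "real m * sqrt (fact r * fact (m - 1)) = sqrt ((real m)\<^sup>2 * (fact r * fact m'))"
        using Suc by (simp add: real_sqrt_mult)
      also have "\<dots> \<le> sqrt (real (Suc r) * real m * (fact r * fact m'))"
        using that(1) Suc unfolding power2_eq_square by (intro real_sqrt_le_mono mult_right_mono) auto
      also have "\<dots> = S" using Suc by (simp add: S_def mult_ac)
      finally show ?thesis .
    qed (simp add: S_def)
    define P where "P = (1 + L) ^ (r + m)"
    have P: "1 \<le> P" using L by (simp add: P_def)
    have "\<bar>\<theta> * gauss_expect \<theta> (hermite r * hermite m)\<bar> \<le> L * (S * P)"
      unfolding abs_mult
    proof (intro mult_mono)
      show "\<bar>gauss_expect \<theta> (hermite r * hermite m)\<bar> \<le> S * P"
        by (rule order.trans[OF IH]) (use s1 P in \<open>auto simp: P_def[symmetric] intro!: mult_right_mono\<close>)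
    qed (use assms L in auto)
    moreover have "\<bar>real m * gauss_expect \<theta> (hermite r * hermite (m - 1))\<bar> \<le> S * P"
    proof -
      have "\<bar>real m * gauss_expect \<theta> (hermite r * hermite (m - 1))\<bar>
          \<le> real m * (sqrt (fact r * fact (m - 1)) * (1 + L) ^ (r + (m - 1)))"
        unfolding abs_mult by (simp, intro mult_left_mono IH) auto
      also have "\<dots> = (real m * sqrt (fact r * fact (m - 1))) * (1 + L) ^ (r + (m - 1))" by simp
      also have "\<dots> \<le> S * P" unfolding P_def using s2 L
        by (intro mult_mono power_increasing) (auto simp: S_def)
      finally show ?thesis .
    qed
    ultimately have "\<bar>gauss_expect \<theta> (hermite (Suc r) * hermite m)\<bar> \<le> L * (S * P) + S * P"
      unfolding gauss_expect_hermite_mult_Suc by (rule order.trans[OF abs_triangle_ineq add_mono])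
    also have "\<dots> = S * (1 + L) ^ (Suc r + m)" by (simp add: P_def algebra_simps)
    finally show ?thesis by (simp only: S_def)
  qed
  consider "r = 0" "m = 0" | r' where "r = Suc r'" "m \<le> r" | m' where "m = Suc m'" "r \<le> m"
    by (cases r; cases m) (auto, metis nat_le_linear)
  then show ?case
  proof cases
    case 1
    then show ?thesis by (simp add: gauss_expect_1)
  next
    case 2
    then show ?thesis using main[of m r'] less by auto
  next
    case 3
    then show ?thesis using main[of r m'] less by (auto simp: mult.commute[of "hermite r"] mult.commute[of "fact r"] add.commute[of r])
  qed
qed

lemma gauss_expect_hermite_square:
  assumes "\<bar>\<theta>\<bar> \<le> L"
  shows "gauss_expect \<theta> (hermite r * hermite r) \<le> fact r * (1 + L) ^ (2 * r)"
  using gauss_expect_hermite_mult_le[OF assms, of r r] by (simp add: mult_2)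

section \<open>A test for the moments\<close>

abbreviation lebesgue_pow :: "nat \<Rightarrow> (nat \<Rightarrow> real) measure" where
  "lebesgue_pow n \<equiv> \<Pi>\<^sub>M i\<in>{1..n}. (lborel :: real measure)"

definition mixing_moment :: "nat \<Rightarrow> (nat \<Rightarrow> real) \<Rightarrow> (nat \<Rightarrow> real) \<Rightarrow> nat \<Rightarrow> real" where
  "mixing_moment k w \<theta> r = (\<Sum>j\<in>{1..k}. w j * \<theta> j ^ r)"

interpretation lborel_product: product_sigma_finite "\<lambda>_::nat. lborel :: real measure"
  by standard

section \<open>Likelihoods as densities with respect to \<open>lebesgue_pow n\<close>\<close>

lemma nn_integral_linear_combination:
  assumes [measurable]: "f \<in> borel_measurable M" "g \<in> borel_measurable M"
  shows "(\<integral>\<^sup>+ x. c * f x + d * g x \<partial>M) = c * integral\<^sup>N M f + d * integral\<^sup>N M g"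
  by (subst nn_integral_add) (simp_all add: nn_integral_cmult)

lemma mixture_density_mixing:
  "mixture_density (mixing k w \<theta>) x = (\<Sum>j\<in>{1..k}. ennreal (w j) * ennreal (normal_density (\<theta> j) 1 x))"
  unfolding mixture_density_def by (rule nn_integral_mixing) (simp add: normal_density_def)

lemma measurable_mixture_density [measurable]:
  "mixture_density (mixing k w \<theta>) \<in> borel_measurable borel"
  unfolding mixture_density_mixing[abs_def] by measurable

lemma measurable_joint_density [measurable]:
  "joint_density n (mixing k w \<theta>) \<in> borel_measurable (lebesgue_pow n)"
  unfolding joint_density_def[abs_def] by measurable

lemma nn_integral_prod_joint_density:
  assumes [measurable]: "f \<in> borel_measurable borel"
  shows "(\<integral>\<^sup>+ x. (\<Prod>i\<in>{1..n}. f (x i)) * joint_density n (mixing k w \<theta>) x \<partial>lebesgue_pow n)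
    = (\<integral>\<^sup>+ y. f y * mixture_density (mixing k w \<theta>) y \<partial>lborel) ^ n"
proof -
  have "(\<integral>\<^sup>+ x. (\<Prod>i\<in>{1..n}. f (x i)) * joint_density n (mixing k w \<theta>) x \<partial>lebesgue_pow n)
      = (\<integral>\<^sup>+ x. (\<Prod>i\<in>{1..n}. f (x i) * mixture_density (mixing k w \<theta>) (x i)) \<partial>lebesgue_pow n)"
    by (simp only: joint_density_def prod.distrib)
  also have "\<dots> = (\<Prod>i\<in>{1..n}. \<integral>\<^sup>+ y. f y * mixture_density (mixing k w \<theta>) y \<partial>lborel)"
    by (rule lborel_product.product_nn_integral_prod) auto
  finally show ?thesis by simp
qed

lemma nn_integral_normal_density: "(\<integral>\<^sup>+ y. ennreal (normal_density \<theta> 1 y) \<partial>lborel) = 1"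
  using prob_space.emeasure_space_1[OF prob_space_normal_density[of 1 \<theta>]]
  by (simp add: emeasure_density)

lemma nn_integral_mult_mixture_density:
  assumes [measurable]: "f \<in> borel_measurable borel"
  shows "(\<integral>\<^sup>+ y. f y * mixture_density (mixing k w \<theta>) y \<partial>lborel)
    = (\<Sum>j\<in>{1..k}. ennreal (w j) * (\<integral>\<^sup>+ y. f y * ennreal (normal_density (\<theta> j) 1 y) \<partial>lborel))"
  unfolding mixture_density_mixing sum_distrib_left
  by (subst nn_integral_sum) (auto simp: mult.left_commute[of "f _"] nn_integral_cmult intro!: sum.cong)

lemma simplex_nonneg: "w \<in> weight_simplex k \<Longrightarrow> j \<in> {1..k} \<Longrightarrow> 0 \<le> w j"
  by (auto simp: weight_simplex_def PiE_def Pi_def)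

lemma sum_ennreal_simplex:
  assumes "w \<in> weight_simplex k" "\<And>j. j \<in> {1..k} \<Longrightarrow> 0 \<le> f j"
  shows "(\<Sum>j\<in>{1..k}. ennreal (w j) * ennreal (f j)) = ennreal (\<Sum>j\<in>{1..k}. w j * f j)"
  using assms simplex_nonneg[OF assms(1)]
  by (subst sum_ennreal[symmetric]) (auto simp: ennreal_mult intro!: sum.cong)

lemma nn_integral_mixture_density:
  assumes "w \<in> weight_simplex k"
  shows "(\<integral>\<^sup>+ y. mixture_density (mixing k w \<theta>) y \<partial>lborel) = 1"
proof -
  have "(\<integral>\<^sup>+ y. mixture_density (mixing k w \<theta>) y \<partial>lborel) = (\<Sum>j\<in>{1..k}. ennreal (w j) * ennreal 1)"
    using nn_integral_mult_mixture_density[of "\<lambda>_. 1" k w \<theta>] by (simp add: nn_integral_normal_density)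
  also have "\<dots> = ennreal (\<Sum>j\<in>{1..k}. w j * 1)" by (rule sum_ennreal_simplex[OF assms]) simp
  also have "\<dots> = 1" using assms by (simp add: weight_simplex_def)
  finally show ?thesis .
qed

lemma nn_integral_joint_density:
  assumes "w \<in> weight_simplex k"
  shows "(\<integral>\<^sup>+ x. joint_density n (mixing k w \<theta>) x \<partial>lebesgue_pow n) = 1"
  using nn_integral_prod_joint_density[of "\<lambda>_. 1" n k w \<theta>] nn_integral_mixture_density[OF assms]
  by simp

text \<open>Product measures are determined by boxes. All expectations move to the common measure
  \<open>lebesgue_pow n\<close>, where likelihoods can be compared and Fubini applies.\<close>

lemma iid_data_eq_density:
  assumes w: "w \<in> weight_simplex k"
  shows "iid_data n (mixing k w \<theta> \<star> std_normal) = density (lebesgue_pow n) (joint_density n (mixing k w \<theta>))"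
proof -
  define G where "G = density lborel (mixture_density (mixing k w \<theta>))"
  have G: "mixing k w \<theta> \<star> std_normal = G"
    unfolding G_def by (rule convolution_std_normal[OF prob_space_mixing[OF w]]) (simp add: mixing_def)
  have "prob_space G"
    by (rule prob_spaceI) (simp add: G_def emeasure_density nn_integral_mixture_density[OF w])
  then interpret G: prob_space G .
  interpret P: product_sigma_finite "\<lambda>_::nat. G" by standard
  have sG: "sets G = sets borel" by (simp add: G_def)
  have "density (lebesgue_pow n) (joint_density n (mixing k w \<theta>)) = (\<Pi>\<^sub>M i\<in>{1..n}. G)"
  proof (rule P.PiM_eqI)
    show "finite {1..n}" by simp
    show "sets (density (lebesgue_pow n) (joint_density n (mixing k w \<theta>))) = sets (\<Pi>\<^sub>M i\<in>{1..n}. G)"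
      by (simp add: sG cong: sets_PiM_cong)
    fix A :: "nat \<Rightarrow> real set" assume "\<And>i. i \<in> {1..n} \<Longrightarrow> A i \<in> sets G"
    then have A: "A i \<in> sets borel" if "i \<in> {1..n}" for i using that sG by auto
    have PA: "Pi\<^sub>E {1..n} A \<in> sets (lebesgue_pow n)" using A by (intro sets_PiM_I_finite) auto
    have "emeasure (density (lebesgue_pow n) (joint_density n (mixing k w \<theta>))) (Pi\<^sub>E {1..n} A)
        = (\<integral>\<^sup>+ x. joint_density n (mixing k w \<theta>) x * indicator (Pi\<^sub>E {1..n} A) x \<partial>lebesgue_pow n)"
      by (rule emeasure_density[OF measurable_joint_density PA])
    also have "\<dots> = (\<integral>\<^sup>+ x. (\<Prod>i\<in>{1..n}. mixture_density (mixing k w \<theta>) (x i) * indicator (A i) (x i)) \<partial>lebesgue_pow n)"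
    proof (rule nn_integral_cong)
      fix x assume "x \<in> space (lebesgue_pow n)"
      then have "x \<in> Pi\<^sub>E {1..n} A \<longleftrightarrow> (\<forall>i\<in>{1..n}. x i \<in> A i)" by (auto simp: space_PiM PiE_def)
      then have "(indicator (Pi\<^sub>E {1..n} A) x :: ennreal) = (\<Prod>i\<in>{1..n}. indicator (A i) (x i))"
        by (auto simp: indicator_def prod_zero_iff)
      then show "joint_density n (mixing k w \<theta>) x * indicator (Pi\<^sub>E {1..n} A) x
          = (\<Prod>i\<in>{1..n}. mixture_density (mixing k w \<theta>) (x i) * indicator (A i) (x i))"
        by (simp only: joint_density_def prod.distrib)
    qed
    also have "\<dots> = (\<Prod>i\<in>{1..n}. \<integral>\<^sup>+ y. mixture_density (mixing k w \<theta>) y * indicator (A i) y \<partial>lborel)"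
      using A by (intro lborel_product.product_nn_integral_prod) auto
    also have "\<dots> = (\<Prod>i\<in>{1..n}. emeasure G (A i))"
      using A by (intro prod.cong refl) (simp add: G_def emeasure_density)
    finally show "emeasure (density (lebesgue_pow n) (joint_density n (mixing k w \<theta>))) (Pi\<^sub>E {1..n} A)
      = (\<Prod>i\<in>{1..n}. emeasure G (A i))" .
  qed
  then show ?thesis by (simp add: iid_data_def G)
qed

text \<open>
  The exponential of Catoni's influence function: like the exponential it is multiplicative under
  \<open>y \<mapsto> - y\<close>, but it needs only second moments to be integrable.
\<close>

definition catoni :: "real \<Rightarrow> real" where
  "catoni y = (if 0 \<le> y then 1 + y + y\<^sup>2 / 2 else 1 / (1 - y + y\<^sup>2 / 2))"

section \<open>Exponential moments of the robust statistics\<close>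

lemma quadratic_pos: "0 < 1 + y + y\<^sup>2 / 2" for y :: real
proof -
  have "1 + y + y\<^sup>2 / 2 = ((1 + y)\<^sup>2 + 1) / 2" by (simp add: power2_eq_square field_simps)
  also have "\<dots> > 0" by (smt (verit) zero_le_power2 divide_pos_pos)
  finally show ?thesis .
qed

lemma catoni_pos: "0 < catoni y"
  using quadratic_pos[of y] quadratic_pos[of "- y"] by (simp add: catoni_def)

text \<open>For negative \<open>y\<close> the quadratics at \<open>y\<close> and \<open>- y\<close>
  have product \<open>1 + y ^ 4 / 4\<close>, at least 1. The matching lower bound comes from
  \<open>catoni_mult_uminus\<close>.\<close>

lemma catoni_le: "catoni y \<le> 1 + y + y\<^sup>2 / 2"
proof (cases "0 \<le> y")
  case False
  have "(1 + y + y\<^sup>2 / 2) * (1 - y + y\<^sup>2 / 2) = 1 + (y ^ 4) / 4"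
    by (simp add: field_simps power2_eq_square power4_eq_xxxx)
  then have "1 \<le> (1 + y + y\<^sup>2 / 2) * (1 - y + y\<^sup>2 / 2)" by simp
  then show ?thesis using False quadratic_pos[of "- y"] by (simp add: catoni_def divide_le_eq)
qed (simp add: catoni_def)

lemma catoni_mult_uminus: "catoni y * catoni (- y) = 1"
  using quadratic_pos[of y] quadratic_pos[of "- y"] by (auto simp: catoni_def)

lemma measurable_catoni [measurable]: "catoni \<in> borel_measurable borel"
  unfolding catoni_def[abs_def] by measurable

lemma measurable_poly [measurable]: "(\<lambda>x. poly p x) \<in> borel_measurable borel" for p :: "real poly"
  by (intro borel_measurable_continuous_onI continuous_intros)

text \<open>The quadratic bound leaves the Gaussian expectation of a polynomial: the linear part is
  unbiased for \<open>\<theta> ^ r - m\<close>, and the quadratic part is a second moment bounded by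
  \<open>V\<close>.\<close>

lemma nn_integral_catoni_normal:
  assumes "\<bar>\<theta>\<bar> \<le> L" and V: "2 * (fact r * (1 + L) ^ (2 * r)) + 2 * m\<^sup>2 \<le> V"
  shows "(\<integral>\<^sup>+ y. ennreal (catoni (a * (poly (hermite r) y - m))) * ennreal (normal_density \<theta> 1 y) \<partial>lborel)
    \<le> ennreal (1 + a * (\<theta> ^ r - m) + a\<^sup>2 * V / 2)"
proof -
  define H where "H = hermite r"
  define Q where "Q = 1 + smult a (H - [:m:]) + smult (a\<^sup>2 / 2) ((H - [:m:]) * (H - [:m:]))"
  have Q: "poly Q y = 1 + a * (poly H y - m) + (a * (poly H y - m))\<^sup>2 / 2" for y
    by (simp add: Q_def power_mult_distrib power2_eq_square)
  have const: "gauss_expect \<theta> [:c:] = c" for c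
    using gauss_expect_smult[of \<theta> c 1] by (simp add: gauss_expect_1)
  have Q0: "0 \<le> poly Q y" for y unfolding Q using quadratic_pos by (simp add: less_imp_le)
  have "(\<integral>\<^sup>+ y. ennreal (catoni (a * (poly H y - m))) * ennreal (normal_density \<theta> 1 y) \<partial>lborel)
      \<le> (\<integral>\<^sup>+ y. ennreal (normal_density \<theta> 1 y * poly Q y) \<partial>lborel)"
  proof (rule nn_integral_mono)
    fix y
    have "catoni (a * (poly H y - m)) * normal_density \<theta> 1 y \<le> poly Q y * normal_density \<theta> 1 y"
      unfolding Q using catoni_le by (intro mult_right_mono) auto
    then show "ennreal (catoni (a * (poly H y - m))) * ennreal (normal_density \<theta> 1 y)
        \<le> ennreal (normal_density \<theta> 1 y * poly Q y)"
      using catoni_pos by (simp add: ennreal_mult[symmetric] less_imp_le mult.commute ennreal_leI)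
  qed
  also have "\<dots> = ennreal (gauss_expect \<theta> Q)"
    unfolding gauss_expect_def using Q0 by (intro nn_integral_eq_integral integrable_normal_poly) auto
  also have "gauss_expect \<theta> Q \<le> 1 + a * (\<theta> ^ r - m) + a\<^sup>2 * V / 2"
  proof -
    \<comment> \<open>Adding the nonnegative square of \<open>H + m\<close> removes the cross term,
      by the parallelogram identity.\<close>
    have "0 \<le> gauss_expect \<theta> ((H + [:m:]) * (H + [:m:]))" by (rule gauss_expect_nonneg) simp
    then have "gauss_expect \<theta> ((H - [:m:]) * (H - [:m:])) \<le> gauss_expect \<theta> ((H - [:m:]) * (H - [:m:])) +
        gauss_expect \<theta> ((H + [:m:]) * (H + [:m:]))" by simp
    also have "\<dots> = gauss_expect \<theta> (smult 2 (H * H) + [:2 * m\<^sup>2:])"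
      unfolding gauss_expect_add[symmetric]
      by (rule arg_cong[where f = "gauss_expect \<theta>"])
        (subst poly_eq_poly_eq_iff[symmetric], rule ext, simp add: power2_eq_square algebra_simps)
    also have "\<dots> \<le> V"
      using V gauss_expect_hermite_square[OF assms(1), of r]
      by (simp add: gauss_expect_add gauss_expect_smult const H_def)
    finally have "a\<^sup>2 / 2 * gauss_expect \<theta> ((H - [:m:]) * (H - [:m:])) \<le> a\<^sup>2 / 2 * V"
      by (intro mult_left_mono) auto
    then show ?thesis
      by (simp add: Q_def gauss_expect_add gauss_expect_smult gauss_expect_diff const gauss_expect_1)
        (simp add: H_def gauss_expect_hermite)
  qed
  finally show ?thesis by (simp add: H_def ennreal_leI)
qed

lemma nn_integral_catoni_mixture:
  assumes w: "w \<in> weight_simplex k" and \<theta>: "\<theta> \<in> atom_cube L k"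
    and V: "2 * (fact r * (1 + L) ^ (2 * r)) + 2 * m\<^sup>2 \<le> V"
  shows "(\<integral>\<^sup>+ y. ennreal (catoni (a * (poly (hermite r) y - m))) * mixture_density (mixing k w \<theta>) y \<partial>lborel)
    \<le> ennreal (exp (a * (mixing_moment k w \<theta> r - m) + a\<^sup>2 * V / 2))"
proof -
  have th: "\<bar>\<theta> j\<bar> \<le> L" if "j \<in> {1..k}" for j
    using \<theta> that by (auto simp: atom_cube_def PiE_def Pi_def abs_le_iff minus_le_iff)
  \<comment> \<open>Each summand must be nonnegative to be added as an extended nonnegative real;
    \<open>V\<close> dominates the squared deviation, and the quadratic is positive.\<close>
  have pos: "0 \<le> 1 + a * (\<theta> j ^ r - m) + a\<^sup>2 * V / 2" if "j \<in> {1..k}" for j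
  proof -
    have "(\<theta> j ^ r - m)\<^sup>2 \<le> V"
    proof -
      have "(\<theta> j ^ r - m)\<^sup>2 \<le> 2 * (\<theta> j ^ r)\<^sup>2 + 2 * m\<^sup>2"
        using zero_le_power2[of "\<theta> j ^ r + m"] by (simp add: power2_eq_square algebra_simps)
      also have "(\<theta> j ^ r)\<^sup>2 = \<bar>\<theta> j\<bar> ^ (2 * r)" by (simp add: power_mult[symmetric] mult.commute power_even_abs)
      also have "\<bar>\<theta> j\<bar> ^ (2 * r) \<le> (1 + L) ^ (2 * r)" using th[OF that] by (intro power_mono) auto
      also have "\<dots> \<le> fact r * (1 + L) ^ (2 * r)"
        using mult_right_mono[OF fact_ge_1[of r, where 'a = real], of "(1 + L) ^ (2 * r)"] by simp
      finally show ?thesis using V by linarith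
    qed
    then have "a\<^sup>2 * (\<theta> j ^ r - m)\<^sup>2 \<le> a\<^sup>2 * V" by (intro mult_left_mono) auto
    then show ?thesis using quadratic_pos[of "a * (\<theta> j ^ r - m)"] by (simp add: power_mult_distrib)
  qed
  have "(\<integral>\<^sup>+ y. ennreal (catoni (a * (poly (hermite r) y - m))) * mixture_density (mixing k w \<theta>) y \<partial>lborel)
    = (\<Sum>j\<in>{1..k}. ennreal (w j) * (\<integral>\<^sup>+ y. ennreal (catoni (a * (poly (hermite r) y - m))) *
        ennreal (normal_density (\<theta> j) 1 y) \<partial>lborel))"
    by (rule nn_integral_mult_mixture_density) measurable
  also have "\<dots> \<le> (\<Sum>j\<in>{1..k}. ennreal (w j) * ennreal (1 + a * (\<theta> j ^ r - m) + a\<^sup>2 * V / 2))"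
    by (intro sum_mono mult_left_mono nn_integral_catoni_normal[OF th V]) auto
  also have "\<dots> = ennreal (\<Sum>j\<in>{1..k}. w j * (1 + a * (\<theta> j ^ r - m) + a\<^sup>2 * V / 2))"
    using pos by (intro sum_ennreal_simplex[OF w])
  also have "(\<Sum>j\<in>{1..k}. w j * (1 + a * (\<theta> j ^ r - m) + a\<^sup>2 * V / 2))
      = (\<Sum>j\<in>{1..k}. (1 - a * m + a\<^sup>2 * V / 2) * w j + a * (w j * \<theta> j ^ r))"
    by (intro sum.cong refl) (simp add: algebra_simps)
  also have "\<dots> = (1 - a * m + a\<^sup>2 * V / 2) * (\<Sum>j\<in>{1..k}. w j) + a * mixing_moment k w \<theta> r"
    unfolding mixing_moment_def by (simp only: sum.distrib sum_distrib_left)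
  also have "\<dots> = 1 + (a * (mixing_moment k w \<theta> r - m) + a\<^sup>2 * V / 2)"
    using w by (simp add: weight_simplex_def algebra_simps)
  \<comment> \<open>Exponentiating only after averaging over the components keeps the bound in terms
    of the moment of the mixture.\<close>
  also have "ennreal \<dots> \<le> ennreal (exp (a * (mixing_moment k w \<theta> r - m) + a\<^sup>2 * V / 2))"
    by (intro ennreal_leI exp_ge_add_one_self)
  finally show ?thesis .
qed

text \<open>The exponential of Catoni's influence sum at scale \<open>a\<close>, for the hypothesis
  that the moment of order \<open>r\<close> is \<open>m\<close>.\<close>

definition moment_stat :: "nat \<Rightarrow> nat \<Rightarrow> real \<Rightarrow> real \<Rightarrow> (nat \<Rightarrow> real) \<Rightarrow> ennreal" where
  "moment_stat n r m a x = (\<Prod>i\<in>{1..n}. ennreal (catoni (a * (poly (hermite r) (x i) - m))))"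

lemma measurable_moment_stat [measurable]: "moment_stat n r m a \<in> borel_measurable (lebesgue_pow n)"
  unfolding moment_stat_def[abs_def] by measurable

text \<open>Reflection of the scale inverts the statistic, which replaces estimates of the lower
  tail.\<close>

lemma moment_stat_mult_uminus: "moment_stat n r m a x * moment_stat n r m (- a) x = 1"
  unfolding moment_stat_def prod.distrib[symmetric]
  by (intro prod.neutral ballI)
    (simp add: ennreal_mult[symmetric] catoni_pos less_imp_le catoni_mult_uminus)

lemma nn_integral_moment_stat:
  assumes w: "w \<in> weight_simplex k" and \<theta>: "\<theta> \<in> atom_cube L k"
    and V: "2 * (fact r * (1 + L) ^ (2 * r)) + 2 * m\<^sup>2 \<le> V"
  shows "(\<integral>\<^sup>+ x. moment_stat n r m a x * joint_density n (mixing k w \<theta>) x \<partial>lebesgue_pow n)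
    \<le> ennreal (exp (real n * (a * (mixing_moment k w \<theta> r - m) + a\<^sup>2 * V / 2)))"
proof -
  have "(\<integral>\<^sup>+ x. moment_stat n r m a x * joint_density n (mixing k w \<theta>) x \<partial>lebesgue_pow n)
      = (\<integral>\<^sup>+ y. ennreal (catoni (a * (poly (hermite r) y - m))) * mixture_density (mixing k w \<theta>) y \<partial>lborel) ^ n"
    unfolding moment_stat_def by (rule nn_integral_prod_joint_density) measurable
  also have "\<dots> \<le> ennreal (exp (a * (mixing_moment k w \<theta> r - m) + a\<^sup>2 * V / 2)) ^ n"
    by (intro power_mono nn_integral_catoni_mixture[OF w \<theta> V]) auto
  also have "\<dots> = ennreal (exp (real n * (a * (mixing_moment k w \<theta> r - m) + a\<^sup>2 * V / 2)))"
    by (simp add: ennreal_power exp_of_nat_mult)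
  finally show ?thesis .
qed

section \<open>The rejection region and its two errors\<close>

definition reject :: "nat \<Rightarrow> nat \<Rightarrow> (nat \<Rightarrow> real) \<Rightarrow> real \<Rightarrow> real \<Rightarrow> (nat \<Rightarrow> real) set" where
  "reject n R m a \<tau> = {x \<in> space (lebesgue_pow n).
     \<exists>r\<in>{1..R}. ennreal \<tau> \<le> moment_stat n r (m r) a x \<or> ennreal \<tau> \<le> moment_stat n r (m r) (- a) x}"

lemma sets_reject [measurable]: "reject n R m a \<tau> \<in> sets (lebesgue_pow n)"
  unfolding reject_def by measurable

text \<open>Markov's inequality and a union bound over the \<open>R\<close> orders and both signs.
  At the true distribution the linear term of the exponent vanishes.\<close>

lemma reject_type1:
  assumes w: "w \<in> weight_simplex k" and \<theta>: "\<theta> \<in> atom_cube L k"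
    and V: "\<And>r. r \<in> {1..R} \<Longrightarrow> 2 * (fact r * (1 + L) ^ (2 * r)) + 2 * (mixing_moment k w \<theta> r)\<^sup>2 \<le> V"
    and \<tau>: "0 < \<tau>"
  shows "(\<integral>\<^sup>+ x. indicator (reject n R (mixing_moment k w \<theta>) a \<tau>) x * joint_density n (mixing k w \<theta>) x \<partial>lebesgue_pow n)
    \<le> ennreal (2 * real R * exp (real n * (a\<^sup>2 * V / 2)) / \<tau>)"
proof -
  let ?m = "mixing_moment k w \<theta>"
  let ?p = "joint_density n (mixing k w \<theta>)"
  have "(\<integral>\<^sup>+ x. indicator (reject n R ?m a \<tau>) x * ?p x \<partial>lebesgue_pow n)
    \<le> (\<integral>\<^sup>+ x. (\<Sum>r\<in>{1..R}. ennreal (1 / \<tau>) * (moment_stat n r (?m r) a x * ?p x) +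
        ennreal (1 / \<tau>) * (moment_stat n r (?m r) (- a) x * ?p x)) \<partial>lebesgue_pow n)"
  proof (rule nn_integral_mono)
    fix x
    have ge1: "1 \<le> ennreal (1 / \<tau>) * z" if "ennreal \<tau> \<le> z" for z
    proof -
      have "1 = ennreal (1 / \<tau>) * ennreal \<tau>" using \<tau> by (simp add: ennreal_mult[symmetric])
      also have "\<dots> \<le> ennreal (1 / \<tau>) * z" by (intro mult_left_mono that) simp
      finally show ?thesis .
    qed
    show "indicator (reject n R ?m a \<tau>) x * ?p x \<le>
      (\<Sum>r\<in>{1..R}. ennreal (1 / \<tau>) * (moment_stat n r (?m r) a x * ?p x) +
        ennreal (1 / \<tau>) * (moment_stat n r (?m r) (- a) x * ?p x))"
    proof (cases "x \<in> reject n R ?m a \<tau>")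
      case True
      then obtain r where r: "r \<in> {1..R}"
        "ennreal \<tau> \<le> moment_stat n r (?m r) a x \<or> ennreal \<tau> \<le> moment_stat n r (?m r) (- a) x"
        by (auto simp: reject_def)
      have "1 \<le> ennreal (1 / \<tau>) * moment_stat n r (?m r) a x + ennreal (1 / \<tau>) * moment_stat n r (?m r) (- a) x"
        using r(2) ge1 by (metis add_increasing add_increasing2 zero_le)
      then have "1 * ?p x \<le> (ennreal (1 / \<tau>) * moment_stat n r (?m r) a x + ennreal (1 / \<tau>) * moment_stat n r (?m r) (- a) x) * ?p x"
        by (intro mult_right_mono) auto
      also have "\<dots> = ennreal (1 / \<tau>) * (moment_stat n r (?m r) a x * ?p x) +
        ennreal (1 / \<tau>) * (moment_stat n r (?m r) (- a) x * ?p x)" by (simp add: distrib_right mult.assoc)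
      also have "\<dots> \<le> (\<Sum>r\<in>{1..R}. ennreal (1 / \<tau>) * (moment_stat n r (?m r) a x * ?p x) +
        ennreal (1 / \<tau>) * (moment_stat n r (?m r) (- a) x * ?p x))"
        using r(1) by (intro member_le_sum) auto
      finally show ?thesis using True by simp
    qed simp
  qed
  also have "\<dots> = (\<Sum>r\<in>{1..R}. \<integral>\<^sup>+ x. ennreal (1 / \<tau>) * (moment_stat n r (?m r) a x * ?p x) +
        ennreal (1 / \<tau>) * (moment_stat n r (?m r) (- a) x * ?p x) \<partial>lebesgue_pow n)"
    by (rule nn_integral_sum) measurable
  also have "\<dots> = (\<Sum>r\<in>{1..R}. ennreal (1 / \<tau>) * (\<integral>\<^sup>+ x. moment_stat n r (?m r) a x * ?p x \<partial>lebesgue_pow n) +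
        ennreal (1 / \<tau>) * (\<integral>\<^sup>+ x. moment_stat n r (?m r) (- a) x * ?p x \<partial>lebesgue_pow n))"
  proof (rule sum.cong[OF refl])
    fix r
    show "(\<integral>\<^sup>+ x. ennreal (1 / \<tau>) * (moment_stat n r (?m r) a x * ?p x) +
        ennreal (1 / \<tau>) * (moment_stat n r (?m r) (- a) x * ?p x) \<partial>lebesgue_pow n)
      = ennreal (1 / \<tau>) * (\<integral>\<^sup>+ x. moment_stat n r (?m r) a x * ?p x \<partial>lebesgue_pow n) +
        ennreal (1 / \<tau>) * (\<integral>\<^sup>+ x. moment_stat n r (?m r) (- a) x * ?p x \<partial>lebesgue_pow n)"
      by (rule nn_integral_linear_combination) measurable
  qed
  also have "\<dots> \<le> (\<Sum>r\<in>{1..R}. ennreal (1 / \<tau>) * ennreal (exp (real n * (a\<^sup>2 * V / 2))) +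
        ennreal (1 / \<tau>) * ennreal (exp (real n * (a\<^sup>2 * V / 2))))"
  proof (intro sum_mono add_mono mult_left_mono)
    fix r assume r: "r \<in> {1..R}"
    show "(\<integral>\<^sup>+ x. moment_stat n r (?m r) a x * ?p x \<partial>lebesgue_pow n) \<le> ennreal (exp (real n * (a\<^sup>2 * V / 2)))"
      using nn_integral_moment_stat[OF w \<theta> V[OF r], of n a] by simp
    show "(\<integral>\<^sup>+ x. moment_stat n r (?m r) (- a) x * ?p x \<partial>lebesgue_pow n) \<le> ennreal (exp (real n * (a\<^sup>2 * V / 2)))"
      using nn_integral_moment_stat[OF w \<theta> V[OF r], of n "- a"] by simp
  qed auto
  also have "\<dots> = (\<Sum>r\<in>{1..R}. ennreal (2 * exp (real n * (a\<^sup>2 * V / 2)) / \<tau>))"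
    using \<tau> by (intro sum.cong refl) (simp add: ennreal_mult[symmetric] ennreal_plus[symmetric] del: ennreal_plus)
  also have "\<dots> = ennreal (2 * real R * exp (real n * (a\<^sup>2 * V / 2)) / \<tau>)"
    using \<tau> by (subst sum_ennreal) (auto simp: field_simps)
  finally show ?thesis .
qed

text \<open>One sign \<open>b\<close> makes the linear term at most \<open>- (a * \<delta>)\<close>.
  Acceptance bounds the statistic at \<open>- b\<close> by \<open>\<tau>\<close>, so by reciprocity
  \<open>\<tau>\<close> times the statistic at \<open>b\<close> is at least 1, and its expectation
  is small.\<close>

lemma reject_type2:
  assumes w: "w \<in> weight_simplex k" and \<theta>: "\<theta> \<in> atom_cube L k"
    and r: "r \<in> {1..R}" and V: "2 * (fact r * (1 + L) ^ (2 * r)) + 2 * (m r)\<^sup>2 \<le> V"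
    and \<tau>: "0 \<le> \<tau>" and a: "0 \<le> a" and far: "\<delta> \<le> \<bar>mixing_moment k w \<theta> r - m r\<bar>"
  shows "(\<integral>\<^sup>+ x. indicator (space (lebesgue_pow n) - reject n R m a \<tau>) x * joint_density n (mixing k w \<theta>) x \<partial>lebesgue_pow n)
    \<le> ennreal (\<tau> * exp (real n * (a\<^sup>2 * V / 2 - a * \<delta>)))"
proof -
  let ?p = "joint_density n (mixing k w \<theta>)"
  obtain b where b: "b = a \<or> b = - a" "b * (mixing_moment k w \<theta> r - m r) \<le> - (a * \<delta>)"
  proof (cases "mixing_moment k w \<theta> r - m r \<ge> 0")
    case True
    then have "a * \<delta> \<le> a * (mixing_moment k w \<theta> r - m r)" using far a by (intro mult_left_mono) auto
    then show ?thesis using that[of "- a"] by (simp add: algebra_simps)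
  next
    case False
    then have "a * \<delta> \<le> a * (m r - mixing_moment k w \<theta> r)" using far a by (intro mult_left_mono) auto
    then show ?thesis using that[of a] by (simp add: algebra_simps)
  qed
  have "(\<integral>\<^sup>+ x. indicator (space (lebesgue_pow n) - reject n R m a \<tau>) x * ?p x \<partial>lebesgue_pow n)
    \<le> (\<integral>\<^sup>+ x. ennreal \<tau> * (moment_stat n r (m r) b x * ?p x) \<partial>lebesgue_pow n)"
  proof (rule nn_integral_mono)
    fix x assume x: "x \<in> space (lebesgue_pow n)"
    show "indicator (space (lebesgue_pow n) - reject n R m a \<tau>) x * ?p x \<le> ennreal \<tau> * (moment_stat n r (m r) b x * ?p x)"
    proof (cases "x \<in> reject n R m a \<tau>")
      case False
      then have "moment_stat n r (m r) (- b) x \<le> ennreal \<tau>"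
        using x r b(1) by (auto simp: reject_def not_le less_imp_le)
      then have "moment_stat n r (m r) (- b) x * (moment_stat n r (m r) b x * ?p x) \<le> ennreal \<tau> * (moment_stat n r (m r) b x * ?p x)"
        by (intro mult_right_mono) auto
      moreover have "moment_stat n r (m r) (- b) x * (moment_stat n r (m r) b x * ?p x) = ?p x"
        using moment_stat_mult_uminus[of n r "m r" b x] by (simp add: mult.assoc[symmetric] mult.commute[of "moment_stat n r (m r) (- b) x"])
      ultimately show ?thesis using x False by simp
    qed simp
  qed
  also have "\<dots> = ennreal \<tau> * (\<integral>\<^sup>+ x. moment_stat n r (m r) b x * ?p x \<partial>lebesgue_pow n)"
    by (rule nn_integral_cmult) measurable
  also have "\<dots> \<le> ennreal \<tau> * ennreal (exp (real n * (b * (mixing_moment k w \<theta> r - m r) + b\<^sup>2 * V / 2)))"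
    by (intro mult_left_mono nn_integral_moment_stat[OF w \<theta> V]) auto
  also have "\<dots> \<le> ennreal \<tau> * ennreal (exp (real n * (a\<^sup>2 * V / 2 - a * \<delta>)))"
    using b by (intro mult_left_mono ennreal_leI) (auto intro!: mult_left_mono)
  also have "\<dots> = ennreal (\<tau> * exp (real n * (a\<^sup>2 * V / 2 - a * \<delta>)))" using \<tau> by (simp add: ennreal_mult)
  finally show ?thesis .
qed

section \<open>Likelihood perturbation\<close>

text \<open>The density ratio is \<open>exp (e * (x - a) - e\<^sup>2 / 2)\<close> with
  \<open>e = b - a\<close>, bounded below by its tangent. Replacing \<open>\<bar>x - a\<bar>\<close>
  by \<open>(1 + (x - a)\<^sup>2) / 2\<close> leaves only a second moment. The bound is one-sided
  because only the positive part of the likelihood difference matters.\<close>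

lemma normal_density_le_shift:
  assumes d: "\<bar>a - b\<bar> \<le> d"
  shows "normal_density a 1 x \<le> normal_density b 1 x + normal_density a 1 x * ((d + d\<^sup>2) / 2 + d / 2 * (x - a)\<^sup>2)"
proof -
  define e where "e = b - a"
  have e: "\<bar>e\<bar> \<le> d" "e\<^sup>2 \<le> d\<^sup>2" using d by (auto simp: e_def abs_le_square_iff[symmetric])
  have "- (x - b)\<^sup>2 / 2 = - (x - a)\<^sup>2 / 2 + (e * (x - a) - e\<^sup>2 / 2)"
    by (simp add: e_def power2_eq_square field_simps)
  then have eq: "normal_density b 1 x = normal_density a 1 x * exp (e * (x - a) - e\<^sup>2 / 2)"
    by (simp add: normal_density_def exp_add[symmetric])
  have "\<bar>x - a\<bar> \<le> (1 + (x - a)\<^sup>2) / 2"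
    using zero_le_power2[of "\<bar>x - a\<bar> - 1"] by (simp add: power2_eq_square algebra_simps)
  then have "\<bar>e * (x - a)\<bar> \<le> d * ((1 + (x - a)\<^sup>2) / 2)"
    unfolding abs_mult using e by (intro mult_mono) auto
  then have "1 - ((d + d\<^sup>2) / 2 + d / 2 * (x - a)\<^sup>2) \<le> 1 + (e * (x - a) - e\<^sup>2 / 2)"
  proof -
    define z q where "z = e * (x - a)" and "q = d / 2 * (x - a)\<^sup>2"
    have "d * ((1 + (x - a)\<^sup>2) / 2) = d / 2 + q" by (simp add: q_def field_simps)
    then have "\<bar>z\<bar> \<le> d / 2 + q" using \<open>\<bar>e * (x - a)\<bar> \<le> _\<close> by (simp only: z_def)
    moreover have "e\<^sup>2 / 2 \<le> d\<^sup>2 / 2" using e(2) by simp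
    ultimately show ?thesis unfolding z_def[symmetric] q_def[symmetric] by (simp add: add_divide_distrib)
  qed
  also have "\<dots> \<le> exp (e * (x - a) - e\<^sup>2 / 2)" by (rule exp_ge_add_one_self)
  finally have "normal_density a 1 x * (1 - ((d + d\<^sup>2) / 2 + d / 2 * (x - a)\<^sup>2)) \<le> normal_density b 1 x"
    unfolding eq by (intro mult_left_mono) auto
  then show ?thesis by (simp add: algebra_simps)
qed

lemma nn_integral_normal_shift_error:
  assumes d: "0 \<le> d"
  shows "(\<integral>\<^sup>+ x. ennreal (normal_density a 1 x * ((d + d\<^sup>2) / 2 + d / 2 * (x - a)\<^sup>2)) \<partial>lborel) = ennreal (d + d\<^sup>2 / 2)"
proof -
  have 1: "has_bochner_integral lborel (\<lambda>x. normal_density a 1 x * (x - a)\<^sup>2) 1"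
    using normal_moment_even[of 1 a 1] by (simp add: fact_numeral)
  have 0: "has_bochner_integral lborel (\<lambda>x. normal_density a 1 x) 1"
    using normal_moment_even[of 1 a 0] by simp
  have "has_bochner_integral lborel (\<lambda>x. normal_density a 1 x * ((d + d\<^sup>2) / 2) + (normal_density a 1 x * (x - a)\<^sup>2) * (d / 2))
      (1 * ((d + d\<^sup>2) / 2) + 1 * (d / 2))"
    by (intro has_bochner_integral_add has_bochner_integral_mult_left 0 1)
  also have "1 * ((d + d\<^sup>2) / 2) + 1 * (d / 2) = d + d\<^sup>2 / 2" by (simp add: field_simps)
  finally have "has_bochner_integral lborel (\<lambda>x. normal_density a 1 x * ((d + d\<^sup>2) / 2 + d / 2 * (x - a)\<^sup>2)) (d + d\<^sup>2 / 2)"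
    by (simp add: algebra_simps)
  then show ?thesis
    using d by (subst nn_integral_eq_integral) (auto simp: has_bochner_integral_iff)
qed

text \<open>The error \<open>e\<close> combines the change of weights at fixed atoms, of mass at
  most \<open>\<eta>\<close>, with the shift of the atoms, of mass
  \<open>\<eta> + \<eta>\<^sup>2 / 2\<close>. An additive majorant is the form that the product
  inequality below can use.\<close>

lemma nn_integral_mixture_density_diff:
  assumes w: "w \<in> weight_simplex k" and v: "v \<in> weight_simplex k"
    and dw: "(\<Sum>j\<in>{1..k}. \<bar>w j - v j\<bar>) \<le> \<eta>" and dt: "\<And>j. j \<in> {1..k} \<Longrightarrow> \<bar>\<phi> j - \<theta> j\<bar> \<le> \<eta>"
    and \<eta>: "0 \<le> \<eta>" "\<eta> \<le> 1"
  obtains e :: "real \<Rightarrow> ennreal" where "e \<in> borel_measurable borel"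
    "\<And>y. mixture_density (mixing k v \<phi>) y \<le> mixture_density (mixing k w \<theta>) y + e y"
    "(\<integral>\<^sup>+ y. e y \<partial>lborel) \<le> ennreal (3 * \<eta>)"
proof
  let ?u = "\<lambda>a y. normal_density a 1 y * ((\<eta> + \<eta>\<^sup>2) / 2 + \<eta> / 2 * (y - a)\<^sup>2)"
  define e where "e y = (\<Sum>j\<in>{1..k}. ennreal \<bar>w j - v j\<bar> * ennreal (normal_density (\<theta> j) 1 y) +
      ennreal (v j) * ennreal (?u (\<phi> j) y))" for y
  show [measurable]: "e \<in> borel_measurable borel" unfolding e_def[abs_def] by measurable
  have u0: "0 \<le> ?u a y" for a y using \<eta> by simp
  show "mixture_density (mixing k v \<phi>) y \<le> mixture_density (mixing k w \<theta>) y + e y" for y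
    unfolding mixture_density_mixing e_def sum.distrib[symmetric]
  proof (rule sum_mono)
    fix j assume j: "j \<in> {1..k}"
    have nn: "0 \<le> w j" "0 \<le> v j" using simplex_nonneg w v j by auto
    have "v j * normal_density (\<phi> j) 1 y \<le> v j * (normal_density (\<theta> j) 1 y + ?u (\<phi> j) y)"
      by (intro mult_left_mono normal_density_le_shift dt j nn)
    also have "\<dots> \<le> (w j + \<bar>w j - v j\<bar>) * normal_density (\<theta> j) 1 y + v j * ?u (\<phi> j) y"
      unfolding distrib_left by (intro add_right_mono mult_right_mono) auto
    also have "\<dots> = w j * normal_density (\<theta> j) 1 y + (\<bar>w j - v j\<bar> * normal_density (\<theta> j) 1 y + v j * ?u (\<phi> j) y)"
      by (simp add: algebra_simps)
    finally show "ennreal (v j) * ennreal (normal_density (\<phi> j) 1 y) \<le>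
      ennreal (w j) * ennreal (normal_density (\<theta> j) 1 y) +
      (ennreal \<bar>w j - v j\<bar> * ennreal (normal_density (\<theta> j) 1 y) + ennreal (v j) * ennreal (?u (\<phi> j) y))"
      using nn u0[of "\<phi> j" y] by (simp add: ennreal_mult[symmetric] ennreal_plus[symmetric] ennreal_leI del: ennreal_plus)
  qed
  have "(\<integral>\<^sup>+ y. e y \<partial>lborel) = (\<Sum>j\<in>{1..k}. \<integral>\<^sup>+ y. ennreal \<bar>w j - v j\<bar> * ennreal (normal_density (\<theta> j) 1 y) +
      ennreal (v j) * ennreal (?u (\<phi> j) y) \<partial>lborel)"
    unfolding e_def by (rule nn_integral_sum) measurable
  also have "\<dots> = (\<Sum>j\<in>{1..k}. ennreal \<bar>w j - v j\<bar> * 1 + ennreal (v j) * ennreal (\<eta> + \<eta>\<^sup>2 / 2))"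
  proof (rule sum.cong[OF refl])
    fix j
    have "(\<integral>\<^sup>+ y. ennreal \<bar>w j - v j\<bar> * ennreal (normal_density (\<theta> j) 1 y) +
        ennreal (v j) * ennreal (?u (\<phi> j) y) \<partial>lborel)
      = ennreal \<bar>w j - v j\<bar> * (\<integral>\<^sup>+ y. ennreal (normal_density (\<theta> j) 1 y) \<partial>lborel) +
        ennreal (v j) * (\<integral>\<^sup>+ y. ennreal (?u (\<phi> j) y) \<partial>lborel)"
      by (rule nn_integral_linear_combination) measurable
    then show "(\<integral>\<^sup>+ y. ennreal \<bar>w j - v j\<bar> * ennreal (normal_density (\<theta> j) 1 y) +
        ennreal (v j) * ennreal (?u (\<phi> j) y) \<partial>lborel)
      = ennreal \<bar>w j - v j\<bar> * 1 + ennreal (v j) * ennreal (\<eta> + \<eta>\<^sup>2 / 2)"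
      by (simp only: nn_integral_normal_density nn_integral_normal_shift_error[OF \<eta>(1)])
  qed
  also have "\<dots> = (\<Sum>j\<in>{1..k}. ennreal (\<bar>w j - v j\<bar> + v j * (\<eta> + \<eta>\<^sup>2 / 2)))"
    using simplex_nonneg[OF v] \<eta>
    by (intro sum.cong refl) (simp add: ennreal_mult[symmetric] ennreal_plus[symmetric] del: ennreal_plus)
  also have "\<dots> = ennreal (\<Sum>j\<in>{1..k}. \<bar>w j - v j\<bar> + v j * (\<eta> + \<eta>\<^sup>2 / 2))"
    using simplex_nonneg[OF v] \<eta> by (intro sum_ennreal) auto
  also have "(\<Sum>j\<in>{1..k}. \<bar>w j - v j\<bar> + v j * (\<eta> + \<eta>\<^sup>2 / 2))
      = (\<Sum>j\<in>{1..k}. \<bar>w j - v j\<bar>) + (\<Sum>j\<in>{1..k}. v j) * (\<eta> + \<eta>\<^sup>2 / 2)"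
    by (simp only: sum.distrib sum_distrib_right)
  also have "ennreal \<dots> \<le> ennreal (3 * \<eta>)"
  proof (rule ennreal_leI)
    have "\<eta>\<^sup>2 \<le> \<eta>" using mult_left_mono[OF \<eta>(2,1)] by (simp add: power2_eq_square)
    then show "(\<Sum>j\<in>{1..k}. \<bar>w j - v j\<bar>) + (\<Sum>j\<in>{1..k}. v j) * (\<eta> + \<eta>\<^sup>2 / 2) \<le> 3 * \<eta>"
      using dw v \<eta> by (simp add: weight_simplex_def)
  qed
  finally show "(\<integral>\<^sup>+ y. e y \<partial>lborel) \<le> ennreal (3 * \<eta>)" .
qed

text \<open>Coordinates are exchanged one at a time: in the term \<open>j\<close> the factors before
  \<open>j\<close> are already \<open>b\<close>, those after \<open>j\<close> are still
  \<open>a\<close>, and factor \<open>j\<close> is the error.\<close>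

lemma prod_le_prod_add_telescope:
  fixes a b e :: "nat \<Rightarrow> ennreal"
  assumes "\<And>i. a i \<le> b i + e i"
  shows "(\<Prod>i\<in>{1..n}. a i) \<le> (\<Prod>i\<in>{1..n}. b i) +
    (\<Sum>j\<in>{1..n}. \<Prod>i\<in>{1..n}. if i < j then b i else if i = j then e i else a i)"
proof (induction n)
  case (Suc n)
  let ?f = "\<lambda>j i. if i < j then b i else if i = j then e i else a i"
  let ?S = "\<Sum>j\<in>{1..n}. \<Prod>i\<in>{1..n}. ?f j i"
  have "(\<Prod>i\<in>{1..Suc n}. a i) \<le> ((\<Prod>i\<in>{1..n}. b i) + ?S) * a (Suc n)"
    using Suc by (simp add: mult_right_mono)
  also have "\<dots> \<le> (\<Prod>i\<in>{1..n}. b i) * (b (Suc n) + e (Suc n)) + ?S * a (Suc n)"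
    unfolding distrib_right by (intro add_mono mult_left_mono assms) auto
  also have "\<dots> = (\<Prod>i\<in>{1..n}. b i) * b (Suc n) + (?S * a (Suc n) + (\<Prod>i\<in>{1..n}. b i) * e (Suc n))"
    by (simp add: distrib_left add_ac)
  also have "?S * a (Suc n) = (\<Sum>j\<in>{1..n}. \<Prod>i\<in>{1..Suc n}. ?f j i)"
    by (simp add: sum_distrib_right)
  also have "(\<Prod>i\<in>{1..n}. b i) * e (Suc n) = (\<Prod>i\<in>{1..Suc n}. ?f (Suc n) i)"
    by (auto intro!: arg_cong2[where f = "(*)"] prod.cong)
  finally show ?case by simp
qed simp

lemma joint_density_less_top: "joint_density n (mixing k w \<theta>) x < \<top>"
proof -
  have "mixture_density (mixing k w \<theta>) y \<noteq> \<top>" for y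
    by (simp add: mixture_density_mixing ennreal_mult_eq_top_iff)
  then show ?thesis
    unfolding joint_density_def less_top[symmetric] ennreal_prod_eq_top by blast
qed

text \<open>In each telescoping term all factors but one have integral 1, so the errors of the
  coordinates add up. The truncated subtraction of \<open>ennreal\<close> is the positive
  part.\<close>

lemma nn_integral_joint_density_diff:
  assumes w: "w \<in> weight_simplex k" and v: "v \<in> weight_simplex k"
    and dw: "(\<Sum>j\<in>{1..k}. \<bar>w j - v j\<bar>) \<le> \<eta>" and dt: "\<And>j. j \<in> {1..k} \<Longrightarrow> \<bar>\<phi> j - \<theta> j\<bar> \<le> \<eta>"
    and \<eta>: "0 \<le> \<eta>" "\<eta> \<le> 1"
  shows "(\<integral>\<^sup>+ x. joint_density n (mixing k v \<phi>) x - joint_density n (mixing k w \<theta>) x \<partial>lebesgue_pow n)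
    \<le> ennreal (3 * real n * \<eta>)"
proof -
  obtain e :: "real \<Rightarrow> ennreal" where e [measurable]: "e \<in> borel_measurable borel"
    and le: "\<And>y. mixture_density (mixing k v \<phi>) y \<le> mixture_density (mixing k w \<theta>) y + e y"
    and ie: "(\<integral>\<^sup>+ y. e y \<partial>lborel) \<le> ennreal (3 * \<eta>)"
    using nn_integral_mixture_density_diff[where \<phi> = \<phi> and \<theta> = \<theta>, OF w v dw dt \<eta>] by blast
  let ?a = "mixture_density (mixing k v \<phi>)"
  let ?b = "mixture_density (mixing k w \<theta>)"
  let ?f = "\<lambda>j i. if i < j then ?b else if i = j then e else ?a"
  have [measurable]: "?f j i \<in> borel_measurable borel" for i j :: nat by simp
  have "(\<integral>\<^sup>+ x. joint_density n (mixing k v \<phi>) x - joint_density n (mixing k w \<theta>) x \<partial>lebesgue_pow n)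
    \<le> (\<integral>\<^sup>+ x. (\<Sum>j\<in>{1..n}. \<Prod>i\<in>{1..n}. ?f j i (x i)) \<partial>lebesgue_pow n)"
  proof (rule nn_integral_mono)
    fix x
    have "joint_density n (mixing k v \<phi>) x \<le> joint_density n (mixing k w \<theta>) x +
        (\<Sum>j\<in>{1..n}. \<Prod>i\<in>{1..n}. if i < j then ?b (x i) else if i = j then e (x i) else ?a (x i))"
      unfolding joint_density_def by (rule prod_le_prod_add_telescope) (rule le)
    also have "(\<Sum>j\<in>{1..n}. \<Prod>i\<in>{1..n}. if i < j then ?b (x i) else if i = j then e (x i) else ?a (x i))
        = (\<Sum>j\<in>{1..n}. \<Prod>i\<in>{1..n}. ?f j i (x i))"
      by (intro sum.cong prod.cong refl) auto
    finally show "joint_density n (mixing k v \<phi>) x - joint_density n (mixing k w \<theta>) x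
      \<le> (\<Sum>j\<in>{1..n}. \<Prod>i\<in>{1..n}. ?f j i (x i))"
      using joint_density_less_top[of n k w \<theta> x] unfolding ennreal_minus_le_iff by auto
  qed
  also have "\<dots> = (\<Sum>j\<in>{1..n}. \<integral>\<^sup>+ x. (\<Prod>i\<in>{1..n}. ?f j i (x i)) \<partial>lebesgue_pow n)"
    by (intro nn_integral_sum borel_measurable_prod_ennreal measurable_compose[OF measurable_component_singleton]) auto
  also have "\<dots> = (\<Sum>j\<in>{1..n}. \<Prod>i\<in>{1..n}. \<integral>\<^sup>+ y. ?f j i y \<partial>lborel)"
    by (intro sum.cong refl lborel_product.product_nn_integral_prod) auto
  also have "\<dots> \<le> (\<Sum>j\<in>{1..n}. ennreal (3 * \<eta>))"
  proof (rule sum_mono)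
    fix j assume j: "j \<in> {1..n}"
    have "(\<Prod>i\<in>{1..n}. \<integral>\<^sup>+ y. ?f j i y \<partial>lborel) = (\<Prod>i\<in>{1..n}. if j = i then \<integral>\<^sup>+ y. e y \<partial>lborel else 1)"
      by (intro prod.cong refl) (auto simp: nn_integral_mixture_density[OF w] nn_integral_mixture_density[OF v])
    also have "\<dots> = (\<integral>\<^sup>+ y. e y \<partial>lborel)" using j by (simp add: prod.delta)
    finally show "(\<Prod>i\<in>{1..n}. \<integral>\<^sup>+ y. ?f j i y \<partial>lborel) \<le> ennreal (3 * \<eta>)" using ie by simp
  qed
  also have "\<dots> = ennreal (3 * real n * \<eta>)" using \<eta> by (subst sum_ennreal) (auto simp: mult_ac)
  finally show ?thesis .
qed

section \<open>Pointwise bound of the posterior by the evidence on a ball\<close>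

lemma divide_le_one_ennreal:
  fixes N D :: ennreal
  assumes ND: "N \<le> D"
  shows "N / D \<le> 1"
proof (cases "D = 0 \<or> D = \<top>")
  case True
  then show ?thesis using ND by (auto simp: divide_ennreal_def)
next
  case False
  then have "N / D \<le> D / D" using ND by (intro divide_right_mono_ennreal)
  then show ?thesis using False by (simp add: less_top zero_less_iff_neq_zero)
qed

text \<open>Here \<open>p\<close> is the true likelihood, \<open>N / D\<close> bounds the posterior
  probability, \<open>q\<close> is the likelihood integrated over a ball of mass \<open>b\<close> in
  a model of probability \<open>c\<close>, and \<open>r\<close> is the approximation error. The
  \<open>q\<close> part cancels the evidence by \<open>c * q \<le> D\<close>; the \<open>r\<close>
  part uses \<open>N / D \<le> 1\<close>.\<close>

lemma posterior_ratio_bound: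
  fixes p N D q r b c :: ennreal
  assumes ND: "N \<le> D" and D: "c * q \<le> D" and p: "b * p \<le> q + r"
    and b: "b \<noteq> 0" "b \<noteq> \<top>" and c: "c \<noteq> 0" "c \<noteq> \<top>"
  shows "p * (N / D) \<le> r / b + N / (c * b)"
proof -
  note ND1 = divide_le_one_ennreal[OF ND]
  have cq: "c * (q * (N / D)) \<le> N"
  proof (cases "D = 0 \<or> D = \<top>")
    case True
    then show ?thesis using ND by (auto simp: divide_ennreal_def)
  next
    case False
    have "c * (q * (N / D)) = (c * q) * (N / D)" by (simp add: mult.assoc)
    also have "\<dots> \<le> D * (N / D)" by (intro mult_right_mono D) auto
    also have "\<dots> = N * (D / D)" by (simp add: divide_ennreal_def mult_ac)
    also have "\<dots> = N" using False by (simp add: less_top zero_less_iff_neq_zero)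
    finally show ?thesis .
  qed
  have inv: "z = z * (y * inverse y)" if "y \<noteq> 0" "y \<noteq> \<top>" for y z :: ennreal
    using ennreal_divide_self[of y] that by (simp add: less_top divide_ennreal_def)
  have "q * (N / D) = q * (N / D) * (c * inverse c)" by (rule inv[OF c])
  also have "\<dots> = (c * (q * (N / D))) * inverse c" by (simp only: mult_ac)
  also have "\<dots> \<le> N * inverse c" by (intro mult_right_mono cq) auto
  finally have qN: "q * (N / D) \<le> N * inverse c" .
  have "p * (N / D) = p * (N / D) * (b * inverse b)" by (rule inv[OF b])
  also have "\<dots> = (b * p) * (N / D) * inverse b" by (simp only: mult_ac)
  also have "\<dots> \<le> (q + r) * (N / D) * inverse b" by (intro mult_right_mono p) auto
  also have "\<dots> = (q * (N / D) + r * (N / D)) * inverse b" by (simp add: distrib_right)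
  also have "\<dots> \<le> (N * inverse c + r * 1) * inverse b"
    by (intro mult_right_mono add_mono qN mult_left_mono ND1) auto
  also have "\<dots> = r / b + N / (c * b)"
    using b c by (simp add: divide_ennreal_def distrib_left distrib_right ennreal_inverse_mult less_top mult_ac add_ac)
  finally show ?thesis .
qed

section \<open>Null sets and joint measurability in the parameters\<close>

lemma AE_pair_fst:
  assumes "prob_space M" "prob_space N" "AE x in M. P x"
  shows "AE z in M \<Otimes>\<^sub>M N. P (fst z)"
proof -
  interpret N: prob_space N by fact
  obtain Z where Z: "{x \<in> space M. \<not> P x} \<subseteq> Z" "Z \<in> null_sets M"
    using assms(3) by (auto simp: eventually_ae_filter)
  have "Z \<times> space N \<in> null_sets (M \<Otimes>\<^sub>M N)"
    using Z(2) by (auto simp: null_sets_def N.emeasure_pair_measure_Times)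
  then show ?thesis
    by (rule AE_I') (use Z(1) in \<open>auto simp: space_pair_measure\<close>)
qed

lemma AE_pair_snd:
  assumes "prob_space M" "prob_space N" "AE x in N. P x"
  shows "AE z in M \<Otimes>\<^sub>M N. P (snd z)"
proof -
  interpret N: prob_space N by fact
  obtain Z where Z: "{x \<in> space N. \<not> P x} \<subseteq> Z" "Z \<in> null_sets N"
    using assms(3) by (auto simp: eventually_ae_filter)
  have "space M \<times> Z \<in> null_sets (M \<Otimes>\<^sub>M N)"
    using Z(2) by (auto simp: null_sets_def N.emeasure_pair_measure_Times)
  then show ?thesis
    by (rule AE_I') (use Z(1) in \<open>auto simp: space_pair_measure\<close>)
qed

lemma measurable_joint_density_params:
  assumes [measurable_cong]: "sets A = sets (\<Pi>\<^sub>M j\<in>{1..k}. (borel :: real measure))"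
    "sets B = sets (\<Pi>\<^sub>M j\<in>{1..k}. (borel :: real measure))"
  shows "(\<lambda>(z, x). joint_density n (mixing k (fst z) (snd z)) x) \<in> borel_measurable ((A \<Otimes>\<^sub>M B) \<Otimes>\<^sub>M lebesgue_pow n)"
  unfolding joint_density_def mixture_density_mixing normal_density_def by measurable

lemma measurable_mixing_moment:
  assumes [measurable_cong]: "sets A = sets (\<Pi>\<^sub>M j\<in>{1..k}. (borel :: real measure))"
    "sets B = sets (\<Pi>\<^sub>M j\<in>{1..k}. (borel :: real measure))"
  shows "(\<lambda>z. mixing_moment k (fst z) (snd z) r) \<in> borel_measurable (A \<Otimes>\<^sub>M B)"
  unfolding mixing_moment_def by measurable

section \<open>The Bayes risk\<close>

text \<open>\<open>is_prior\<close> does not constrain \<open>W 0\<close> and \<open>T 0\<close>. As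
  \<open>k = 0\<close> has probability 0, the inner integral is set to 0 there, which makes it
  measurable in the data for every \<open>k\<close>.\<close>

lemma prior_integral_eq:
  assumes "pmf \<pi> 0 = 0"
  shows "prior_integral \<pi> W T f =
    (\<integral>\<^sup>+ k. (if k = 0 then 0 else \<integral>\<^sup>+ z. f (mixing k (fst z) (snd z)) \<partial>(W k \<Otimes>\<^sub>M T k)) \<partial>measure_pmf \<pi>)"
  unfolding prior_integral_def
proof (rule nn_integral_cong_AE)
  have "k \<noteq> 0" if "k \<in> set_pmf \<pi>" for k using that assms by (metis pmf_eq_0_set_pmf)
  then show "AE k in measure_pmf \<pi>. (\<integral>\<^sup>+ (w, \<theta>). f (mixing k w \<theta>) \<partial>(W k \<Otimes>\<^sub>M T k)) =
      (if k = 0 then 0 else \<integral>\<^sup>+ z. f (mixing k (fst z) (snd z)) \<partial>(W k \<Otimes>\<^sub>M T k))"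
    by (auto simp: AE_measure_pmf_iff case_prod_beta')
qed

lemma nn_integral_measure_pmf_ge:
  "ennreal (pmf \<pi> k) * f k \<le> (\<integral>\<^sup>+ j. f j \<partial>measure_pmf \<pi>)"
proof -
  have "ennreal (pmf \<pi> k) * f k = (\<integral>\<^sup>+ j. f k * indicator {k} j \<partial>measure_pmf \<pi>)"
    by (simp add: nn_integral_cmult_indicator emeasure_pmf_single mult.commute)
  also have "\<dots> \<le> (\<integral>\<^sup>+ j. f j \<partial>measure_pmf \<pi>)"
    by (intro nn_integral_mono) (auto split: split_indicator)
  finally show ?thesis .
qed

lemma measurable_measure_pmf_pair:
  fixes f :: "nat \<Rightarrow> 'a \<Rightarrow> ennreal"
  assumes "\<And>k. f k \<in> borel_measurable M"
  shows "(\<lambda>(k, x). f k x) \<in> borel_measurable (measure_pmf \<pi> \<Otimes>\<^sub>M M)"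
proof -
  have "(\<lambda>(k, x). f k x) \<in> borel_measurable (count_space UNIV \<Otimes>\<^sub>M M)"
    by (rule measurable_pair_measure_countable1) (use assms in auto)
  moreover have "sets (measure_pmf \<pi> \<Otimes>\<^sub>M M) = sets (count_space UNIV \<Otimes>\<^sub>M M)"
    by (rule sets_pair_measure_cong) auto
  ultimately show ?thesis by (simp cong: measurable_cong_sets)
qed

lemma ennreal_inverse_antimono:
  fixes x y :: ennreal
  assumes "y \<le> x"
  shows "inverse x \<le> inverse y"
proof (cases "y = 0 \<or> x = \<top>")
  case False
  then have "y \<noteq> \<top>" using \<open>y \<le> x\<close> by (auto simp: top_unique)
  with False obtain a b where "x = ennreal a" "y = ennreal b" "0 < b" "0 \<le> a"
    by (cases x; cases y) (auto simp: less_le)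
  then show ?thesis using \<open>y \<le> x\<close> by (auto simp: inverse_ennreal intro!: ennreal_leI)
qed auto

locale bayes_mixture =
  fixes L :: real and \<pi> :: "nat pmf" and W T :: "nat \<Rightarrow> (nat \<Rightarrow> real) measure" and n :: nat
  assumes prior: "is_prior L \<pi> W T"
begin

abbreviation param :: "nat \<Rightarrow> ((nat \<Rightarrow> real) \<times> (nat \<Rightarrow> real)) measure" where
  "param k \<equiv> W k \<Otimes>\<^sub>M T k"

abbreviation lik :: "nat \<Rightarrow> (nat \<Rightarrow> real) \<times> (nat \<Rightarrow> real) \<Rightarrow> (nat \<Rightarrow> real) \<Rightarrow> ennreal" where
  "lik k z x \<equiv> joint_density n (mixing k (fst z) (snd z)) x"

lemma prob_W: "1 \<le> k \<Longrightarrow> prob_space (W k)" and prob_T: "1 \<le> k \<Longrightarrow> prob_space (T k)"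
  and sets_W: "1 \<le> k \<Longrightarrow> sets (W k) = sets (\<Pi>\<^sub>M j\<in>{1..k}. (borel :: real measure))"
  and sets_T: "1 \<le> k \<Longrightarrow> sets (T k) = sets (\<Pi>\<^sub>M j\<in>{1..k}. (borel :: real measure))"
  and pmf_0: "pmf \<pi> 0 = 0"
  using prior by (auto simp: is_prior_def)

lemma prob_param: "1 \<le> k \<Longrightarrow> prob_space (param k)"
  using prob_W prob_T by (intro prob_space_pair)

lemma AE_param:
  assumes "1 \<le> k"
  shows "AE z in param k. fst z \<in> weight_simplex k \<and> snd z \<in> atom_cube L k"
proof -
  have "AE w in W k. w \<in> weight_simplex k" "AE \<theta> in T k. \<theta> \<in> atom_cube L k"
    using prior assms by (auto simp: is_prior_def)
  then show ?thesis
    using AE_pair_fst[OF prob_W[OF assms] prob_T[OF assms]] AE_pair_snd[OF prob_W[OF assms] prob_T[OF assms]]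
    by auto
qed

lemma measurable_lik: "1 \<le> k \<Longrightarrow> (\<lambda>(z, x). lik k z x) \<in> borel_measurable (param k \<Otimes>\<^sub>M lebesgue_pow n)"
  by (rule measurable_joint_density_params[OF sets_W sets_T])

lemma measurable_lik_param: "1 \<le> k \<Longrightarrow> x \<in> space (lebesgue_pow n) \<Longrightarrow> (\<lambda>z. lik k z x) \<in> borel_measurable (param k)"
  using measurable_compose[OF measurable_Pair2' measurable_lik, of x k] by simp

lemma sigma_finite_lebesgue_pow: "sigma_finite_measure (lebesgue_pow n)"
  by (rule lborel_product.sigma_finite) simp

lemma lik_Fubini:
  assumes k: "1 \<le> k" and [measurable]: "A \<in> sets (lebesgue_pow n)" "B \<in> sets (param k)"
  shows "(\<integral>\<^sup>+ x. indicator A x * (\<integral>\<^sup>+ z. lik k z x * indicator B z \<partial>param k) \<partial>lebesgue_pow n)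
    = (\<integral>\<^sup>+ z. indicator B z * (\<integral>\<^sup>+ x. indicator A x * lik k z x \<partial>lebesgue_pow n) \<partial>param k)"
proof -
  interpret P: prob_space "param k" by (rule prob_param[OF k])
  interpret Q: sigma_finite_measure "lebesgue_pow n" by (rule sigma_finite_lebesgue_pow)
  interpret pair_sigma_finite "param k" "lebesgue_pow n" ..
  note [measurable] = measurable_lik[OF k]
  have "(\<integral>\<^sup>+ x. indicator A x * (\<integral>\<^sup>+ z. lik k z x * indicator B z \<partial>param k) \<partial>lebesgue_pow n)
      = (\<integral>\<^sup>+ x. \<integral>\<^sup>+ z. indicator B z * (indicator A x * lik k z x) \<partial>param k \<partial>lebesgue_pow n)"
  proof (rule nn_integral_cong)
    fix x assume x: "x \<in> space (lebesgue_pow n)"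
    note [measurable] = measurable_lik_param[OF k x]
    show "indicator A x * (\<integral>\<^sup>+ z. lik k z x * indicator B z \<partial>param k)
        = (\<integral>\<^sup>+ z. indicator B z * (indicator A x * lik k z x) \<partial>param k)"
      by (subst nn_integral_cmult[symmetric]) (auto simp: mult_ac)
  qed
  also have "\<dots> = (\<integral>\<^sup>+ z. \<integral>\<^sup>+ x. indicator B z * (indicator A x * lik k z x) \<partial>lebesgue_pow n \<partial>param k)"
    by (rule Fubini') measurable
  also have "\<dots> = (\<integral>\<^sup>+ z. indicator B z * (\<integral>\<^sup>+ x. indicator A x * lik k z x \<partial>lebesgue_pow n) \<partial>param k)"
    by (intro nn_integral_cong nn_integral_cmult) measurable
  finally show ?thesis .
qed

lemma measurable_marginal:
  assumes k: "1 \<le> k" and [measurable]: "B \<in> sets (param k)"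
  shows "(\<lambda>x. \<integral>\<^sup>+ z. lik k z x * indicator B z \<partial>param k) \<in> borel_measurable (lebesgue_pow n)"
proof -
  interpret P: prob_space "param k" by (rule prob_param[OF k])
  note [measurable] = measurable_lik[OF k]
  show ?thesis by (rule P.borel_measurable_nn_integral) measurable
qed

text \<open>
  On the ball \<open>B\<close> of mass \<open>b\<close> the likelihood is close in \<open>L\<^sup>1\<close> to the true one, and this bounds the
  evidence from below without any event of high probability.
\<close>

lemma evidence_lower_bound:
  assumes k: "1 \<le> k" and v: "v \<in> weight_simplex k" and \<eta>: "0 \<le> \<eta>" "\<eta> \<le> 1"
    and B[measurable]: "B \<in> sets (param k)"
    and near: "\<And>z. z \<in> B \<Longrightarrow> (\<Sum>j\<in>{1..k}. \<bar>fst z j - v j\<bar>) \<le> \<eta> \<and> (\<forall>j\<in>{1..k}. \<bar>snd z j - \<phi> j\<bar> \<le> \<eta>)"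
  obtains r where "r \<in> borel_measurable (lebesgue_pow n)"
    "\<And>x. x \<in> space (lebesgue_pow n) \<Longrightarrow> emeasure (param k) B * joint_density n (mixing k v \<phi>) x
      \<le> (\<integral>\<^sup>+ z. lik k z x * indicator B z \<partial>param k) + r x"
    "(\<integral>\<^sup>+ x. r x \<partial>lebesgue_pow n) \<le> emeasure (param k) B * ennreal (3 * real n * \<eta>)"
proof
  interpret P: prob_space "param k" by (rule prob_param[OF k])
  interpret Q: sigma_finite_measure "lebesgue_pow n" by (rule sigma_finite_lebesgue_pow)
  interpret pair_sigma_finite "param k" "lebesgue_pow n" ..
  note [measurable] = measurable_lik[OF k]
  let ?p = "joint_density n (mixing k v \<phi>)"
  \<comment> \<open>The positive part of the loss of likelihood, averaged over the ball; Fubini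
    reduces its integral to the bound for a single parameter.\<close>
  define r where "r x = (\<integral>\<^sup>+ z. indicator B z * (?p x - lik k z x) \<partial>param k)" for x
  show "r \<in> borel_measurable (lebesgue_pow n)"
    unfolding r_def[abs_def] by measurable
  show "emeasure (param k) B * ?p x \<le> (\<integral>\<^sup>+ z. lik k z x * indicator B z \<partial>param k) + r x"
    if x: "x \<in> space (lebesgue_pow n)" for x
  proof -
    note [measurable] = measurable_lik_param[OF k x]
    have "emeasure (param k) B * ?p x = (\<integral>\<^sup>+ z. ?p x * indicator B z \<partial>param k)"
      unfolding nn_integral_cmult_indicator[OF B] by (rule mult.commute)
    also have "\<dots> \<le> (\<integral>\<^sup>+ z. lik k z x * indicator B z + indicator B z * (?p x - lik k z x) \<partial>param k)"
    proof (rule nn_integral_mono)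
      fix z
      have "?p x \<le> lik k z x + (?p x - lik k z x)"
        using ennreal_minus_le_iff[of "?p x" "lik k z x" "?p x - lik k z x"] by blast
      then show "?p x * indicator B z \<le> lik k z x * indicator B z + indicator B z * (?p x - lik k z x)"
        by (auto split: split_indicator)
    qed
    also have "\<dots> = (\<integral>\<^sup>+ z. lik k z x * indicator B z \<partial>param k) + r x"
      unfolding r_def by (rule nn_integral_add) measurable
    finally show ?thesis .
  qed
  have "(\<integral>\<^sup>+ x. r x \<partial>lebesgue_pow n)
      = (\<integral>\<^sup>+ z. \<integral>\<^sup>+ x. indicator B z * (?p x - lik k z x) \<partial>lebesgue_pow n \<partial>param k)"
    unfolding r_def by (rule Fubini') measurable
  also have "\<dots> = (\<integral>\<^sup>+ z. indicator B z * (\<integral>\<^sup>+ x. ?p x - lik k z x \<partial>lebesgue_pow n) \<partial>param k)"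
    by (intro nn_integral_cong nn_integral_cmult) measurable
  also have "\<dots> \<le> (\<integral>\<^sup>+ z. ennreal (3 * real n * \<eta>) * indicator B z \<partial>param k)"
  proof (rule nn_integral_mono_AE)
    show "AE z in param k. indicator B z * (\<integral>\<^sup>+ x. ?p x - lik k z x \<partial>lebesgue_pow n) \<le> ennreal (3 * real n * \<eta>) * indicator B z"
      using AE_param[OF k]
    proof eventually_elim
      fix z assume z: "fst z \<in> weight_simplex k \<and> snd z \<in> atom_cube L k"
      show "indicator B z * (\<integral>\<^sup>+ x. ?p x - lik k z x \<partial>lebesgue_pow n) \<le> ennreal (3 * real n * \<eta>) * indicator B z"
      proof (cases "z \<in> B")
        case True
        have "(\<integral>\<^sup>+ x. ?p x - lik k z x \<partial>lebesgue_pow n) \<le> ennreal (3 * real n * \<eta>)"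
          by (rule nn_integral_joint_density_diff)
            (use z v near[OF True] \<eta> in \<open>auto simp: abs_minus_commute\<close>)
        then show ?thesis using True by simp
      qed simp
    qed
  qed
  also have "\<dots> = emeasure (param k) B * ennreal (3 * real n * \<eta>)"
    unfolding nn_integral_cmult_indicator[OF B] by (rule mult.commute)
  finally show "(\<integral>\<^sup>+ x. r x \<partial>lebesgue_pow n) \<le> emeasure (param k) B * ennreal (3 * real n * \<eta>)" .
qed

lemma emeasure_ball:
  fixes v \<phi> :: "nat \<Rightarrow> real" and \<eta> :: real
  assumes k: "1 \<le> k"
  defines "B \<equiv> {w \<in> space (W k). (\<Sum>j\<in>{1..k}. \<bar>w j - v j\<bar>) \<le> \<eta>} \<times> {\<theta> \<in> space (T k). (MAX j\<in>{1..k}. \<bar>\<theta> j - \<phi> j\<bar>) \<le> \<eta>}"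
  shows "B \<in> sets (param k)"
    and "emeasure (param k) B = ennreal (measure (W k) {w \<in> space (W k). (\<Sum>j\<in>{1..k}. \<bar>w j - v j\<bar>) \<le> \<eta>} *
      measure (T k) {\<theta> \<in> space (T k). (MAX j\<in>{1..k}. \<bar>\<theta> j - \<phi> j\<bar>) \<le> \<eta>})"
proof -
  interpret W: prob_space "W k" by (rule prob_W[OF k])
  interpret T: prob_space "T k" by (rule prob_T[OF k])
  note [measurable_cong] = sets_W[OF k] sets_T[OF k]
  have 1[measurable]: "{w \<in> space (W k). (\<Sum>j\<in>{1..k}. \<bar>w j - v j\<bar>) \<le> \<eta>} \<in> sets (W k)" by measurable
  have "((MAX j\<in>{1..k}. \<bar>\<theta> j - \<phi> j\<bar>) \<le> \<eta>) = (\<forall>j\<in>{1..k}. \<bar>\<theta> j - \<phi> j\<bar> \<le> \<eta>)" for \<theta>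
    using k by (subst Max_le_iff) auto
  then have 2[measurable]: "{\<theta> \<in> space (T k). (MAX j\<in>{1..k}. \<bar>\<theta> j - \<phi> j\<bar>) \<le> \<eta>} \<in> sets (T k)" by simp
  show "B \<in> sets (param k)" unfolding B_def by measurable
  show "emeasure (param k) B = ennreal (measure (W k) {w \<in> space (W k). (\<Sum>j\<in>{1..k}. \<bar>w j - v j\<bar>) \<le> \<eta>} *
      measure (T k) {\<theta> \<in> space (T k). (MAX j\<in>{1..k}. \<bar>\<theta> j - \<phi> j\<bar>) \<le> \<eta>})"
    unfolding B_def by (subst T.emeasure_pair_measure_Times[OF 1 2])
      (simp add: W.emeasure_eq_measure T.emeasure_eq_measure ennreal_mult)
qed

text \<open>The terms are the type I error, the approximation error of the evidence, and the type II
  error plus the prior mass of larger models, the last two divided by a lower bound for the prior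
  mass of the ball.\<close>

theorem bayes_risk_bound:
  assumes k: "1 \<le> k" and pk: "0 < pmf \<pi> k"
    and v: "v \<in> weight_simplex k" and \<phi>: "\<phi> \<in> atom_cube L k" and \<eta>: "0 \<le> \<eta>" "\<eta> \<le> 1" and \<beta>: "0 < \<beta>"
    and ball: "\<beta> \<le> measure (W k) {w \<in> space (W k). (\<Sum>j\<in>{1..k}. \<bar>w j - v j\<bar>) \<le> \<eta>} *
      measure (T k) {\<theta> \<in> space (T k). (MAX j\<in>{1..k}. \<bar>\<theta> j - \<phi> j\<bar>) \<le> \<eta>}"
    and V: "\<And>r. r \<in> {1..R} \<Longrightarrow> 2 * (fact r * (1 + L) ^ (2 * r)) + 2 * (mixing_moment k v \<phi> r)\<^sup>2 \<le> V"
    and a: "0 \<le> a" and \<tau>: "0 < \<tau>"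
    and far: "\<And>k' w \<theta>. 1 \<le> k' \<Longrightarrow> k' \<le> k \<Longrightarrow> w \<in> weight_simplex k' \<Longrightarrow> \<theta> \<in> atom_cube L k' \<Longrightarrow>
      mixing k' w \<theta> \<in> F \<Longrightarrow> \<exists>r\<in>{1..R}. \<delta> \<le> \<bar>mixing_moment k' w \<theta> r - mixing_moment k v \<phi> r\<bar>"
  shows "(\<integral>\<^sup>+ x. posterior n \<pi> W T x F \<partial>iid_data n (mixing k v \<phi> \<star> std_normal)) \<le>
    ennreal (2 * real R * exp (real n * (a\<^sup>2 * V / 2)) / \<tau>) + ennreal (3 * real n * \<eta>) +
    (ennreal (\<tau> * exp (real n * (a\<^sup>2 * V / 2 - a * \<delta>))) + emeasure (measure_pmf \<pi>) {k<..}) / ennreal (pmf \<pi> k * \<beta>)"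
proof -
  let ?Q = "lebesgue_pow n"
  let ?p = "joint_density n (mixing k v \<phi>)"
  let ?m = "mixing_moment k v \<phi>"
  define Rj where "Rj = reject n R ?m a \<tau>"
  define t1 where "t1 = ennreal (2 * real R * exp (real n * (a\<^sup>2 * V / 2)) / \<tau>)"
  define t2 where "t2 = ennreal (\<tau> * exp (real n * (a\<^sup>2 * V / 2 - a * \<delta>)))"
  have Rj[measurable]: "Rj \<in> sets ?Q" unfolding Rj_def by (rule sets_reject)
  \<comment> \<open>The parameters of measures in \<open>F\<close> need not form a measurable set.
    \<open>Bad\<close> is measurable and contains them up to a null set; all parameters of larger
    models belong to it and are left to the prior.\<close>
  define Bad where "Bad k' = (if k' \<le> k then {z \<in> space (param k').
    \<exists>r\<in>{1..R}. \<delta> \<le> \<bar>mixing_moment k' (fst z) (snd z) r - ?m r\<bar>} else space (param k'))" for k'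
  have Bad: "Bad k' \<in> sets (param k')" if "1 \<le> k'" for k'
  proof -
    note [measurable] = measurable_mixing_moment[OF sets_W[OF that] sets_T[OF that]]
    have "{z \<in> space (param k'). \<exists>r\<in>{1..R}. \<delta> \<le> \<bar>mixing_moment k' (fst z) (snd z) r - ?m r\<bar>} \<in> sets (param k')"
      by measurable
    then show ?thesis unfolding Bad_def by simp
  qed
  define J where "J k' x = (if k' = 0 then 0 else \<integral>\<^sup>+ z. lik k' z x * indicator (space (param k')) z \<partial>param k')" for k' x
  define JB where "JB k' x = (if k' = 0 then 0 else \<integral>\<^sup>+ z. lik k' z x * indicator (Bad k') z \<partial>param k')" for k' x
  define D where "D x = (\<integral>\<^sup>+ k'. J k' x \<partial>measure_pmf \<pi>)" for x
  define N where "N x = (\<integral>\<^sup>+ k'. JB k' x \<partial>measure_pmf \<pi>)" for x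
  have mJ: "J k' \<in> borel_measurable ?Q" for k'
    unfolding J_def[abs_def] using measurable_marginal[of k' "space (param k')"] by (cases "k' = 0") auto
  have mJB: "JB k' \<in> borel_measurable ?Q" for k'
    unfolding JB_def[abs_def] using measurable_marginal[of k' "Bad k'"] Bad[of k'] by (cases "k' = 0") auto
  interpret Q: sigma_finite_measure ?Q by (rule sigma_finite_lebesgue_pow)
  interpret pi: prob_space "measure_pmf \<pi>" by (rule prob_space_measure_pmf)
  interpret PQ: pair_sigma_finite "measure_pmf \<pi>" ?Q ..
  have [measurable]: "(\<lambda>(k, x). J k x) \<in> borel_measurable (measure_pmf \<pi> \<Otimes>\<^sub>M ?Q)"
    "(\<lambda>(k, x). JB k x) \<in> borel_measurable (measure_pmf \<pi> \<Otimes>\<^sub>M ?Q)"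
    by (rule measurable_measure_pmf_pair[OF mJ], rule measurable_measure_pmf_pair[OF mJB])
  have mD[measurable]: "D \<in> borel_measurable ?Q"
    unfolding D_def[abs_def] by measurable
  have mN[measurable]: "N \<in> borel_measurable ?Q"
    unfolding N_def[abs_def] by measurable
  have Deq: "prior_integral \<pi> W T (\<lambda>\<nu>. joint_density n \<nu> x) = D x" for x
    unfolding prior_integral_eq[OF pmf_0] D_def J_def
    by (intro nn_integral_cong if_cong refl) simp
  have Nle: "prior_integral \<pi> W T (\<lambda>\<nu>. joint_density n \<nu> x * indicator F \<nu>) \<le> N x" for x
    unfolding prior_integral_eq[OF pmf_0] N_def
  proof (rule nn_integral_mono)
    fix k'
    show "(if k' = 0 then 0 else \<integral>\<^sup>+ z. lik k' z x * indicator F (mixing k' (fst z) (snd z)) \<partial>param k') \<le> JB k' x"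
    proof (cases "k' = 0")
      case False
      then have k': "1 \<le> k'" by simp
      have "(\<integral>\<^sup>+ z. lik k' z x * indicator F (mixing k' (fst z) (snd z)) \<partial>param k') \<le>
          (\<integral>\<^sup>+ z. lik k' z x * indicator (Bad k') z \<partial>param k')"
      proof (rule nn_integral_mono_AE)
        show "AE z in param k'. lik k' z x * indicator F (mixing k' (fst z) (snd z)) \<le> lik k' z x * indicator (Bad k') z"
          using AE_param[OF k'] AE_space
        proof eventually_elim
          fix z assume z: "fst z \<in> weight_simplex k' \<and> snd z \<in> atom_cube L k'" "z \<in> space (param k')"
          have "z \<in> Bad k'" if "mixing k' (fst z) (snd z) \<in> F"
            using far[OF k'] z that by (auto simp: Bad_def)
          then show "lik k' z x * indicator F (mixing k' (fst z) (snd z)) \<le> lik k' z x * indicator (Bad k') z"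
            by (auto split: split_indicator)
        qed
      qed
      then show ?thesis using False by (simp add: JB_def)
    qed (simp add: JB_def)
  qed
  have ND: "N x \<le> D x" for x
    unfolding N_def D_def J_def JB_def
    by (intro nn_integral_mono) (auto simp: Bad_def intro!: nn_integral_mono mult_left_mono split: split_indicator)
  define B where "B = {w \<in> space (W k). (\<Sum>j\<in>{1..k}. \<bar>w j - v j\<bar>) \<le> \<eta>} \<times> {\<theta> \<in> space (T k). (MAX j\<in>{1..k}. \<bar>\<theta> j - \<phi> j\<bar>) \<le> \<eta>}"
  define b where "b = emeasure (param k) B"
  define c where "c = ennreal (pmf \<pi> k)"
  have B[measurable]: "B \<in> sets (param k)" unfolding B_def by (rule emeasure_ball(1)[OF k])
  have b\<beta>: "ennreal \<beta> \<le> b" unfolding b_def B_def emeasure_ball(2)[OF k] by (rule ennreal_leI[OF ball])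
  have b: "b \<noteq> 0" "b \<noteq> \<top>"
    using b\<beta> \<beta> prob_space.emeasure_le_1[OF prob_param[OF k], of B] by (auto simp: b_def top_unique)
  have c: "c \<noteq> 0" "c \<noteq> \<top>" using pk by (auto simp: c_def)
  have near: "(\<Sum>j\<in>{1..k}. \<bar>fst z j - v j\<bar>) \<le> \<eta> \<and> (\<forall>j\<in>{1..k}. \<bar>snd z j - \<phi> j\<bar> \<le> \<eta>)" if "z \<in> B" for z
  proof -
    have "(MAX j\<in>{1..k}. \<bar>snd z j - \<phi> j\<bar>) \<le> \<eta>" using that by (auto simp: B_def)
    then have "\<forall>j\<in>{1..k}. \<bar>snd z j - \<phi> j\<bar> \<le> \<eta>" using k by (subst (asm) Max_le_iff) auto
    then show ?thesis using that by (auto simp: B_def)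
  qed
  obtain r where r[measurable]: "r \<in> borel_measurable ?Q"
    and bp: "\<And>x. x \<in> space ?Q \<Longrightarrow> b * ?p x \<le> (\<integral>\<^sup>+ z. lik k z x * indicator B z \<partial>param k) + r x"
    and ir: "(\<integral>\<^sup>+ x. r x \<partial>?Q) \<le> b * ennreal (3 * real n * \<eta>)"
    unfolding b_def using evidence_lower_bound[OF k v \<eta> B near] by blast
  have cq: "c * (\<integral>\<^sup>+ z. lik k z x * indicator B z \<partial>param k) \<le> D x" for x
  proof -
    have "(\<integral>\<^sup>+ z. lik k z x * indicator B z \<partial>param k) \<le> J k x"
      using k by (auto simp: J_def intro!: nn_integral_mono mult_left_mono split: split_indicator)
    then have "c * (\<integral>\<^sup>+ z. lik k z x * indicator B z \<partial>param k) \<le> c * J k x" by (intro mult_left_mono) auto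
    also have "\<dots> \<le> D x" unfolding c_def D_def by (rule nn_integral_measure_pmf_ge)
    finally show ?thesis .
  qed
  \<comment> \<open>On the rejection region the posterior is bounded by 1, elsewhere by the ratio
    bound.\<close>
  have pointwise: "?p x * (N x / D x) \<le> indicator Rj x * ?p x + (r x / b + indicator (space ?Q - Rj) x * N x / (c * b))"
    if x: "x \<in> space ?Q" for x
  proof (cases "x \<in> Rj")
    case True
    have "?p x * (N x / D x) \<le> ?p x * 1" by (intro mult_left_mono divide_le_one_ennreal ND) auto
    then show ?thesis using True by (simp add: add_increasing2)
  next
    case False
    then show ?thesis using x posterior_ratio_bound[OF ND cq bp[OF x] b c] by simp
  qed
  \<comment> \<open>After Fubini the inner integral is a type II error for
    \<open>k' \<le> k\<close>. For larger \<open>k'\<close> it is at most the total mass 1 of the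
    likelihood, which leaves the prior tail.\<close>
  have mass: "(\<integral>\<^sup>+ x. indicator (space ?Q - Rj) x * N x \<partial>?Q) \<le> t2 + emeasure (measure_pmf \<pi>) {k<..}"
  proof -
    have "(\<integral>\<^sup>+ x. indicator (space ?Q - Rj) x * N x \<partial>?Q)
        = (\<integral>\<^sup>+ x. \<integral>\<^sup>+ k'. indicator (space ?Q - Rj) x * JB k' x \<partial>measure_pmf \<pi> \<partial>?Q)"
      unfolding N_def by (intro nn_integral_cong nn_integral_cmult[symmetric]) simp
    also have "\<dots> = (\<integral>\<^sup>+ k'. \<integral>\<^sup>+ x. indicator (space ?Q - Rj) x * JB k' x \<partial>?Q \<partial>measure_pmf \<pi>)"
      by (rule PQ.Fubini') measurable
    also have "\<dots> \<le> (\<integral>\<^sup>+ k'. t2 + indicator {k<..} k' \<partial>measure_pmf \<pi>)"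
    proof (rule nn_integral_mono)
      fix k'
      show "(\<integral>\<^sup>+ x. indicator (space ?Q - Rj) x * JB k' x \<partial>?Q) \<le> t2 + indicator {k<..} k'"
      proof (cases "k' = 0")
        case False
        then have k': "1 \<le> k'" by simp
        interpret Pk: prob_space "param k'" by (rule prob_param[OF k'])
        have "(\<integral>\<^sup>+ x. indicator (space ?Q - Rj) x * JB k' x \<partial>?Q)
          = (\<integral>\<^sup>+ z. indicator (Bad k') z * (\<integral>\<^sup>+ x. indicator (space ?Q - Rj) x * lik k' z x \<partial>?Q) \<partial>param k')"
          using False lik_Fubini[OF k' sets.compl_sets[OF Rj] Bad[OF k']] by (simp add: JB_def)
        also have "\<dots> \<le> (\<integral>\<^sup>+ z. t2 + indicator {k<..} k' \<partial>param k')"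
        proof (rule nn_integral_mono_AE)
          show "AE z in param k'. indicator (Bad k') z * (\<integral>\<^sup>+ x. indicator (space ?Q - Rj) x * lik k' z x \<partial>?Q)
              \<le> t2 + indicator {k<..} k'"
            using AE_param[OF k']
          proof eventually_elim
            fix z assume z: "fst z \<in> weight_simplex k' \<and> snd z \<in> atom_cube L k'"
            show "indicator (Bad k') z * (\<integral>\<^sup>+ x. indicator (space ?Q - Rj) x * lik k' z x \<partial>?Q)
              \<le> t2 + indicator {k<..} k'"
            proof (cases "k' \<le> k")
              case True
              show ?thesis
              proof (cases "z \<in> Bad k'")
                case zB: True
                then obtain s where s: "s \<in> {1..R}" "\<delta> \<le> \<bar>mixing_moment k' (fst z) (snd z) s - ?m s\<bar>"
                  using True by (auto simp: Bad_def)
                have "(\<integral>\<^sup>+ x. indicator (space ?Q - Rj) x * lik k' z x \<partial>?Q) \<le> t2"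
                  unfolding Rj_def t2_def using z \<tau>
                  by (intro reject_type2[where m = ?m, OF _ _ s(1) V[OF s(1)] _ a s(2)]) auto
                then show ?thesis using True zB by simp
              qed simp
            next
              case False
              have "indicator (Bad k') z * (\<integral>\<^sup>+ x. indicator (space ?Q - Rj) x * lik k' z x \<partial>?Q)
                  \<le> 1 * (\<integral>\<^sup>+ x. lik k' z x \<partial>?Q)"
                by (intro mult_mono nn_integral_mono) (auto split: split_indicator)
              also have "\<dots> = 1" using z nn_integral_joint_density[of "fst z" k' n "snd z"] by simp
              finally show ?thesis using False by (simp add: add_increasing)
            qed
          qed
        qed
        also have "\<dots> = t2 + indicator {k<..} k'" by (simp add: Pk.emeasure_space_1)
        finally show ?thesis .
      qed (simp add: JB_def)
    qed
    also have "\<dots> = t2 + emeasure (measure_pmf \<pi>) {k<..}" by (simp add: nn_integral_add)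
    finally show ?thesis .
  qed
  have "(\<integral>\<^sup>+ x. posterior n \<pi> W T x F \<partial>iid_data n (mixing k v \<phi> \<star> std_normal))
      \<le> (\<integral>\<^sup>+ x. N x / D x \<partial>density ?Q ?p)"
    unfolding iid_data_eq_density[OF v] posterior_def Deq
    by (intro nn_integral_mono divide_right_mono_ennreal Nle)
  also have "\<dots> = (\<integral>\<^sup>+ x. ?p x * (N x / D x) \<partial>?Q)" by (rule nn_integral_density) measurable
  also have "\<dots> \<le> (\<integral>\<^sup>+ x. indicator Rj x * ?p x + (r x / b + indicator (space ?Q - Rj) x * N x / (c * b)) \<partial>?Q)"
    by (rule nn_integral_mono) (rule pointwise)
  also have "\<dots> = (\<integral>\<^sup>+ x. indicator Rj x * ?p x \<partial>?Q) + ((\<integral>\<^sup>+ x. r x \<partial>?Q) / b +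
      (\<integral>\<^sup>+ x. indicator (space ?Q - Rj) x * N x \<partial>?Q) / (c * b))"
  proof -
    define f g where "f x = indicator Rj x * ?p x" and "g x = indicator (space ?Q - Rj) x * N x" for x
    have [measurable]: "f \<in> borel_measurable ?Q" "g \<in> borel_measurable ?Q"
      unfolding f_def[abs_def] g_def[abs_def] by measurable
    have "(\<integral>\<^sup>+ x. f x + (r x / b + g x / (c * b)) \<partial>?Q) = (\<integral>\<^sup>+ x. f x \<partial>?Q) + (\<integral>\<^sup>+ x. r x / b + g x / (c * b) \<partial>?Q)"
      by (rule nn_integral_add) measurable
    also have "(\<integral>\<^sup>+ x. r x / b + g x / (c * b) \<partial>?Q) = (\<integral>\<^sup>+ x. r x / b \<partial>?Q) + (\<integral>\<^sup>+ x. g x / (c * b) \<partial>?Q)"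
      by (rule nn_integral_add) measurable
    also have "(\<integral>\<^sup>+ x. r x / b \<partial>?Q) = (\<integral>\<^sup>+ x. r x \<partial>?Q) / b" by (rule nn_integral_divide) measurable
    also have "(\<integral>\<^sup>+ x. g x / (c * b) \<partial>?Q) = (\<integral>\<^sup>+ x. g x \<partial>?Q) / (c * b)"
      by (rule nn_integral_divide) measurable
    finally show ?thesis unfolding f_def g_def .
  qed
  also have "\<dots> \<le> t1 + (ennreal (3 * real n * \<eta>) + (t2 + emeasure (measure_pmf \<pi>) {k<..}) / ennreal (pmf \<pi> k * \<beta>))"
  proof (intro add_mono)
    show "(\<integral>\<^sup>+ x. indicator Rj x * ?p x \<partial>?Q) \<le> t1"
      unfolding Rj_def t1_def by (rule reject_type1[OF v \<phi> V \<tau>])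
    have "(\<integral>\<^sup>+ x. r x \<partial>?Q) / b \<le> b * ennreal (3 * real n * \<eta>) / b" by (intro divide_right_mono_ennreal ir)
    also have "\<dots> = ennreal (3 * real n * \<eta>)"
      using b by (simp add: mult.commute[of b] mult_divide_eq_ennreal)
    finally show "(\<integral>\<^sup>+ x. r x \<partial>?Q) / b \<le> ennreal (3 * real n * \<eta>)" .
    have "ennreal (pmf \<pi> k * \<beta>) = c * ennreal \<beta>" using \<beta> by (simp add: c_def ennreal_mult)
    also have "\<dots> \<le> c * b" by (intro mult_left_mono b\<beta>) auto
    finally have cb: "ennreal (pmf \<pi> k * \<beta>) \<le> c * b" .
    show "(\<integral>\<^sup>+ x. indicator (space ?Q - Rj) x * N x \<partial>?Q) / (c * b) \<le>
        (t2 + emeasure (measure_pmf \<pi>) {k<..}) / ennreal (pmf \<pi> k * \<beta>)"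
      unfolding divide_ennreal_def by (intro mult_mono mass ennreal_inverse_antimono cb) auto
  qed
  finally show ?thesis unfolding t1_def t2_def by (simp add: add.assoc)
qed

end

section \<open>The rates\<close>

lemma power_div_fact_le_exp:
  fixes x :: real
  assumes "0 \<le> x"
  shows "x ^ j / fact j \<le> exp x"
proof -
  have s: "(\<lambda>n. x ^ n / fact n) sums exp x"
    using exp_converges[of x] by (simp add: divide_inverse mult.commute)
  have "(\<Sum>n\<in>{j}. x ^ n / fact n) \<le> (\<Sum>n. x ^ n / fact n)"
    by (rule sum_le_suminf) (use s assms in \<open>auto simp: sums_iff\<close>)
  then show ?thesis using s by (simp add: sums_iff)
qed

text \<open>In terms of \<open>noise n\<close>, the exponents of the rates are the reciprocals of
  the odd integers \<open>2 * k - 1\<close> and \<open>2 * (k - k0) + 1\<close>.\<close>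

definition noise :: "nat \<Rightarrow> real" where
  "noise n = sqrt ((ln (real n))\<^sup>2 / real n)"

text \<open>This is \<open>2 * (exp c * c)\<close> with \<open>c = 32 * (1 + L) ^ 4\<close>: the 2
  counts the at most \<open>2 * k\<close> gaps, \<open>exp c\<close> is paid for the factorial, and
  \<open>c\<close> is the root of a power \<open>c ^ p\<close>. The 32 collects the constants in
  \<open>moment_bound_le_eps_sep\<close>.\<close>

definition rate_const :: "real \<Rightarrow> real" where
  "rate_const L = 2 * (exp (32 * (1 + L) ^ 4) * (32 * (1 + L) ^ 4))"

lemma noise_pos: "2 \<le> n \<Longrightarrow> 0 < noise n"
  by (simp add: noise_def)

lemma noise_powr: "((ln (real n))\<^sup>2 / real n) powr x = noise n powr (2 * x)"
proof -
  have "noise n powr (2 * x) = (noise n powr 2) powr x" by (simp add: powr_powr)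
  also have "noise n powr 2 = (noise n)\<^sup>2" by (simp add: noise_def)
  finally show ?thesis by (simp add: noise_def)
qed

text \<open>The form delivered by \<open>wasserstein1_le_moments\<close>. With
  \<open>p = 2 * (k - k0) + 1\<close>, the exponent of \<open>k\<close> is
  \<open>1 + (k + 1 / 2) / p\<close>.\<close>

lemma eps_sep_eq:
  assumes k: "1 \<le> k0" "k0 \<le> k" and \<gamma>: "0 < \<gamma>" and n: "2 \<le> n"
  shows "eps_sep n k k0 \<gamma> = real k *
    (real k powr (real k + 1 / 2) * (1 / \<gamma>) ^ (2 * k0 - 2) * noise n) powr (1 / real (2 * (k - k0) + 1))"
proof -
  define p where "p = real (2 * (k - k0) + 1)"
  have p: "0 < p" "4 * (real k - real k0) + 2 = 2 * p" "2 * (real k - real k0) + 1 = p"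
    using k by (auto simp: p_def of_nat_diff)
  have e1: "(6 * real k - 4 * real k0 + 3) / (2 * p) = 1 + (real k + 1 / 2) * (1 / p)"
    using p by (simp add: field_simps)
  have "(1 / \<gamma>) ^ (2 * k0 - 2) = (1 / \<gamma>) powr (real (2 * k0 - 2))" using \<gamma> by (simp add: powr_realpow)
  also have "real (2 * k0 - 2) = 2 * real k0 - 2" using k by (simp add: of_nat_diff)
  also have "(1 / \<gamma>) powr (2 * real k0 - 2) = \<gamma> powr (- (2 * real k0 - 2))"
    unfolding powr_minus_divide using \<gamma> by (simp add: powr_divide)
  finally have g: "(1 / \<gamma>) ^ (2 * k0 - 2) = \<gamma> powr (- (2 * real k0 - 2))" .
  have kp: "real k powr (1 + (real k + 1 / 2) * (1 / p)) = real k * (real k powr (real k + 1 / 2)) powr (1 / p)"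
    using k by (subst powr_add) (simp add: powr_powr)
  have "eps_sep n k k0 \<gamma> = real k * (real k powr (real k + 1 / 2)) powr (1 / p) *
      (\<gamma> powr (- (2 * real k0 - 2))) powr (1 / p) * noise n powr (1 / p)"
  proof -
    have "(\<gamma> powr (- (2 * real k0 - 2))) powr (1 / p) = \<gamma> powr (- ((2 * real k0 - 2) / p))"
      by (simp only: powr_powr mult_minus_left times_divide_eq_right mult_1_right minus_divide_left)
    moreover have "2 * (1 / (2 * p)) = 1 / p" by simp
    ultimately show ?thesis unfolding eps_sep_def noise_powr p(2,3) e1 kp by (simp only:)
  qed
  also have "\<dots> = real k * (real k powr (real k + 1 / 2) * \<gamma> powr (- (2 * real k0 - 2)) * noise n) powr (1 / p)"
    using noise_pos[OF n] by (simp add: powr_mult mult.assoc)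
  finally show ?thesis unfolding g p_def .
qed

lemma eps_sep_pos: "1 \<le> k0 \<Longrightarrow> k0 \<le> k \<Longrightarrow> 0 < \<gamma> \<Longrightarrow> 2 \<le> n \<Longrightarrow> 0 < eps_sep n k k0 \<gamma>"
  unfolding eps_sep_eq using noise_pos[of n] by simp

text \<open>For one cluster \<open>\<gamma>\<close> has exponent 0, and the rates differ by the
  factor \<open>k powr (1 / (2 * k - 1))\<close>, at most 2 because
  \<open>k \<le> 2 ^ k\<close>.\<close>

lemma eps_sep_one_le_eps_bar:
  assumes k: "1 \<le> k" and \<gamma>: "0 < \<gamma>" and n: "2 \<le> n"
  shows "eps_sep n k 1 \<gamma> \<le> 2 * eps_bar n k"
proof -
  have "4 * (real k - 1) + 2 = 4 * real k - 2" "6 * real k - 4 * real 1 + 3 = 6 * real k - 1" by simp_all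
  moreover have "(6 * real k - 1) / (4 * real k - 2) = 1 / (2 * real k - 1) + 3 / 2"
    using k by (simp add: divide_simps)
  ultimately have eq: "eps_sep n k 1 \<gamma> = real k powr (1 / (2 * real k - 1)) * eps_bar n k"
    using \<gamma> by (simp add: eps_sep_def eps_bar_def powr_add)
  have "real k \<le> 2 powr (2 * real k - 1)"
  proof -
    have "k < 2 ^ k" by (rule less_exp)
    then have "real k \<le> 2 ^ k" by (metis less_imp_le of_nat_le_iff of_nat_numeral of_nat_power)
    also have "\<dots> = 2 powr real k" by (simp add: powr_realpow)
    also have "\<dots> \<le> 2 powr (2 * real k - 1)" using k by (intro powr_mono) auto
    finally show ?thesis .
  qed
  then have "real k powr (1 / (2 * real k - 1)) \<le> (2 powr (2 * real k - 1)) powr (1 / (2 * real k - 1))"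
    using k by (intro powr_mono2) auto
  also have "\<dots> = 2" using k by (simp add: powr_powr)
  finally show ?thesis unfolding eq by (intro mult_right_mono) (auto simp: eps_bar_def)
qed

text \<open>
  The factor \<open>1 / ((k0 - 1)!)\<^sup>2\<close> absorbs the exponential constant \<open>c ^ k\<close>, which is not bounded
  after taking the root of order \<open>2 (k - k0) + 1\<close> when \<open>k0\<close> is close to \<open>k\<close>.
\<close>

lemma moment_bound_le_eps_sep:
  assumes L: "0 < L" and k: "1 \<le> k0" "k0 \<le> k" and \<gamma>: "0 < \<gamma>" and n: "2 \<le> n"
    and \<delta>: "0 \<le> \<delta>" "\<delta> \<le> (2 * (1 + L)\<^sup>2) ^ k * real k ^ k * noise n"
  shows "2 * real k * (\<delta> * ((2 * (1 + L)) ^ (2 * k - 1) * (2 / \<gamma>) ^ (2 * k0 - 2) / (fact (k0 - 1))\<^sup>2))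
      powr (1 / real (2 * (k - k0) + 1)) \<le> rate_const L * eps_sep n k k0 \<gamma>"
proof -
  define c where "c = 32 * (1 + L) ^ 4"
  define p where "p = 2 * (k - k0) + 1"
  define G where "G = (1 / \<gamma>) ^ (2 * k0 - 2)"
  define Y where "Y = real k powr (real k + 1 / 2) * G * noise n"
  define X where "X = \<delta> * ((2 * (1 + L)) ^ (2 * k - 1) * (2 / \<gamma>) ^ (2 * k0 - 2) / (fact (k0 - 1))\<^sup>2)"
  have G: "0 < G" using \<gamma> by (simp add: G_def)
  have nz: "0 < noise n" by (rule noise_pos[OF n])
  have Y: "0 < Y" using k G nz by (simp add: Y_def)
  have c1: "1 \<le> c" using one_le_power[of "1 + L" 4] L unfolding c_def by linarith
  have X0: "0 \<le> X" using \<delta> L \<gamma> by (simp add: X_def)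
  have kk: "real k ^ k \<le> real k powr (real k + 1 / 2)"
  proof -
    have "real k ^ k = real k powr real k" using k by (simp add: powr_realpow)
    also have "\<dots> \<le> real k powr (real k + 1 / 2)" using k by (intro powr_mono) auto
    finally show ?thesis .
  qed
  have "X \<le> ((2 * (1 + L)\<^sup>2) ^ k * real k ^ k * noise n) * (((2 * (1 + L))\<^sup>2) ^ k * (4 ^ k * G) / (fact (k0 - 1))\<^sup>2)"
    unfolding X_def
  proof (intro mult_mono divide_right_mono)
    have "(2 * (1 + L)) ^ (2 * k - 1) \<le> (2 * (1 + L)) ^ (2 * k)" using L by (intro power_increasing) auto
    then show "(2 * (1 + L)) ^ (2 * k - 1) \<le> ((2 * (1 + L))\<^sup>2) ^ k" by (simp only: power_mult)
    have "(2 / \<gamma>) ^ (2 * k0 - 2) = 2 ^ (2 * k0 - 2) * G" by (simp add: G_def power_divide)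
    also have "\<dots> \<le> 2 ^ (2 * k) * G" using k G by (intro mult_right_mono power_increasing) auto
    finally show "(2 / \<gamma>) ^ (2 * k0 - 2) \<le> 4 ^ k * G" by (simp add: power_mult)
  qed (use \<delta> L \<gamma> nz in auto)
  also have "\<dots> = (2 * (1 + L)\<^sup>2 * (2 * (1 + L))\<^sup>2 * 4) ^ k / (fact (k0 - 1))\<^sup>2 * (real k ^ k * G * noise n)"
    by (simp only: power_mult_distrib) (simp add: mult_ac)
  also have "2 * (1 + L)\<^sup>2 * (2 * (1 + L))\<^sup>2 * 4 = c" unfolding power_mult_distrib by (simp add: c_def power2_eq_square power4_eq_xxxx)
  also have "c ^ k / (fact (k0 - 1))\<^sup>2 * (real k ^ k * G * noise n) \<le> (exp c * c ^ p) * Y"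
  proof (rule mult_mono)
    \<comment> \<open>One factorial absorbs \<open>c ^ (k0 - 1)\<close> through the exponential
      series; the remaining exponent \<open>k - k0 + 1\<close> is at most \<open>p\<close>, so the
      root of order \<open>p\<close> leaves at most one \<open>c\<close>.\<close>
    have "c ^ k / (fact (k0 - 1))\<^sup>2 = (c ^ (k0 - 1) / fact (k0 - 1)) * (c ^ (k - k0 + 1) / fact (k0 - 1))"
    proof -
      have "k = (k0 - 1) + (k - k0 + 1)" using k by simp
      then have "c ^ k = c ^ (k0 - 1) * c ^ (k - k0 + 1)" by (metis power_add)
      then show ?thesis by (simp add: power2_eq_square)
    qed
    also have "\<dots> \<le> exp c * (c ^ (k - k0 + 1) / 1)"
      using c1 by (intro mult_mono power_div_fact_le_exp divide_left_mono) auto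
    also have "\<dots> \<le> exp c * c ^ p"
      using c1 by (auto intro!: power_increasing simp: p_def simp del: power_Suc)
    finally show "c ^ k / (fact (k0 - 1))\<^sup>2 \<le> exp c * c ^ p" .
    show "real k ^ k * G * noise n \<le> Y" unfolding Y_def using kk G nz by (intro mult_right_mono) auto
  qed (use c1 G nz in auto)
  finally have X: "X \<le> (exp c * c ^ p) * Y" .
  have p1: "1 \<le> real p" by (simp add: p_def)
  have "X powr (1 / real p) \<le> ((exp c * c ^ p) * Y) powr (1 / real p)"
    using X X0 by (intro powr_mono2) auto
  also have "\<dots> = exp c powr (1 / real p) * c * Y powr (1 / real p)"
    using c1 Y p1 by (simp add: powr_mult powr_realpow[symmetric] powr_powr)
  also have "\<dots> \<le> exp c powr 1 * c * Y powr (1 / real p)"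
    using c1 p1 by (intro mult_right_mono powr_mono) auto
  also have "\<dots> = exp c * c * Y powr (1 / real p)" by simp
  finally have "2 * real k * X powr (1 / real p) \<le> 2 * real k * (exp c * c * Y powr (1 / real p))"
    by (intro mult_left_mono) auto
  also have "\<dots> = rate_const L * eps_sep n k k0 \<gamma>"
    unfolding eps_sep_eq[OF k \<gamma> n] by (simp add: rate_const_def c_def Y_def G_def p_def)
  finally show ?thesis by (simp only: X_def p_def)
qed

theorem wasserstein1_le_eps_sep:
  assumes L: "0 < L" and n: "2 \<le> n"
    and w: "w \<in> weight_simplex k'" and \<theta>: "\<theta> \<in> atom_cube L k'" and k': "1 \<le> k'" "k' \<le> k"
    and v: "v \<in> weight_simplex k" and \<phi>: "\<phi> \<in> atom_cube L k"
    and sep: "separated_atoms k v \<phi> k0 \<gamma> \<omega>" and k0: "1 \<le> k0" "k0 \<le> k" and \<gamma>: "0 < \<gamma>" and \<omega>: "0 < \<omega>"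
    and big: "8 * rate_const L * eps_bar n k < \<gamma> * \<omega>"
    and \<delta>: "0 \<le> \<delta>" "\<delta> \<le> (2 * (1 + L)\<^sup>2) ^ k * real k ^ k * noise n"
    and mom: "\<And>r. 1 \<le> r \<Longrightarrow> r < 2 * k \<Longrightarrow> \<bar>mixing_moment k' w \<theta> r - mixing_moment k v \<phi> r\<bar> \<le> \<delta>"
  shows "wasserstein1 (mixing k' w \<theta>) (mixing k v \<phi>) \<le> rate_const L * eps_sep n k k0 \<gamma>"
proof -
  let ?W = "wasserstein1 (mixing k' w \<theta>) (mixing k v \<phi>)"
  have rc: "0 < rate_const L" using L by (simp add: rate_const_def)
  note mom' = mom[unfolded mixing_moment_def]
  \<comment> \<open>With a one-point index set the separation is vacuous, and any atoms serve as
    representatives.\<close>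
  have "?W \<le> 2 * real k * (\<delta> * ((2 * (1 + L)) ^ (2 * k - 1) * (2 / \<gamma>) ^ (2 * card {()} - 2) / (fact (card {()} - 1))\<^sup>2))
      powr (1 / real (2 * (k - card {()}) + 1))"
    by (rule wasserstein1_le_moments[where x = "\<lambda>_. \<phi> 1" and y = "\<lambda>_. \<theta> 1", OF w \<theta> v \<phi> k'(2) \<delta>(1) mom'])
      (use k' \<gamma> in auto)
  also have "\<dots> \<le> rate_const L * eps_sep n k 1 \<gamma>"
    using moment_bound_le_eps_sep[OF L _ _ \<gamma> n \<delta>, of 1] k' by simp
  also have "\<dots> \<le> rate_const L * (2 * eps_bar n k)"
    using rc k' by (intro mult_left_mono eps_sep_one_le_eps_bar[OF _ \<gamma> n]) auto
  \<comment> \<open>The constant 8 is the 2 from \<open>eps_sep_one_le_eps_bar\<close> times the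
    denominator of \<open>\<gamma> / 4\<close>.\<close>
  finally have coarse: "?W < \<gamma> / 4 * \<omega>" using big by (simp add: field_simps)
  obtain P where P: "partition_on {1..k} P" "card P = k0"
    and Psep: "\<And>S T i j. S \<in> P \<Longrightarrow> T \<in> P \<Longrightarrow> S \<noteq> T \<Longrightarrow> i \<in> S \<Longrightarrow> j \<in> T \<Longrightarrow> \<gamma> \<le> \<bar>\<phi> i - \<phi> j\<bar>"
    and Pmass: "\<And>S. S \<in> P \<Longrightarrow> \<omega> \<le> (\<Sum>j\<in>S. v j)"
    using sep unfolding separated_atoms_def by metis
  have Pk: "S \<subseteq> {1..k}" if "S \<in> P" for S using P(1) that by (auto simp: partition_on_def)
  \<comment> \<open>A cluster of mass at least \<open>\<omega>\<close> without an atom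
    \<open>\<theta> h\<close> closer than \<open>\<gamma> / 4\<close> would cost at least
    \<open>\<gamma> / 4 * \<omega>\<close>.\<close>
  have "\<exists>j h. j \<in> S \<and> h \<in> {1..k'} \<and> \<bar>\<theta> h - \<phi> j\<bar> < \<gamma> / 4" if S: "S \<in> P" for S
  proof (rule ccontr)
    assume "\<not> ?thesis"
    then have "\<gamma> / 4 \<le> \<bar>\<theta> h - \<phi> j\<bar>" if "h \<in> {1..k'}" "j \<in> S" for h j using that by force
    then have "\<gamma> / 4 * (\<Sum>j\<in>S. v j) \<le> ?W"
      using \<gamma> by (intro wasserstein1_ge_far_mass[OF w v Pk[OF S]]) auto
    moreover have "\<gamma> / 4 * \<omega> \<le> \<gamma> / 4 * (\<Sum>j\<in>S. v j)" using \<gamma> Pmass[OF S] by (intro mult_left_mono) auto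
    ultimately show False using coarse by linarith
  qed
  then obtain jj hh where jh: "\<And>S. S \<in> P \<Longrightarrow> jj S \<in> S" "\<And>S. S \<in> P \<Longrightarrow> hh S \<in> {1..k'}"
    "\<And>S. S \<in> P \<Longrightarrow> \<bar>\<theta> (hh S) - \<phi> (jj S)\<bar> < \<gamma> / 4"
    by metis
  have fP: "finite P" using P(1) by (rule finite_elements[rotated]) simp
  have "?W \<le> 2 * real k * (\<delta> * ((2 * (1 + L)) ^ (2 * k - 1) * (2 / \<gamma>) ^ (2 * card P - 2) / (fact (card P - 1))\<^sup>2))
      powr (1 / real (2 * (k - card P) + 1))"
  proof (rule wasserstein1_le_moments[where x = "\<lambda>S. \<phi> (jj S)" and y = "\<lambda>S. \<theta> (hh S)", OF w \<theta> v \<phi> k'(2) \<delta>(1) mom' fP])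
    show "P \<noteq> {}" using P(2) k0 by auto
    show "(\<lambda>S. \<phi> (jj S)) ` P \<subseteq> \<phi> ` {1..k}" using jh(1) Pk by blast
    show "(\<lambda>S. \<theta> (hh S)) ` P \<subseteq> \<theta> ` {1..k'}" using jh(2) by blast
    show "0 < \<gamma>" by fact
    \<comment> \<open>Displacements below \<open>\<gamma> / 4\<close> at both ends leave half of the
      separation.\<close>
    show "\<gamma> / 2 \<le> \<bar>\<phi> (jj S) - \<phi> (jj T)\<bar> \<and> \<gamma> / 2 \<le> \<bar>\<theta> (hh S) - \<theta> (hh T)\<bar> \<and> \<gamma> / 2 \<le> \<bar>\<phi> (jj S) - \<theta> (hh T)\<bar>"
      if "S \<in> P" "T \<in> P" "S \<noteq> T" for S T
    proof -
      have "\<gamma> \<le> \<bar>\<phi> (jj S) - \<phi> (jj T)\<bar>" using that jh(1) by (intro Psep[of S T]) auto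
      moreover have "\<bar>\<theta> (hh S) - \<phi> (jj S)\<bar> < \<gamma> / 4" "\<bar>\<theta> (hh T) - \<phi> (jj T)\<bar> < \<gamma> / 4" using that jh(3) by auto
      ultimately show ?thesis using \<gamma> by linarith
    qed
  qed
  also have "\<dots> \<le> rate_const L * eps_sep n k k0 \<gamma>"
    unfolding P(2) by (rule moment_bound_le_eps_sep[OF L k0 \<gamma> n \<delta>])
  finally show ?thesis .
qed

text \<open>The first step beyond \<open>k\<close> keeps the small factor \<open>\<rho>\<close>,
  later steps use only \<open>1 / 2\<close>; the geometric series gives the 2.\<close>

lemma emeasure_pmf_tail:
  fixes \<pi> :: "nat pmf"
  assumes ratio: "\<And>j. k \<le> j \<Longrightarrow> pmf \<pi> (Suc j) \<le> \<rho> * pmf \<pi> j" and \<rho>: "0 \<le> \<rho>" "\<rho> \<le> 1 / 2"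
  shows "emeasure (measure_pmf \<pi>) {k<..} \<le> ennreal (2 * \<rho> * pmf \<pi> k)"
proof -
  have le: "pmf \<pi> (Suc (k + j)) \<le> \<rho> * pmf \<pi> k * (1 / 2) ^ j" for j
  proof (induction j)
    case 0
    then show ?case using ratio[of k] by simp
  next
    case (Suc j)
    have "pmf \<pi> (Suc (k + Suc j)) \<le> \<rho> * pmf \<pi> (Suc (k + j))" using ratio[of "Suc (k + j)"] by simp
    also have "\<dots> \<le> 1 / 2 * (\<rho> * pmf \<pi> k * (1 / 2) ^ j)" using \<rho> Suc by (intro mult_mono) auto
    finally show ?case by simp
  qed
  have "{k<..} = (\<Union>j. {Suc (k + j)})"
    by (auto simp: image_iff) (metis add_Suc less_natE)
  then have "emeasure (measure_pmf \<pi>) {k<..} \<le> (\<Sum>j. emeasure (measure_pmf \<pi>) {Suc (k + j)})"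
    using emeasure_subadditive_countably[of "\<lambda>j. {Suc (k + j)}" "measure_pmf \<pi>"] by simp
  also have "\<dots> \<le> (\<Sum>j. ennreal (\<rho> * pmf \<pi> k * (1 / 2) ^ j))"
    by (intro suminf_le) (auto simp: emeasure_pmf_single intro!: ennreal_leI le)
  also have "\<dots> = ennreal (\<rho> * pmf \<pi> k * (1 / (1 - 1 / 2)))"
    using \<rho> by (intro suminf_ennreal_eq sums_mult geometric_sums) auto
  finally show ?thesis by (simp add: mult_ac)
qed

section \<open>Variance and accuracy of the moment tests\<close>

lemma mixing_moment_abs_le:
  assumes "v \<in> weight_simplex k" "\<phi> \<in> atom_cube L k"
  shows "\<bar>mixing_moment k v \<phi> r\<bar> \<le> L ^ r"
proof -
  have \<phi>: "\<bar>\<phi> j\<bar> \<le> L" if "j \<in> {1..k}" for j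
    using assms(2) that by (auto simp: atom_cube_def PiE_def Pi_def abs_le_iff minus_le_iff)
  have "\<bar>mixing_moment k v \<phi> r\<bar> \<le> (\<Sum>j\<in>{1..k}. v j * \<bar>\<phi> j\<bar> ^ r)"
    unfolding mixing_moment_def using simplex_nonneg[OF assms(1)]
    by (intro order.trans[OF sum_abs] sum_mono) (auto simp: abs_mult power_abs)
  also have "\<dots> \<le> (\<Sum>j\<in>{1..k}. v j * L ^ r)"
    using simplex_nonneg[OF assms(1)] \<phi> by (intro sum_mono mult_left_mono power_mono) auto
  also have "\<dots> = L ^ r" using assms(1) by (simp add: sum_distrib_right[symmetric] weight_simplex_def)
  finally show ?thesis .
qed

text \<open>Evaluated at the highest order \<open>2 * k - 1\<close>. Half of the 4 covers the
  Hermite polynomial, half the squared moment.\<close>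

definition stat_var :: "real \<Rightarrow> nat \<Rightarrow> real" where
  "stat_var L k = 4 * (fact (2 * k - 1) * (1 + L) ^ (2 * (2 * k - 1)))"

lemma stat_var_ge:
  assumes L: "0 < L" and v: "v \<in> weight_simplex k" "\<phi> \<in> atom_cube L k" and r: "r \<in> {1..2 * k - 1}"
  shows "2 * (fact r * (1 + L) ^ (2 * r)) + 2 * (mixing_moment k v \<phi> r)\<^sup>2 \<le> stat_var L k"
proof -
  have f: "(1::real) \<le> fact r" "fact r \<le> (fact (2 * k - 1) :: real)" using r by (auto intro!: fact_mono fact_ge_1)
  have p: "(1 + L) ^ (2 * r) \<le> (1 + L) ^ (2 * (2 * k - 1))" using L r by (intro power_increasing) auto
  have "(mixing_moment k v \<phi> r)\<^sup>2 = \<bar>mixing_moment k v \<phi> r\<bar>\<^sup>2" by simp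
  also have "\<dots> \<le> (L ^ r)\<^sup>2" by (intro power_mono mixing_moment_abs_le v) auto
  also have "\<dots> = L ^ (2 * r)" by (simp add: power_mult[symmetric] mult.commute)
  also have "\<dots> \<le> 1 * (1 + L) ^ (2 * r)" using L by (simp add: power_mono)
  also have "\<dots> \<le> fact r * (1 + L) ^ (2 * r)" using L f by (intro mult_right_mono) auto
  finally have "(mixing_moment k v \<phi> r)\<^sup>2 \<le> fact r * (1 + L) ^ (2 * r)" .
  moreover have "fact r * (1 + L) ^ (2 * r) \<le> fact (2 * k - 1) * (1 + L) ^ (2 * (2 * k - 1))"
    using f p L by (intro mult_mono) auto
  ultimately show ?thesis unfolding stat_var_def by linarith
qed

text \<open>The factor \<open>k\<close> from the bound on \<open>s\<close> raises
  \<open>(2 * k) ^ (2 * k - 1)\<close>, which bounds the factorial, to at most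
  \<open>(2 * k) ^ (2 * k)\<close>, whose root is \<open>(2 * k) ^ k\<close>. The 64 is 16 from
  squaring the leading 4 times 4 from \<open>stat_var\<close>.\<close>

lemma moment_accuracy:
  assumes L: "0 < L" and k: "1 \<le> k" and n: "2 \<le> n" and s: "0 \<le> s" "64 * s \<le> real k * (ln (real n))\<^sup>2"
  shows "4 * sqrt (s * stat_var L k / real n) \<le> (2 * (1 + L)\<^sup>2) ^ k * real k ^ k * noise n"
proof -
  have f: "fact (2 * k - 1) \<le> real (2 * k) ^ (2 * k - 1)"
  proof -
    have "fact (2 * k - 1) \<le> real ((2 * k - 1) ^ (2 * k - 1))" by (rule fact_le_power)
    also have "\<dots> \<le> real (2 * k) ^ (2 * k - 1)" unfolding of_nat_power by (intro power_mono) auto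
    finally show ?thesis .
  qed
  have "real k * (fact (2 * k - 1) * (1 + L) ^ (2 * (2 * k - 1)))
      \<le> real (2 * k) * (real (2 * k) ^ (2 * k - 1) * (1 + L) ^ (4 * k))"
  proof (intro mult_mono f)
    show "(1 + L) ^ (2 * (2 * k - 1)) \<le> (1 + L) ^ (4 * k)" using L by (intro power_increasing) linarith+
  qed (use L in auto)
  also have "\<dots> = real (2 * k) ^ (2 * k) * (1 + L) ^ (4 * k)"
    using power_minus_mult[of "2 * k" "real (2 * k)"] k by (simp only: mult.assoc[symmetric] mult.commute)
  also have "\<dots> = ((2 * (1 + L)\<^sup>2) ^ k * real k ^ k)\<^sup>2"
    by (simp add: power_mult_distrib power_mult[symmetric] mult.commute)
  finally have F: "real k * (fact (2 * k - 1) * (1 + L) ^ (2 * (2 * k - 1))) \<le> ((2 * (1 + L)\<^sup>2) ^ k * real k ^ k)\<^sup>2" .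
  have "16 * (s * stat_var L k / real n) = 64 * s * (fact (2 * k - 1) * (1 + L) ^ (2 * (2 * k - 1))) / real n"
    by (simp add: stat_var_def)
  also have "\<dots> \<le> real k * (ln (real n))\<^sup>2 * (fact (2 * k - 1) * (1 + L) ^ (2 * (2 * k - 1))) / real n"
    using s L by (intro divide_right_mono mult_right_mono) auto
  also have "\<dots> = real k * (fact (2 * k - 1) * (1 + L) ^ (2 * (2 * k - 1))) * ((ln (real n))\<^sup>2 / real n)" by simp
  also have "\<dots> \<le> ((2 * (1 + L)\<^sup>2) ^ k * real k ^ k)\<^sup>2 * ((ln (real n))\<^sup>2 / real n)"
    by (intro mult_right_mono F) auto
  finally have "sqrt (16 * (s * stat_var L k / real n)) \<le> sqrt (((2 * (1 + L)\<^sup>2) ^ k * real k ^ k)\<^sup>2 * ((ln (real n))\<^sup>2 / real n))"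
    by (rule real_sqrt_le_mono)
  then have "sqrt 16 * sqrt (s * stat_var L k / real n) \<le> sqrt (((2 * (1 + L)\<^sup>2) ^ k * real k ^ k)\<^sup>2) * noise n"
    unfolding noise_def real_sqrt_mult[of 16] real_sqrt_mult[of "((2 * (1 + L)\<^sup>2) ^ k * real k ^ k)\<^sup>2"] .
  moreover have "sqrt (((2 * (1 + L)\<^sup>2) ^ k * real k ^ k)\<^sup>2) = (2 * (1 + L)\<^sup>2) ^ k * real k ^ k"
    using L by (intro real_sqrt_unique) auto
  moreover have "sqrt 16 = (4 :: real)" by (rule real_sqrt_unique) auto
  ultimately show ?thesis by simp
qed

text \<open>
  The constant \<open>K = c3 + 2 (c5 + c7) + 1\<close> is chosen so that the type II error \<open>exp (- 2 s)\<close> of the test beats the prior mass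
  \<open>\<Pi>(k) \<beta>\<close> of the ball of radius \<open>1 / n\<^sup>2\<close>. For \<open>kb\<close> of order \<open>ln n / ln ln n\<close>, the assumption
  \<open>64 K kb \<le> ln n\<close> holds for all large \<open>n\<close>.
\<close>

theorem bayes_risk_rate:
  fixes L A c1 c2 c3 c4 c5 c6 c7 :: real and n k kb k0 :: nat
  assumes L: "0 < L" and prior: "is_prior L \<pi> W T" and n: "3 \<le> n" and k: "1 \<le> k" "k \<le> kb"
    and c: "0 < c1" "0 < c2" "0 < c3" "0 < c4" "0 < c5" "0 < c6" "0 < c7"
    and A: "2 * (c5 + c7) + 1 \<le> A" and kb: "64 * (c3 + 2 * (c5 + c7) + 1) * real kb \<le> ln (real n)" and nc1: "2 * c1 \<le> real n"
    and P1: "\<And>j. 1 \<le> j \<Longrightarrow> pmf \<pi> (j + 1) \<le> c1 * exp (- A * real kb * ln (real n)) * pmf \<pi> j"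
    and P1': "\<And>j. j \<in> {1..kb} \<Longrightarrow> c2 * exp (- (c3 * real kb * ln (real n)) * real j) \<le> pmf \<pi> j"
    and P2: "prior_P2 c4 c5 W" and P3: "prior_P3 L c6 c7 T"
    and k0: "1 \<le> k0" "k0 \<le> k" and \<gamma>: "0 < \<gamma>" and \<omega>: "0 < \<omega>"
    and big: "8 * rate_const L * eps_bar n k < \<gamma> * \<omega>"
    and \<nu>s: "\<nu>s \<in> separated_mixings L k k0 \<gamma> \<omega>"
  shows "(\<integral>\<^sup>+ x. posterior n \<pi> W T x
      {\<nu> \<in> (\<Union>k\<in>{1..}. mixings L k). (rate_const L + 1) * eps_sep n k k0 \<gamma> \<le> wasserstein1 \<nu> \<nu>s}
      \<partial>iid_data n (\<nu>s \<star> std_normal)) \<le> ennreal ((7 + 1 / (c2 * c4 * c6) + 2 * c1 / (c4 * c6)) / real n)"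
proof -
  interpret bayes_mixture L \<pi> W T n by unfold_locales (rule prior)
  let ?F = "{\<nu> \<in> (\<Union>k\<in>{1..}. mixings L k). (rate_const L + 1) * eps_sep n k k0 \<gamma> \<le> wasserstein1 \<nu> \<nu>s}"
  obtain v \<phi> where v: "v \<in> weight_simplex k" and \<phi>: "\<phi> \<in> atom_cube L k"
    and sep: "separated_atoms k v \<phi> k0 \<gamma> \<omega>" and \<nu>s_eq: "\<nu>s = mixing k v \<phi>"
    using \<nu>s by (auto simp: separated_mixings_def)
  define K where "K = c3 + 2 * (c5 + c7) + 1"
  define l where "l = ln (real n)"
  define s where "s = K * real kb * real k * l"
  define V where "V = stat_var L k"
  \<comment> \<open>With this scale the variance term is \<open>s / 2\<close>, and
    \<open>\<delta>\<close> makes the linear term \<open>4 * s\<close>. The threshold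
    \<open>\<tau>\<close> then gives the exponents \<open>- s\<close> for type I and
    \<open>- 2 * s\<close> for type II.\<close>
  define a where "a = sqrt (s / (real n * V))"
  define \<tau> where "\<tau> = exp (3 * s / 2)"
  define \<delta> where "\<delta> = 4 * sqrt (s * V / real n)"
  \<comment> \<open>The error \<open>3 * n * \<eta>\<close> of the evidence is \<open>3 / n\<close>,
    while the prior mass of the ball stays polynomial in \<open>n\<close> for fixed
    \<open>k\<close>.\<close>
  define \<eta> where "\<eta> = 1 / (real n)\<^sup>2"
  define \<beta> where "\<beta> = c4 * \<eta> powr (c5 * real k) * (c6 * \<eta> powr (c7 * real k))"
  have l: "1 \<le> l"
  proof -
    have "exp 1 \<le> (3::real)" by (rule exp_le)
    also have "\<dots> \<le> real n" using n by simp
    finally show ?thesis unfolding l_def using n by (subst ln_ge_iff) auto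
  qed
  have nl: "exp (- l) = 1 / real n" using n by (simp add: l_def exp_minus inverse_eq_divide)
  have K: "1 \<le> K" using c by (simp add: K_def)
  have kbk: "1 \<le> real k" "real k \<le> real kb" "1 \<le> real kb" using k by auto
  have s0: "0 < s" using K kbk l unfolding s_def by (intro mult_pos_pos) auto
  have V0: "0 < V" unfolding V_def stat_var_def using L by simp
  have n0: "0 < real n" using n by simp
  have a0: "0 \<le> a" using s0 V0 n0 by (simp add: a_def)
  have a2: "real n * (a\<^sup>2 * V / 2) = s / 2" using s0 V0 n0 by (simp add: a_def field_simps)
  have a\<delta>: "real n * (a * \<delta>) = 4 * s"
  proof -
    have "a * \<delta> = 4 * sqrt ((s / (real n * V)) * (s * V / real n))" by (simp only: a_def \<delta>_def real_sqrt_mult)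
    also have "(s / (real n * V)) * (s * V / real n) = (s / real n)\<^sup>2" using V0 by (simp add: power2_eq_square)
    finally show ?thesis using s0 n0 by simp
  qed
  have \<eta>: "0 < \<eta>" "\<eta> \<le> 1" "\<eta> < 1 / real k"
  proof -
    show "0 < \<eta>" "\<eta> \<le> 1" using n by (auto simp: \<eta>_def)
    have "real k \<le> 64 * K * real kb" using K kbk mult_mono[of 1 "64 * K" "real k" "real kb"] by simp
    also have "\<dots> \<le> ln (real n)" using kb by (simp only: K_def)
    also have "\<dots> < real n" using n by (intro ln_less_self) auto
    also have "\<dots> \<le> (real n)\<^sup>2" using n by (simp add: power2_eq_square)
    finally show "\<eta> < 1 / real k" using kbk n by (simp add: \<eta>_def field_simps)
  qed
  have \<beta>0: "0 < \<beta>" using c \<eta> by (simp add: \<beta>_def)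
  have \<beta>_eq: "\<beta> = c4 * c6 * exp (- (2 * (c5 + c7) * real k * l))"
  proof -
    have "\<eta> = exp (- (2 * l))" using n by (simp add: \<eta>_def l_def exp_minus exp_double inverse_eq_divide)
    then have "\<eta> powr x = exp (- (2 * x * l))" for x by (simp add: powr_def mult_ac)
    then show ?thesis by (simp add: \<beta>_def exp_add[symmetric] algebra_simps)
  qed
  have ball: "\<beta> \<le> measure (W k) {w \<in> space (W k). (\<Sum>j\<in>{1..k}. \<bar>w j - v j\<bar>) \<le> \<eta>} *
      measure (T k) {\<theta> \<in> space (T k). (MAX j\<in>{1..k}. \<bar>\<theta> j - \<phi> j\<bar>) \<le> \<eta>}"
    unfolding \<beta>_def
  proof (rule mult_mono)
    show "c4 * \<eta> powr (c5 * real k) \<le> measure (W k) {w \<in> space (W k). (\<Sum>j\<in>{1..k}. \<bar>w j - v j\<bar>) \<le> \<eta>}"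
      using P2 k v \<eta> unfolding prior_P2_def by blast
    show "c6 * \<eta> powr (c7 * real k) \<le> measure (T k) {\<theta> \<in> space (T k). (MAX j\<in>{1..k}. \<bar>\<theta> j - \<phi> j\<bar>) \<le> \<eta>}"
      using P3 k \<phi> \<eta> unfolding prior_P3_def by blast
  qed (use c in auto)
  have pk: "c2 * exp (- (c3 * real kb * real k * l)) \<le> pmf \<pi> k"
    using P1'[of k] k by (simp add: l_def mult_ac)
  have pk0: "0 < pmf \<pi> k" by (rule less_le_trans[OF _ pk]) (use c in simp)
  have far: "\<exists>r\<in>{1..2 * k - 1}. \<delta> \<le> \<bar>mixing_moment k' w \<theta> r - mixing_moment k v \<phi> r\<bar>"
    if "1 \<le> k'" "k' \<le> k" "w \<in> weight_simplex k'" "\<theta> \<in> atom_cube L k'" "mixing k' w \<theta> \<in> ?F" for k' w \<theta>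
  proof (rule ccontr)
    assume "\<not> ?thesis"
    then have mom: "\<bar>mixing_moment k' w \<theta> r - mixing_moment k v \<phi> r\<bar> \<le> \<delta>" if "1 \<le> r" "r < 2 * k" for r
      using that by (intro less_imp_le) (auto simp: not_le)
    have "64 * s \<le> real k * (ln (real n))\<^sup>2"
    proof -
      have "64 * s = (64 * K * real kb) * (real k * l)" by (simp add: s_def)
      also have "\<dots> \<le> l * (real k * l)" using kb l unfolding K_def by (intro mult_right_mono) (auto simp: l_def)
      finally show ?thesis by (simp add: l_def power2_eq_square mult_ac)
    qed
    then have \<delta>: "0 \<le> \<delta>" "\<delta> \<le> (2 * (1 + L)\<^sup>2) ^ k * real k ^ k * noise n"
      using moment_accuracy[OF L k(1) _ less_imp_le[OF s0]] n s0 V0 by (auto simp: \<delta>_def V_def)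
    have n2: "2 \<le> n" using n by simp
    have "wasserstein1 (mixing k' w \<theta>) (mixing k v \<phi>) \<le> rate_const L * eps_sep n k k0 \<gamma>"
      by (rule wasserstein1_le_eps_sep[OF L n2 that(3,4,1,2) v \<phi> sep k0 \<gamma> \<omega> big \<delta> mom])
    also have "\<dots> < (rate_const L + 1) * eps_sep n k k0 \<gamma>"
      using eps_sep_pos[OF k0 \<gamma> n2] by simp
    finally show False using that(5) \<nu>s_eq by simp
  qed
  \<comment> \<open>The ratio of successive model probabilities; by the choice of \<open>A\<close>
    it compensates \<open>1 / \<beta>\<close> and leaves a factor \<open>1 / n\<close>.\<close>
  define \<rho> where "\<rho> = c1 * exp (- A * real kb * l)"
  have Akb: "2 * (c5 + c7) * real k + 1 \<le> A * real kb"
  proof -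
    have "2 * (c5 + c7) * real k + 1 \<le> 2 * (c5 + c7) * real kb + real kb"
      using c kbk by (intro add_mono mult_left_mono) auto
    also have "\<dots> = (2 * (c5 + c7) + 1) * real kb" by (simp add: algebra_simps)
    also have "\<dots> \<le> A * real kb" using A by (intro mult_right_mono) auto
    finally show ?thesis .
  qed
  have \<rho>: "0 \<le> \<rho>" "\<rho> \<le> 1 / 2"
  proof -
    show "0 \<le> \<rho>" using c by (simp add: \<rho>_def)
    have "1 * l \<le> A * real kb * l" using Akb c kbk l by (intro mult_right_mono) (auto intro: order.trans[rotated])
    then have "exp (- A * real kb * l) \<le> exp (- l)" by simp
    then have "\<rho> \<le> c1 * (1 / real n)" unfolding \<rho>_def nl using c by (intro mult_left_mono) auto
    also have "\<dots> \<le> 1 / 2" using nc1 n0 by (simp add: field_simps)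
    finally show "\<rho> \<le> 1 / 2" .
  qed
  have tail: "emeasure (measure_pmf \<pi>) {k<..} \<le> ennreal (2 * \<rho> * pmf \<pi> k)"
    by (rule emeasure_pmf_tail) (use P1 k \<rho> in \<open>auto simp: \<rho>_def l_def\<close>)
  have "(\<integral>\<^sup>+ x. posterior n \<pi> W T x ?F \<partial>iid_data n (\<nu>s \<star> std_normal)) \<le>
    ennreal (2 * real (2 * k - 1) * exp (real n * (a\<^sup>2 * V / 2)) / \<tau>) + ennreal (3 * real n * \<eta>) +
    (ennreal (\<tau> * exp (real n * (a\<^sup>2 * V / 2 - a * \<delta>))) + emeasure (measure_pmf \<pi>) {k<..}) / ennreal (pmf \<pi> k * \<beta>)"
    unfolding \<nu>s_eq
    by (rule bayes_risk_bound[OF k(1) pk0 v \<phi> less_imp_le[OF \<eta>(1)] \<eta>(2) \<beta>0 ball _ a0])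
      (use stat_var_ge[OF L v \<phi>] far in \<open>auto simp: V_def \<tau>_def \<nu>s_eq\<close>)
  also have "2 * real (2 * k - 1) * exp (real n * (a\<^sup>2 * V / 2)) / \<tau> = 2 * real (2 * k - 1) * exp (- s)"
  proof -
    have "exp (s / 2) / \<tau> = exp (- s)" unfolding \<tau>_def exp_diff[symmetric] by simp
    then show ?thesis unfolding a2 by (metis times_divide_eq_right)
  qed
  also have "3 * real n * \<eta> = 3 / real n" using n0 by (simp add: \<eta>_def power2_eq_square)
  also have "\<tau> * exp (real n * (a\<^sup>2 * V / 2 - a * \<delta>)) = exp (- (2 * s))"
    unfolding right_diff_distrib a2 a\<delta> \<tau>_def by (simp add: exp_add[symmetric])
  also have "ennreal (2 * real (2 * k - 1) * exp (- s)) + ennreal (3 / real n) +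
      (ennreal (exp (- (2 * s))) + emeasure (measure_pmf \<pi>) {k<..}) / ennreal (pmf \<pi> k * \<beta>)
    \<le> ennreal (2 * real (2 * k - 1) * exp (- s)) + ennreal (3 / real n) +
      (ennreal (exp (- (2 * s))) + ennreal (2 * \<rho> * pmf \<pi> k)) / ennreal (pmf \<pi> k * \<beta>)"
    by (intro add_mono divide_right_mono_ennreal tail) auto
  also have "\<dots> = ennreal (2 * real (2 * k - 1) * exp (- s) + 3 / real n +
      (exp (- (2 * s)) + 2 * \<rho> * pmf \<pi> k) / (pmf \<pi> k * \<beta>))"
    using \<rho>(1) pk0 \<beta>0 by (simp add: divide_ennreal ennreal_plus[symmetric] del: ennreal_plus)
  also have "\<dots> \<le> ennreal ((7 + 1 / (c2 * c4 * c6) + 2 * c1 / (c4 * c6)) / real n)"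
  proof (rule ennreal_leI)
    \<comment> \<open>The number of tests grows with \<open>k\<close>, but
      \<open>k \<le> exp ((k - 1) * l)\<close> and \<open>k * l \<le> s\<close>, so a factor
      \<open>1 / n\<close> remains.\<close>
    have "2 * real (2 * k - 1) * exp (- s) \<le> 4 * exp (- l)"
    proof -
      have "real k \<le> 1 + (real k - 1) * l" using kbk l mult_left_mono[of 1 l "real k - 1"] by simp
      also have "\<dots> \<le> exp ((real k - 1) * l)" by (rule exp_ge_add_one_self)
      finally have k_le: "real k \<le> exp ((real k - 1) * l)" .
      have "real k * l \<le> s"
      proof -
        have "1 * 1 \<le> K * real kb" using K kbk by (intro mult_mono) auto
        then show ?thesis unfolding s_def mult.assoc[of "K * real kb"]
          using kbk l mult_right_mono[of 1 "K * real kb" "real k * l"] by simp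
      qed
      then have es: "exp (- s) \<le> exp (- (real k * l))" by simp
      have "2 * real (2 * k - 1) * exp (- s) \<le> 4 * exp ((real k - 1) * l) * exp (- (real k * l))"
      proof (rule mult_mono)
        have "2 * real (2 * k - 1) \<le> 4 * real k" by simp
        also have "\<dots> \<le> 4 * exp ((real k - 1) * l)" using k_le by simp
        finally show "2 * real (2 * k - 1) \<le> 4 * exp ((real k - 1) * l)" .
      qed (use es in auto)
      also have "\<dots> = 4 * exp (- l)" by (simp add: exp_add[symmetric] algebra_simps)
      finally show ?thesis .
    qed
    moreover have "exp (- (2 * s)) / (pmf \<pi> k * \<beta>) \<le> 1 / (c2 * c4 * c6) * exp (- l)"
    proof -
      have "c2 * exp (- (c3 * real kb * real k * l)) * \<beta> \<le> pmf \<pi> k * \<beta>" using pk \<beta>0 by (intro mult_right_mono) auto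
      then have "exp (- (2 * s)) / (pmf \<pi> k * \<beta>) \<le> exp (- (2 * s)) / (c2 * exp (- (c3 * real kb * real k * l)) * \<beta>)"
        using c \<beta>0 pk0 by (intro divide_left_mono) auto
      also have "\<dots> = 1 / (c2 * c4 * c6) * exp (- (2 * s) + c3 * real kb * real k * l + 2 * (c5 + c7) * real k * l)"
      proof -
        have "exp (- (2 * s)) / (c2 * exp (- u) * (c4 * c6 * exp (- t))) = 1 / (c2 * c4 * c6) * exp (- (2 * s) + u + t)"
          for u t using c by (simp add: exp_add exp_diff exp_minus field_simps)
        then show ?thesis unfolding \<beta>_eq .
      qed
      also have "\<dots> \<le> 1 / (c2 * c4 * c6) * exp (- l)"
      proof (intro mult_left_mono)
        \<comment> \<open>The three summands of \<open>K\<close> pay for the probability of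
          \<open>k\<close>, the mass of the ball and a factor \<open>1 / n\<close>.\<close>
        have "2 * (c5 + c7) * (real k * l) \<le> 2 * (c5 + c7) * (real kb * (real k * l))"
          using c kbk l mult_right_mono[of 1 "real kb" "real k * l"] by (intro mult_left_mono) auto
        moreover have "1 * l \<le> (real kb * real k) * l"
          using kbk l mult_mono[of 1 "real kb" 1 "real k"] by (intro mult_right_mono) auto
        moreover have "s = c3 * real kb * real k * l + 2 * (c5 + c7) * (real kb * (real k * l)) + (real kb * real k) * l"
          by (simp add: s_def K_def algebra_simps)
        ultimately have "c3 * real kb * real k * l + 2 * (c5 + c7) * real k * l + l \<le> s"
          by (simp add: mult.assoc)
        then show "exp (- (2 * s) + c3 * real kb * real k * l + 2 * (c5 + c7) * real k * l) \<le> exp (- l)"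
          using s0 by simp
      qed (use c in auto)
      finally show ?thesis .
    qed
    \<comment> \<open>The tail is proportional to \<open>pmf \<pi> k\<close>, which cancels; so the
      lower bound on \<open>A\<close> involves only \<open>c5\<close> and \<open>c7\<close>.\<close>
    moreover have "2 * \<rho> * pmf \<pi> k / (pmf \<pi> k * \<beta>) \<le> 2 * c1 / (c4 * c6) * exp (- l)"
    proof -
      have "2 * \<rho> * pmf \<pi> k / (pmf \<pi> k * \<beta>) = 2 * c1 / (c4 * c6) * exp (- A * real kb * l + 2 * (c5 + c7) * real k * l)"
      proof -
        have "2 * (c1 * exp u) * pmf \<pi> k / (pmf \<pi> k * (c4 * c6 * exp (- t))) = 2 * c1 / (c4 * c6) * exp (u + t)"
          for u t using c pk0 by (simp add: exp_add exp_minus field_simps)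
        then show ?thesis unfolding \<beta>_eq \<rho>_def .
      qed
      also have "\<dots> \<le> 2 * c1 / (c4 * c6) * exp (- l)"
      proof (intro mult_left_mono)
        have "(2 * (c5 + c7) * real k + 1) * l \<le> A * real kb * l" using Akb l by (intro mult_right_mono) auto
        then show "exp (- A * real kb * l + 2 * (c5 + c7) * real k * l) \<le> exp (- l)" by (simp add: algebra_simps)
      qed (use c in auto)
      finally show ?thesis .
    qed
    ultimately show "2 * real (2 * k - 1) * exp (- s) + 3 / real n + (exp (- (2 * s)) + 2 * \<rho> * pmf \<pi> k) / (pmf \<pi> k * \<beta>)
        \<le> (7 + 1 / (c2 * c4 * c6) + 2 * c1 / (c4 * c6)) / real n"
      unfolding nl add_divide_distrib by simp
  qed
  finally show ?thesis .
qed

theorem theorem2p3: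
  fixes L :: real
  assumes "L > 0"
  shows "\<exists>M0>0. \<exists>M>0. \<forall>M'\<ge>M0. \<forall>c1>0. \<forall>c4>0. \<forall>c5>0. \<forall>c6>0. \<forall>c7>0. \<exists>A0>0. \<forall>A\<ge>A0. \<forall>c2>0. \<forall>c3>0.
    \<forall>(kbar :: nat \<Rightarrow> nat) (kstar :: nat \<Rightarrow> nat) (k0 :: nat \<Rightarrow> nat)
      (\<gamma> :: nat \<Rightarrow> real) (\<omega> :: nat \<Rightarrow> real)
      (\<pi> :: nat \<Rightarrow> nat pmf) (W :: nat \<Rightarrow> (nat \<Rightarrow> real) measure) (T :: nat \<Rightarrow> (nat \<Rightarrow> real) measure).
      (\<forall>n\<ge>1. 1 \<le> kstar n \<and> kstar n \<le> kbar n) \<and>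
      (\<exists>C>0. \<forall>n\<ge>3. real (kbar n) \<le> C * (ln (real n) / ln (ln (real n)))) \<and>
      (\<forall>n\<ge>1. k0 n \<in> {1..kstar n} \<and> \<gamma> n > 0 \<and> \<omega> n > 0 \<and> \<gamma> n * \<omega> n > M' * eps_bar n (kstar n)) \<and>
      (\<forall>n\<ge>1. is_prior L (\<pi> n) W T) \<and>
      prior_P1 c1 A c2 c3 kbar \<pi> \<and> prior_P2 c4 c5 W \<and> prior_P3 L c6 c7 T
      \<longrightarrow>
      (\<lambda>n. SUP \<nu>s\<in>separated_mixings L (kstar n) (k0 n) (\<gamma> n) (\<omega> n).
         \<integral>\<^sup>+ x. posterior n (\<pi> n) W T x
           {\<nu> \<in> (\<Union>k\<in>{1..}. mixings L k). wasserstein1 \<nu> \<nu>s \<ge> M * eps_sep n (kstar n) (k0 n) (\<gamma> n)}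
         \<partial>iid_data n (\<nu>s \<star> std_normal)) \<longlonglongrightarrow> 0"
proof -
  define M2 where "M2 = rate_const L"
  have M2: "0 < M2" using assms by (simp add: M2_def rate_const_def)
  show ?thesis
  \<comment> \<open>\<open>M0\<close> and \<open>M\<close> depend on \<open>L\<close> only. The 1 in
    \<open>M2 + 1\<close> turns the bound by \<open>M2\<close> times the positive rate into a strict
    inequality, as the event \<open>\<ge>\<close> requires.\<close>
  proof (rule exI[of _ "8 * M2"], intro conjI, use M2 in simp, rule exI[of _ "M2 + 1"], intro conjI, use M2 in simp,
      intro allI impI, rule_tac x = "2 * (c5 + c7) + 1" in exI, intro conjI, simp add: add_pos_pos, intro allI impI, goal_cases)
    case (1 M' c1 c4 c5 c6 c7 A c2 c3 kbar kstar k0 \<gamma> \<omega> \<pi> W T)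
    note M' = \<open>8 * M2 \<le> M'\<close> and A = \<open>2 * (c5 + c7) + 1 \<le> A\<close>
    from 1 have k: "\<And>n. 1 \<le> n \<Longrightarrow> 1 \<le> kstar n \<and> kstar n \<le> kbar n"
      and kb: "\<exists>C>0. \<forall>n\<ge>3. real (kbar n) \<le> C * (ln (real n) / ln (ln (real n)))"
      and k0: "\<And>n. 1 \<le> n \<Longrightarrow> k0 n \<in> {1..kstar n} \<and> \<gamma> n > 0 \<and> \<omega> n > 0 \<and> \<gamma> n * \<omega> n > M' * eps_bar n (kstar n)"
      and pr: "\<And>n. 1 \<le> n \<Longrightarrow> is_prior L (\<pi> n) W T"
      and P: "prior_P1 c1 A c2 c3 kbar \<pi>" "prior_P2 c4 c5 W" "prior_P3 L c6 c7 T"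
      by blast+
    obtain C where C: "0 < C" "\<And>n. 3 \<le> n \<Longrightarrow> real (kbar n) \<le> C * (ln (real n) / ln (ln (real n)))"
      using kb by blast
    define K where "K = c3 + 2 * (c5 + c7) + 1"
    have K: "0 < K" using 1 by (simp add: K_def add_pos_pos)
    define H where "H = 7 + 1 / (c2 * c4 * c6) + 2 * c1 / (c4 * c6)"
    let ?R = "\<lambda>n. SUP \<nu>s\<in>separated_mixings L (kstar n) (k0 n) (\<gamma> n) (\<omega> n).
         \<integral>\<^sup>+ x. posterior n (\<pi> n) W T x
           {\<nu> \<in> (\<Union>k\<in>{1..}. mixings L k). wasserstein1 \<nu> \<nu>s \<ge> (M2 + 1) * eps_sep n (kstar n) (k0 n) (\<gamma> n)}
         \<partial>iid_data n (\<nu>s \<star> std_normal)"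
    \<comment> \<open>Once \<open>ln (ln n)\<close> exceeds \<open>64 * K * C\<close>, the assumed
      growth of \<open>kbar\<close> yields \<open>64 * K * kbar n \<le> ln n\<close>.\<close>
    have "\<forall>\<^sub>F n in sequentially. 64 * K * C \<le> ln (ln (real n))" by real_asymp
    moreover have "\<forall>\<^sub>F n in sequentially. 2 * c1 \<le> real n" by real_asymp
    ultimately have ev: "\<forall>\<^sub>F n in sequentially. ?R n \<le> ennreal (H / real n)"
      using eventually_ge_at_top[of 3]
    proof eventually_elim
      case (elim n)
      then have n1: "1 \<le> n" by simp
      have lln: "0 < ln (ln (real n))" using elim(1) K C(1) by (meson less_le_trans mult_pos_pos zero_less_numeral)
      have ln0: "0 \<le> ln (real n)" using elim by simp
      have "64 * K * real (kbar n) \<le> 64 * K * (C * (ln (real n) / ln (ln (real n))))"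
        using K by (intro mult_left_mono C(2) elim) auto
      also have "\<dots> = (64 * K * C) * (ln (real n) / ln (ln (real n)))" by simp
      also have "\<dots> \<le> ln (ln (real n)) * (ln (real n) / ln (ln (real n)))"
        using lln ln0 by (intro mult_right_mono elim) auto
      also have "\<dots> = ln (real n)" using lln by simp
      finally have kbn: "64 * K * real (kbar n) \<le> ln (real n)" .
      have "8 * M2 * eps_bar n (kstar n) \<le> M' * eps_bar n (kstar n)"
        using M' by (intro mult_right_mono) (auto simp: eps_bar_def)
      then have big: "8 * M2 * eps_bar n (kstar n) < \<gamma> n * \<omega> n" using k0[OF n1] by linarith
      show "?R n \<le> ennreal (H / real n)"
        unfolding H_def
        by (rule SUP_least, unfold M2_def,
            rule bayes_risk_rate)
          (use 1 assms elim pr[OF n1] k[OF n1] k0[OF n1] A P kbn big n1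
            in \<open>auto simp: K_def M2_def prior_P1_def\<close>)
    qed
    have lim: "(\<lambda>n. ennreal (H / real n)) \<longlonglongrightarrow> 0"
    proof -
      have "(\<lambda>n. H / real n) \<longlonglongrightarrow> 0" by real_asymp
      then show ?thesis using tendsto_ennrealI by fastforce
    qed
    show "?R \<longlonglongrightarrow> 0"
      by (rule tendsto_sandwich[OF _ ev tendsto_const lim]) simp
  qed
qed

end
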